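(* Let $M=G/H$ be a homogeneous space endowed with a $G$-invariant Riemannian metric and a solid homogeneous cone field $C_M$. Suppose that the conal order $\leq_M$ is quasi-closed and that the chronological sets $I^+$ and $I^-$ are continuous. Let $\varphi_t$ be the flow of a continuously differentiable vector field on $M$ which is strongly differentially positive with respect to $C_M$ and such that each orbit is well-defined for all $t\ge 0$ and has compact closure. Let $\mu$ be an invariant probability measure of $\varphi_t$ on $M$ and let $B$ be any connected component of $\mathrm{supp}(\mu)$. Then $B$ is either strongly ordered (any two distinct points of $B$ are strongly ordered) or unordered (any two distinct points of $B$ are unordered).
   Context: Setting: $G$ is a connected Lie group endowed with a left-invariant Riemannian metric, $H$ a closed subgroup, $M=G/H$ with its smooth transitive left action $(g,x)\mapsto g\cdot x$, and $\lambda_g(x)=g\cdot x$. A Riemannian metric on $M$ is $G$-invariant if every $\lambda_g$ is an isometry. Cone fields: a closed convex cone in a finite-dimensional real vector space is a nonempty closed subset $C$ with $C+C\subset C$, $\alpha C\subset C$ for all $\alpha\ge 0$, and $C\cap(-C)=\{0\}$; it is solid if $\mathrm{Int}\,C\neq\emptyset$. A cone field $C_M$ on $M$ assigns to each $x\in M$ a closed convex cone $C_M(x)\subset T_xM$; it is solid if every $C_M(x)$ is solid, and homogeneous if $d\lambda_g|_x(C_M(x))=C_M(g\cdot x)$ for all $g\in G$, $x\in M$. Orders: a conal curve is a continuous, piecewise continuously differentiable curve $\gamma:[t_0,t_1]\to M$, $t_0<t_1$, with $\gamma'(t)\in C_M(\gamma(t))$ for $t_0\le t<t_1$ (right-hand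 derivative at the finitely many points where the derivative is not continuous); it is strictly conal if moreover $\gamma'(t)\in\mathrm{Int}\,C_M(\gamma(t))$ for $t_0\le t<t_1$. Write $x\leq_M y$ if there is a conal curve from $x$ to $y$ (the conal order; reflexive and transitive, not necessarily antisymmetric), and $x\ll_M y$ if there is a strictly conal curve from $x$ to $y$. Points $x,y$ are strongly ordered if $x\ll_M y$ or $y\ll_M x$, and unordered if neither $x\leq_M y$ nor $y\leq_M x$. The order $\leq_M$ is quasi-closed if $x\leq_M y$ whenever $x_n\to x$, $y_n\to y$ and $x_n\ll_M y_n$ for all $n$. Chronological sets: $I^+(p)=\{q: p\ll_M q\}$, $I^-(p)=\{q: q\ll_M p\}$. $I^{+}$ is inner continuous at $p$ if for each compact $K\subset I^{+}(p)$ there is a neighborhood $U$ of $p$ with $K\subset I^{+}(q)$ for all $q\in U$; outer continuous at $p$ if for each compact $K\subset M\setminus\overline{I^{+}(p)}$ there is a neighborhood $U$ of $p$ with $K\subset M\setminus\overline{I^{+}(q)}$ for all $q\in U$; continuous if it is inner and outer continuous at every $p\in M$. Likewise for $I^-$. Dynamics: the flow $\varphi:\mathbb{R}\times M\to M$ is strongly differentially positive with respect to $C_M$ if $d\varphi_t(x)\{C_M(x)\setminus\{0\}\}\subseteq \mathrm{Int}\,C_M(\varphi_t(x))$ for all $x\in M$, $t>0$. The orbit of $x$ is $O(x)=\{\varphi_t(x):t\in\mathbb{R}\}$. A (Borel) probability measure $\mu$ on $M$ is invariant if it is preserved by every $\varphi_t$; $\mathrm{supp}(\mu)$ is the complement in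 $M$ of the union of all open sets $U$ with $\mu(U)=0$. *)

theory Defs
  imports "HOL-Probability.Probability" "HOL-Algebra.Left_Coset"
begin

section \<open>Smooth manifolds\<close>

primrec Ck_on :: "nat \<Rightarrow> ('e::real_normed_vector \<Rightarrow> 'f::real_normed_vector) \<Rightarrow> 'e set \<Rightarrow> bool" where
  "Ck_on 0 f S \<longleftrightarrow> continuous_on S f"
| "Ck_on (Suc k) f S \<longleftrightarrow>
     (\<forall>x\<in>S. f differentiable (at x)) \<and>
     (\<forall>v. Ck_on k (\<lambda>x. frechet_derivative f (at x) v) S)"

text \<open>Only used for open \<open>S\<close> and finite-dimensional domains, where continuity of all directional
  derivatives is continuity of the total derivative.\<close>

type_synonym ('a, 'e) chart = "'a set \<times> ('a \<Rightarrow> 'e)"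

text \<open>A chart is its domain together with the coordinate map, whose values outside the domain are
  irrelevant. The atlas need not be maximal.\<close>

record ('a, 'e) manifold =
  mtop :: "'a topology"
  atlas :: "('a, 'e) chart set"

abbreviation chart_inv :: "('a, 'e) chart \<Rightarrow> 'e \<Rightarrow> 'a" where
  "chart_inv c \<equiv> inv_into (fst c) (snd c)"

definition is_chart :: "'a topology \<Rightarrow> ('a, 'e::euclidean_space) chart \<Rightarrow> bool" where
  "is_chart X c \<longleftrightarrow> openin X (fst c) \<and> open (snd c ` fst c) \<and>
     homeomorphic_map (subtopology X (fst c)) (top_of_set (snd c ` fst c)) (snd c)"

definition smooth_manifold :: "('a, 'e::euclidean_space) manifold \<Rightarrow> bool" where
  "smooth_manifold N \<longleftrightarrow>
     Hausdorff_space (mtop N) \<and> second_countable (mtop N) \<and>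
     (\<forall>c\<in>atlas N. is_chart (mtop N) c) \<and>
     (\<Union>c\<in>atlas N. fst c) = topspace (mtop N) \<and>
     (\<forall>c\<in>atlas N. \<forall>d\<in>atlas N. \<forall>k.
        Ck_on k (snd d \<circ> chart_inv c) (snd c ` (fst c \<inter> fst d)))"

definition charts_at :: "('a, 'e) manifold \<Rightarrow> 'a \<Rightarrow> ('a, 'e) chart set" where
  "charts_at N x = {c \<in> atlas N. x \<in> fst c}"

definition Ck_map ::
  "nat \<Rightarrow> ('a, 'e::euclidean_space) manifold \<Rightarrow> ('b, 'f::euclidean_space) manifold \<Rightarrow> ('a \<Rightarrow> 'b) \<Rightarrow> bool"
  where
  "Ck_map k N N' f \<longleftrightarrow> continuous_map (mtop N) (mtop N') f \<and>
     (\<forall>c\<in>atlas N. \<forall>d\<in>atlas N'.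
        Ck_on k (snd d \<circ> f \<circ> chart_inv c) (snd c ` {p \<in> fst c. f p \<in> fst d}))"

definition smooth_map ::
  "('a, 'e::euclidean_space) manifold \<Rightarrow> ('b, 'f::euclidean_space) manifold \<Rightarrow> ('a \<Rightarrow> 'b) \<Rightarrow> bool"
  where "smooth_map N N' f \<longleftrightarrow> (\<forall>k. Ck_map k N N' f)"

definition prod_manifold ::
  "('a, 'e) manifold \<Rightarrow> ('b, 'f) manifold \<Rightarrow> ('a \<times> 'b, 'e \<times> 'f) manifold" where
  "prod_manifold N N' =
     \<lparr>mtop = prod_topology (mtop N) (mtop N'),
      atlas = {(fst c \<times> fst d, map_prod (snd c) (snd d)) | c d. c \<in> atlas N \<and> d \<in> atlas N'}\<rparr>"

definition real_line :: "(real, real) manifold" where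
  "real_line = \<lparr>mtop = euclideanreal, atlas = {(UNIV, id)}\<rparr>"

section \<open>Tangent vectors\<close>

text \<open>A tangent vector at \<open>x\<close> is the family of its coordinate vectors in all charts around \<open>x\<close>,
  related by the derivatives of the transition maps; it is extended by \<open>0\<close> to all other charts.
  The vector space structure is pointwise.\<close>

type_synonym ('a, 'e) tangent = "('a, 'e) chart \<Rightarrow> 'e"

definition tangent_space ::
  "('a, 'e::euclidean_space) manifold \<Rightarrow> 'a \<Rightarrow> ('a, 'e) tangent set" where
  "tangent_space N x =
     {v. (\<forall>c\<in>charts_at N x. \<forall>d\<in>charts_at N x.
            v d = frechet_derivative (snd d \<circ> chart_inv c) (at (snd c x)) (v c)) \<and>
         (\<forall>c. c \<notin> charts_at N x \<longrightarrow> v c = 0)}"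

text \<open>The topology on the type of tangents is the product topology; on the finite-dimensional
  subspace \<open>tangent_space N x\<close> it induces the usual topology.\<close>

definition tangent_topology ::
  "('a, 'e::euclidean_space) manifold \<Rightarrow> 'a \<Rightarrow> ('a, 'e) tangent topology" where
  "tangent_topology N x = top_of_set (tangent_space N x)"

definition tangent_of_coord ::
  "('a, 'e::euclidean_space) manifold \<Rightarrow> ('a, 'e) chart \<Rightarrow> 'a \<Rightarrow> 'e \<Rightarrow> ('a, 'e) tangent" where
  "tangent_of_coord N c x e =
     (\<lambda>d. if d \<in> charts_at N x
          then frechet_derivative (snd d \<circ> chart_inv c) (at (snd c x)) e else 0)"

text \<open>For \<open>f\<close> differentiable at \<open>x\<close>, the value does not depend on the chosen chart around \<open>x\<close>.\<close>

definition mdiff ::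
  "('a, 'e::euclidean_space) manifold \<Rightarrow> ('b, 'f::euclidean_space) manifold \<Rightarrow> ('a \<Rightarrow> 'b) \<Rightarrow> 'a
     \<Rightarrow> ('a, 'e) tangent \<Rightarrow> ('b, 'f) tangent" where
  "mdiff N N' f x v =
     (let c = (SOME c. c \<in> charts_at N x) in
      (\<lambda>d. if d \<in> charts_at N' (f x)
           then frechet_derivative (snd d \<circ> f \<circ> chart_inv c) (at (snd c x)) (v c) else 0))"

definition Ck_vector_field ::
  "nat \<Rightarrow> ('a, 'e::euclidean_space) manifold \<Rightarrow> ('a \<Rightarrow> ('a, 'e) tangent) \<Rightarrow> bool" where
  "Ck_vector_field k N X \<longleftrightarrow>
     (\<forall>x\<in>topspace (mtop N). X x \<in> tangent_space N x) \<and>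
     (\<forall>c\<in>atlas N. Ck_on k (\<lambda>y. X (chart_inv c y) c) (snd c ` fst c))"

definition riemannian_metric ::
  "('a, 'e::euclidean_space) manifold
     \<Rightarrow> ('a \<Rightarrow> ('a, 'e) tangent \<Rightarrow> ('a, 'e) tangent \<Rightarrow> real) \<Rightarrow> bool" where
  "riemannian_metric N \<rho> \<longleftrightarrow>
     (\<forall>x\<in>topspace (mtop N). \<forall>u\<in>tangent_space N x. \<forall>v\<in>tangent_space N x.
        \<rho> x u v = \<rho> x v u \<and>
        (\<forall>w\<in>tangent_space N x. \<rho> x (\<lambda>c. u c + v c) w = \<rho> x u w + \<rho> x v w) \<and>
        (\<forall>a. \<rho> x (\<lambda>c. a *\<^sub>R u c) v = a * \<rho> x u v) \<and>
        (u \<noteq> (\<lambda>c. 0) \<longrightarrow> \<rho> x u u > 0)) \<and>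
     (\<forall>c\<in>atlas N. \<forall>a b k.
        Ck_on k (\<lambda>y. \<rho> (chart_inv c y) (tangent_of_coord N c (chart_inv c y) a)
                                      (tangent_of_coord N c (chart_inv c y) b))
          (snd c ` fst c))"

definition invariant_metric ::
  "('a, 'e::euclidean_space) manifold \<Rightarrow> 'g set \<Rightarrow> ('g \<Rightarrow> 'a \<Rightarrow> 'a)
     \<Rightarrow> ('a \<Rightarrow> ('a, 'e) tangent \<Rightarrow> ('a, 'e) tangent \<Rightarrow> real) \<Rightarrow> bool" where
  "invariant_metric N A act \<rho> \<longleftrightarrow>
     (\<forall>g\<in>A. \<forall>x\<in>topspace (mtop N). \<forall>v\<in>tangent_space N x. \<forall>w\<in>tangent_space N x.
        \<rho> (act g x) (mdiff N N (act g) x v) (mdiff N N (act g) x w) = \<rho> x v w)"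

section \<open>Lie groups and homogeneous spaces\<close>

definition lie_group :: "'g monoid \<Rightarrow> ('g, 'e::euclidean_space) manifold \<Rightarrow> bool" where
  "lie_group G N \<longleftrightarrow> group G \<and> smooth_manifold N \<and> carrier G = topspace (mtop N) \<and>
     smooth_map (prod_manifold N N) N (\<lambda>(x, y). x \<otimes>\<^bsub>G\<^esub> y) \<and>
     smooth_map N N (m_inv G)"

text \<open>The points of the homogeneous space \<open>G/H\<close> are the left cosets, its topology is the quotient
  topology, and its smooth structure is the unique one for which the projection is a smooth
  submersion. Smoothness of the action \<open>lact G\<close> by left translation then follows.\<close>

definition homogeneous_space ::
  "'g monoid \<Rightarrow> ('g, 'e::euclidean_space) manifold \<Rightarrow> 'g set
     \<Rightarrow> ('g set, 'f::euclidean_space) manifold \<Rightarrow> bool" where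
  "homogeneous_space G N H M \<longleftrightarrow>
     smooth_manifold M \<and>
     topspace (mtop M) = lcosets\<^bsub>G\<^esub> H \<and>
     quotient_map (mtop N) (mtop M) (\<lambda>g. g <#\<^bsub>G\<^esub> H) \<and>
     smooth_map N M (\<lambda>g. g <#\<^bsub>G\<^esub> H) \<and>
     (\<forall>g\<in>carrier G.
        mdiff N M (\<lambda>g. g <#\<^bsub>G\<^esub> H) g ` tangent_space N g = tangent_space M (g <#\<^bsub>G\<^esub> H))"

definition lact :: "'g monoid \<Rightarrow> 'g \<Rightarrow> 'g set \<Rightarrow> 'g set" where
  "lact G g x = g <#\<^bsub>G\<^esub> x"

section \<open>Cone fields\<close>

definition closed_convex_cone ::
  "('a, 'e::euclidean_space) manifold \<Rightarrow> 'a \<Rightarrow> ('a, 'e) tangent set \<Rightarrow> bool" where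
  "closed_convex_cone N x K \<longleftrightarrow>
     K \<noteq> {} \<and> closedin (tangent_topology N x) K \<and>
     (\<forall>u\<in>K. \<forall>v\<in>K. (\<lambda>c. u c + v c) \<in> K) \<and>
     (\<forall>a\<ge>0. \<forall>v\<in>K. (\<lambda>c. a *\<^sub>R v c) \<in> K) \<and>
     K \<inter> (\<lambda>v c. - v c) ` K = {\<lambda>c. 0}"

definition cone_field ::
  "('a, 'e::euclidean_space) manifold \<Rightarrow> ('a \<Rightarrow> ('a, 'e) tangent set) \<Rightarrow> bool" where
  "cone_field N C \<longleftrightarrow> (\<forall>x\<in>topspace (mtop N). closed_convex_cone N x (C x))"

definition cone_interior ::
  "('a, 'e::euclidean_space) manifold \<Rightarrow> ('a \<Rightarrow> ('a, 'e) tangent set) \<Rightarrow> 'a \<Rightarrow> ('a, 'e) tangent set"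
  where "cone_interior N C x = tangent_topology N x interior_of C x"

definition solid_cone_field ::
  "('a, 'e::euclidean_space) manifold \<Rightarrow> ('a \<Rightarrow> ('a, 'e) tangent set) \<Rightarrow> bool" where
  "solid_cone_field N C \<longleftrightarrow>
     cone_field N C \<and> (\<forall>x\<in>topspace (mtop N). cone_interior N C x \<noteq> {})"

definition homogeneous_cone_field ::
  "('a, 'e::euclidean_space) manifold \<Rightarrow> 'g set \<Rightarrow> ('g \<Rightarrow> 'a \<Rightarrow> 'a)
     \<Rightarrow> ('a \<Rightarrow> ('a, 'e) tangent set) \<Rightarrow> bool" where
  "homogeneous_cone_field N A act C \<longleftrightarrow>
     (\<forall>g\<in>A. \<forall>x\<in>topspace (mtop N). mdiff N N (act g) x ` C x = C (act g x))"

section \<open>Conal curves and orders\<close>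

text \<open>One-sided derivatives at the end points of \<open>[a, b]\<close>. The map \<open>V\<close> is the velocity along the
  curve; its continuity is expressed in charts.\<close>

definition C1_curve_on ::
  "('a, 'e::euclidean_space) manifold \<Rightarrow> (real \<Rightarrow> 'a) \<Rightarrow> real \<Rightarrow> real \<Rightarrow> bool" where
  "C1_curve_on N \<gamma> a b \<longleftrightarrow>
     continuous_map (top_of_set {a..b}) (mtop N) \<gamma> \<and>
     (\<exists>V. (\<forall>t\<in>{a..b}. V t \<in> tangent_space N (\<gamma> t) \<and>
              (\<forall>c\<in>charts_at N (\<gamma> t).
                 ((snd c \<circ> \<gamma>) has_vector_derivative V t c) (at t within {a..b}))) \<and>
          (\<forall>c\<in>atlas N. continuous_on {t\<in>{a..b}. \<gamma> t \<in> fst c} (\<lambda>t. V t c)))"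

definition piecewise_C1_curve ::
  "('a, 'e::euclidean_space) manifold \<Rightarrow> (real \<Rightarrow> 'a) \<Rightarrow> real \<Rightarrow> real \<Rightarrow> bool" where
  "piecewise_C1_curve N \<gamma> t0 t1 \<longleftrightarrow>
     continuous_map (top_of_set {t0..t1}) (mtop N) \<gamma> \<and>
     (\<exists>P. finite P \<and> P \<subseteq> {t0..t1} \<and> t0 \<in> P \<and> t1 \<in> P \<and>
          (\<forall>a\<in>P. \<forall>b\<in>P. a < b \<and> P \<inter> {a<..<b} = {} \<longrightarrow> C1_curve_on N \<gamma> a b))"

definition right_velocity ::
  "('a, 'e::euclidean_space) manifold \<Rightarrow> (real \<Rightarrow> 'a) \<Rightarrow> real \<Rightarrow> ('a, 'e) tangent" where
  "right_velocity N \<gamma> t =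
     (\<lambda>c. if c \<in> charts_at N (\<gamma> t) then vector_derivative (snd c \<circ> \<gamma>) (at_right t) else 0)"

definition conal_curve ::
  "('a, 'e::euclidean_space) manifold \<Rightarrow> ('a \<Rightarrow> ('a, 'e) tangent set)
     \<Rightarrow> (real \<Rightarrow> 'a) \<Rightarrow> real \<Rightarrow> real \<Rightarrow> bool" where
  "conal_curve N C \<gamma> t0 t1 \<longleftrightarrow> t0 < t1 \<and> piecewise_C1_curve N \<gamma> t0 t1 \<and>
     (\<forall>t. t0 \<le> t \<and> t < t1 \<longrightarrow> right_velocity N \<gamma> t \<in> C (\<gamma> t))"

definition strictly_conal_curve ::
  "('a, 'e::euclidean_space) manifold \<Rightarrow> ('a \<Rightarrow> ('a, 'e) tangent set)
     \<Rightarrow> (real \<Rightarrow> 'a) \<Rightarrow> real \<Rightarrow> real \<Rightarrow> bool" where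
  "strictly_conal_curve N C \<gamma> t0 t1 \<longleftrightarrow> conal_curve N C \<gamma> t0 t1 \<and>
     (\<forall>t. t0 \<le> t \<and> t < t1 \<longrightarrow> right_velocity N \<gamma> t \<in> cone_interior N C (\<gamma> t))"

definition conal_le ::
  "('a, 'e::euclidean_space) manifold \<Rightarrow> ('a \<Rightarrow> ('a, 'e) tangent set) \<Rightarrow> 'a \<Rightarrow> 'a \<Rightarrow> bool" where
  "conal_le N C x y \<longleftrightarrow> (\<exists>\<gamma> t0 t1. conal_curve N C \<gamma> t0 t1 \<and> \<gamma> t0 = x \<and> \<gamma> t1 = y)"

definition conal_ll ::
  "('a, 'e::euclidean_space) manifold \<Rightarrow> ('a \<Rightarrow> ('a, 'e) tangent set) \<Rightarrow> 'a \<Rightarrow> 'a \<Rightarrow> bool" where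
  "conal_ll N C x y \<longleftrightarrow> (\<exists>\<gamma> t0 t1. strictly_conal_curve N C \<gamma> t0 t1 \<and> \<gamma> t0 = x \<and> \<gamma> t1 = y)"

definition strongly_ordered ::
  "('a, 'e::euclidean_space) manifold \<Rightarrow> ('a \<Rightarrow> ('a, 'e) tangent set) \<Rightarrow> 'a \<Rightarrow> 'a \<Rightarrow> bool" where
  "strongly_ordered N C x y \<longleftrightarrow> conal_ll N C x y \<or> conal_ll N C y x"

definition unordered ::
  "('a, 'e::euclidean_space) manifold \<Rightarrow> ('a \<Rightarrow> ('a, 'e) tangent set) \<Rightarrow> 'a \<Rightarrow> 'a \<Rightarrow> bool" where
  "unordered N C x y \<longleftrightarrow> \<not> conal_le N C x y \<and> \<not> conal_le N C y x"

definition quasi_closed_order ::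
  "('a, 'e::euclidean_space) manifold \<Rightarrow> ('a \<Rightarrow> ('a, 'e) tangent set) \<Rightarrow> bool" where
  "quasi_closed_order N C \<longleftrightarrow>
     (\<forall>xs ys x y. limitin (mtop N) xs x sequentially \<and> limitin (mtop N) ys y sequentially \<and>
        (\<forall>n::nat. conal_ll N C (xs n) (ys n)) \<longrightarrow> conal_le N C x y)"

definition chron_future ::
  "('a, 'e::euclidean_space) manifold \<Rightarrow> ('a \<Rightarrow> ('a, 'e) tangent set) \<Rightarrow> 'a \<Rightarrow> 'a set" where
  "chron_future N C p = {q. conal_ll N C p q}"

definition chron_past ::
  "('a, 'e::euclidean_space) manifold \<Rightarrow> ('a \<Rightarrow> ('a, 'e) tangent set) \<Rightarrow> 'a \<Rightarrow> 'a set" where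
  "chron_past N C p = {q. conal_ll N C q p}"

definition inner_continuous_at :: "'a topology \<Rightarrow> ('a \<Rightarrow> 'a set) \<Rightarrow> 'a \<Rightarrow> bool" where
  "inner_continuous_at X I p \<longleftrightarrow>
     (\<forall>K. compactin X K \<and> K \<subseteq> I p \<longrightarrow>
        (\<exists>U. openin X U \<and> p \<in> U \<and> (\<forall>q\<in>U. K \<subseteq> I q)))"

definition outer_continuous_at :: "'a topology \<Rightarrow> ('a \<Rightarrow> 'a set) \<Rightarrow> 'a \<Rightarrow> bool" where
  "outer_continuous_at X I p \<longleftrightarrow>
     (\<forall>K. compactin X K \<and> K \<subseteq> topspace X - X closure_of I p \<longrightarrow>
        (\<exists>U. openin X U \<and> p \<in> U \<and> (\<forall>q\<in>U. K \<subseteq> topspace X - X closure_of I q)))"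

definition continuous_chron :: "'a topology \<Rightarrow> ('a \<Rightarrow> 'a set) \<Rightarrow> bool" where
  "continuous_chron X I \<longleftrightarrow>
     (\<forall>p\<in>topspace X. inner_continuous_at X I p \<and> outer_continuous_at X I p)"

section \<open>Flows and invariant measures\<close>

text \<open>The flow of a continuously differentiable vector field \<open>X\<close>: a one-parameter group whose time
  derivative is \<open>X\<close>. Joint continuous differentiability is automatic for such \<open>X\<close> by the
  classical theorem on dependence on initial values; it is recorded here as part of the notion.\<close>

definition is_flow_of ::
  "('a, 'e::euclidean_space) manifold \<Rightarrow> ('a \<Rightarrow> ('a, 'e) tangent) \<Rightarrow> (real \<Rightarrow> 'a \<Rightarrow> 'a) \<Rightarrow> bool"
  where
  "is_flow_of N X \<phi> \<longleftrightarrow>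
     Ck_map 1 (prod_manifold real_line N) N (\<lambda>(t, x). \<phi> t x) \<and>
     (\<forall>x\<in>topspace (mtop N). \<phi> 0 x = x \<and> (\<forall>s t. \<phi> (s + t) x = \<phi> s (\<phi> t x)) \<and>
        (\<forall>t. \<forall>c\<in>charts_at N (\<phi> t x).
           ((\<lambda>s. snd c (\<phi> s x)) has_vector_derivative X (\<phi> t x) c) (at t)))"

definition orbit :: "(real \<Rightarrow> 'a \<Rightarrow> 'a) \<Rightarrow> 'a \<Rightarrow> 'a set" where
  "orbit \<phi> x = range (\<lambda>t. \<phi> t x)"

definition strongly_differentially_positive ::
  "('a, 'e::euclidean_space) manifold \<Rightarrow> ('a \<Rightarrow> ('a, 'e) tangent set) \<Rightarrow> (real \<Rightarrow> 'a \<Rightarrow> 'a) \<Rightarrow> bool"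
  where
  "strongly_differentially_positive N C \<phi> \<longleftrightarrow>
     (\<forall>x\<in>topspace (mtop N). \<forall>t>0.
        mdiff N N (\<phi> t) x ` (C x - {\<lambda>c. 0}) \<subseteq> cone_interior N C (\<phi> t x))"

definition borel_probability :: "'a topology \<Rightarrow> 'a measure \<Rightarrow> bool" where
  "borel_probability X \<mu> \<longleftrightarrow> prob_space \<mu> \<and> space \<mu> = topspace X \<and>
     sets \<mu> = sigma_sets (topspace X) {U. openin X U}"

definition invariant_measure :: "(real \<Rightarrow> 'a \<Rightarrow> 'a) \<Rightarrow> 'a measure \<Rightarrow> bool" where
  "invariant_measure \<phi> \<mu> \<longleftrightarrow>
     (\<forall>t. \<forall>A\<in>sets \<mu>. emeasure \<mu> (\<phi> t -` A \<inter> space \<mu>) = emeasure \<mu> A)"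

definition measure_support :: "'a topology \<Rightarrow> 'a measure \<Rightarrow> 'a set" where
  "measure_support X \<mu> = topspace X - \<Union>{U. openin X U \<and> emeasure \<mu> U = 0}"

end

theory Submission
  imports Defs
begin

text \<open>
  Write \<open>x \<le> y\<close> for \<open>conal_le\<close>, \<open>x \<lless> y\<close> for \<open>conal_ll\<close>, and \<open>S\<close> for the support of \<open>\<mu>\<close>.

  The heart of the matter is that two distinct points \<open>x \<le> y\<close> of \<open>S\<close> satisfy \<open>x \<lless> y\<close>
  (\<open>support_le_imp_ll\<close>). The flow is strongly monotone: \<open>x \<le> y\<close> and \<open>x \<noteq> y\<close> imply
  \<open>\<phi>\<^sub>t x \<lless> \<phi>\<^sub>t y\<close> for \<open>t > 0\<close>. As \<open>\<lless>\<close> is an open relation, \<open>\<phi>\<^sub>1 u \<lless> \<phi>\<^sub>1 v\<close> holds for all \<open>u\<close> near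
  \<open>x\<close> and \<open>v\<close> near \<open>y\<close>. Poincare recurrence for the product measure \<open>\<mu> \<times> \<mu>\<close> on small rectangles
  brings some of these pairs back to where they started, so every pair \<open>(u, v)\<close> in \<open>S \<times> S\<close> near
  \<open>(x, y)\<close> is a limit of pairs related by \<open>\<lless>\<close>, and \<open>u \<le> v\<close> because the order is quasi-closed. For small
  \<open>t > 0\<close> this applies to \<open>\<phi>\<^sub>-\<^sub>t x\<close> and \<open>\<phi>\<^sub>-\<^sub>t y\<close>; flowing forward for time \<open>t\<close> gives \<open>x \<lless> y\<close>.

  Hence on \<open>S\<close>, away from the diagonal, being strongly ordered is both an open relation (since \<open>\<lless>\<close>
  is open) and a closed one (limits satisfy \<open>\<le>\<close>, hence \<open>\<lless>\<close>). On a connected set a symmetric relation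
  with this property holds for all pairs of distinct points or for none
  (\<open>connected_symmetric_dichotomy\<close>), and two distinct points of \<open>S\<close> which are not strongly ordered are
  unordered.

  Strong monotonicity (\<open>strongly_positive_map_conal_ll\<close>) needs an argument because the velocity of a
  conal curve \<open>\<gamma>\<close> may vanish, and then \<open>\<phi>\<^sub>t \<circ> \<gamma>\<close> is not strictly conal. But where the velocity of
  \<open>\<phi>\<^sub>t \<circ> \<gamma>\<close> does not vanish, it lies in the interior of the cone with a margin proportional to its
  length, by compactness of the set of unit vectors of a cone. If the cone field is continuous, small translates
  of \<open>\<phi>\<^sub>t \<circ> \<gamma>\<close> in a chart are therefore still conal, and they become strictly conal when a small constant
  vector from the interior of the cones is added to the velocity
  (\<open>pushed_curve_locally_strict\<close>). Openness of the chronological sets glues these local pieces.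

  Continuity of the cone field follows from homogeneity: the submersion \<open>G \<rightarrow> G/H\<close> has local sections,
  so a point near \<open>p\<close> is the image of \<open>p\<close> under a group element near the identity, whose derivative
  at \<open>p\<close> is close to the identity (\<open>homogeneous_cone_field_continuous\<close>).
\<close>


section \<open>Calculus in charts\<close>

lemma Ck_on_1_derivative:
  assumes "Ck_on 1 f S" "x \<in> S"
  shows "(f has_derivative frechet_derivative f (at x)) (at x)"
  using assms by (simp add: frechet_derivative_works)

lemma Ck_on_1_continuous:
  assumes "Ck_on 1 f S"
  shows "continuous_on S (\<lambda>x. frechet_derivative f (at x) v)"
  using assms by simp

lemma linear_basis_expansion:
  fixes L :: "'a::euclidean_space \<Rightarrow> 'b::real_normed_vector"
  assumes L: "linear L"
  shows "L h = (\<Sum>b\<in>Basis. (h \<bullet> b) *\<^sub>R L b)"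
proof -
  have "L h = L (\<Sum>b\<in>Basis. (h \<bullet> b) *\<^sub>R b)" by (simp add: euclidean_representation)
  also have "\<dots> = (\<Sum>b\<in>Basis. (h \<bullet> b) *\<^sub>R L b)"
    by (simp only: linear_sum[OF L] linear_cmul[OF L])
  finally show ?thesis .
qed

text \<open>\<open>Ck_on\<close> provides continuity of directional derivatives only. In finite dimension this controls the
  operator norm, since a linear map is determined by its values on a basis.\<close>

lemma linear_family_near:
  fixes A :: "'i \<Rightarrow> 'a::euclidean_space \<Rightarrow> 'b::real_normed_vector"
  assumes lin: "\<forall>\<^sub>F i in F. linear (A i)" and L: "linear L"
    and lim: "\<And>b. b \<in> Basis \<Longrightarrow> ((\<lambda>i. A i b) \<longlongrightarrow> L b) F" and e: "e > 0"
  shows "\<forall>\<^sub>F i in F. \<forall>h. norm (A i h - L h) \<le> e * norm h"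
proof -
  define e' where "e' = e / DIM('a)"
  have e': "e' > 0" using e by (simp add: e'_def)
  have "\<forall>\<^sub>F i in F. \<forall>b\<in>Basis. norm (A i b - L b) < e'"
    using lim e' by (auto simp: eventually_ball_finite_distrib tendsto_iff dist_norm)
  with lin show ?thesis
  proof eventually_elim
    case (elim i)
    show ?case
    proof
      fix h :: 'a
      have D: "linear (\<lambda>h. A i h - L h)" using elim(1) L by (rule linear_compose_sub)
      have "A i h - L h = (\<Sum>b\<in>Basis. (h \<bullet> b) *\<^sub>R (A i b - L b))"
        by (rule linear_basis_expansion[OF D])
      also have "norm \<dots> \<le> (\<Sum>b\<in>(Basis::'a set). norm h * e')"
      proof (rule sum_norm_le)
        fix b :: 'a assume b: "b \<in> Basis"
        have "norm ((h \<bullet> b) *\<^sub>R (A i b - L b)) = \<bar>h \<bullet> b\<bar> * norm (A i b - L b)" by simp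
        also have "\<dots> \<le> norm h * e'"
          using elim(2) b by (intro mult_mono) (auto simp: Basis_le_norm less_imp_le)
        finally show "norm ((h \<bullet> b) *\<^sub>R (A i b - L b)) \<le> norm h * e'" .
      qed
      also have "\<dots> = of_nat DIM('a) * (norm h * e')" by (rule sum_constant)
      also have "\<dots> = e * norm h" unfolding e'_def by simp
      finally show "norm (A i h - L h) \<le> e * norm h" .
    qed
  qed
qed

lemma linear_family_tendsto:
  fixes A :: "'i \<Rightarrow> 'a::euclidean_space \<Rightarrow> 'b::real_normed_vector"
  assumes lin: "\<forall>\<^sub>F i in F. linear (A i)" and L: "linear L"
    and lim: "\<And>b. b \<in> Basis \<Longrightarrow> ((\<lambda>i. A i b) \<longlongrightarrow> L b) F" and h: "(h \<longlongrightarrow> h0) F"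
  shows "((\<lambda>i. A i (h i)) \<longlongrightarrow> L h0) F"
proof -
  have "((\<lambda>i. \<Sum>b\<in>Basis. (h i \<bullet> b) *\<^sub>R A i b) \<longlongrightarrow> (\<Sum>b\<in>Basis. (h0 \<bullet> b) *\<^sub>R L b)) F"
    by (intro tendsto_intros h lim)
  moreover have "L h0 = (\<Sum>b\<in>Basis. (h0 \<bullet> b) *\<^sub>R L b)"
    by (rule linear_basis_expansion[OF L])
  moreover have "\<forall>\<^sub>F i in F. (\<Sum>b\<in>Basis. (h i \<bullet> b) *\<^sub>R A i b) = A i (h i)"
    using lin by eventually_elim (rule linear_basis_expansion[symmetric])
  ultimately show ?thesis by (auto elim: Lim_transform_eventually)
qed

locale manifold =
  fixes N :: "('a, 'e::euclidean_space) manifold"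
  assumes smooth_manifold: "smooth_manifold N"
begin

abbreviation coords :: "('a, 'e) chart \<Rightarrow> 'e set" where "coords c \<equiv> snd c ` fst c"

abbreviation DT :: "('a, 'e) chart \<Rightarrow> ('a, 'e) chart \<Rightarrow> 'a \<Rightarrow> 'e \<Rightarrow> 'e" where
  "DT c d p \<equiv> frechet_derivative (snd d \<circ> chart_inv c) (at (snd c p))"

lemma charts_atD: "c \<in> charts_at N p \<Longrightarrow> c \<in> atlas N" "c \<in> charts_at N p \<Longrightarrow> p \<in> fst c"
  by (auto simp: charts_at_def)

lemma chart_exists: "p \<in> topspace (mtop N) \<Longrightarrow> \<exists>c. c \<in> charts_at N p"
  using smooth_manifold unfolding smooth_manifold_def charts_at_def by blast

lemma is_chart: "c \<in> atlas N \<Longrightarrow> is_chart (mtop N) c"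
  using smooth_manifold unfolding smooth_manifold_def by blast

lemma openin_chart: "c \<in> atlas N \<Longrightarrow> openin (mtop N) (fst c)"
  using is_chart by (auto simp: is_chart_def)

lemma charts_at_topspace: "c \<in> charts_at N p \<Longrightarrow> p \<in> topspace (mtop N)"
  using openin_subset[OF openin_chart] charts_atD by blast

lemma open_coords: "c \<in> atlas N \<Longrightarrow> open (coords c)"
  using is_chart by (auto simp: is_chart_def)

lemma chart_homeo:
  "c \<in> atlas N \<Longrightarrow> homeomorphic_map (subtopology (mtop N) (fst c)) (top_of_set (coords c)) (snd c)"
  using is_chart by (auto simp: is_chart_def)

lemma inj_chart: "c \<in> atlas N \<Longrightarrow> inj_on (snd c) (fst c)"
  using homeomorphic_imp_injective_map[OF chart_homeo] openin_subset[OF openin_chart]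
  by (simp add: topspace_subtopology inf.absorb2)

lemma chart_inv_chart [simp]: "c \<in> atlas N \<Longrightarrow> p \<in> fst c \<Longrightarrow> chart_inv c (snd c p) = p"
  by (simp add: inj_chart)

lemma openin_chart_image:
  assumes "c \<in> atlas N" "openin (mtop N) U"
  shows "open (snd c ` (fst c \<inter> U))"
proof -
  have "openin (subtopology (mtop N) (fst c)) (fst c \<inter> U)"
    using assms(2) by (auto simp: openin_subtopology)
  then have "openin (top_of_set (coords c)) (snd c ` (fst c \<inter> U))"
    using homeomorphic_imp_open_map[OF chart_homeo[OF assms(1)]] by (auto simp: open_map_def)
  then show ?thesis
    by (simp add: openin_open_eq[OF open_coords[OF assms(1)]])
qed

lemma openin_chart_preimage:
  assumes "c \<in> atlas N" "open W"
  shows "openin (mtop N) {p \<in> fst c. snd c p \<in> W}"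
proof -
  have "continuous_map (subtopology (mtop N) (fst c)) (top_of_set (coords c)) (snd c)"
    using homeomorphic_imp_continuous_map[OF chart_homeo[OF assms(1)]] .
  then have "continuous_map (subtopology (mtop N) (fst c)) euclidean (snd c)"
    by (simp add: continuous_map_in_subtopology)
  then have "openin (subtopology (mtop N) (fst c)) {p \<in> topspace (subtopology (mtop N) (fst c)). snd c p \<in> W}"
    using assms(2) by (auto simp: continuous_map_def)
  then have "openin (mtop N) {p \<in> topspace (subtopology (mtop N) (fst c)). snd c p \<in> W}"
    using openin_chart[OF assms(1)] openin_trans_full by blast
  moreover have "{p \<in> topspace (subtopology (mtop N) (fst c)). snd c p \<in> W} = {p \<in> fst c. snd c p \<in> W}"
    using openin_subset[OF openin_chart[OF assms(1)]] by auto
  ultimately show ?thesis by simp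
qed

lemma limitin_chart:
  assumes "c \<in> charts_at N p"
  shows "limitin (mtop N) f p F \<longleftrightarrow>
    (\<forall>\<^sub>F i in F. f i \<in> fst c) \<and> ((\<lambda>i. snd c (f i)) \<longlongrightarrow> snd c p) F" (is "?L \<longleftrightarrow> ?R")
proof
  assume L: ?L
  have c: "c \<in> atlas N" "p \<in> fst c" using charts_atD assms by auto
  have dom: "\<forall>\<^sub>F i in F. f i \<in> fst c"
    using L openin_chart[OF c(1)] c(2) by (auto simp: limitin_def)
  moreover have "((\<lambda>i. snd c (f i)) \<longlongrightarrow> snd c p) F"
  proof (rule topological_tendstoI)
    fix W assume W: "open W" "snd c p \<in> W"
    then have "\<forall>\<^sub>F i in F. f i \<in> {p \<in> fst c. snd c p \<in> W}"
      using L openin_chart_preimage[OF c(1) W(1)] c(2) unfolding limitin_def by blast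
    then show "\<forall>\<^sub>F i in F. snd c (f i) \<in> W" by eventually_elim auto
  qed
  ultimately show ?R by simp
next
  assume R: ?R
  have c: "c \<in> atlas N" "p \<in> fst c" using charts_atD assms by auto
  show ?L unfolding limitin_def
  proof (intro conjI allI impI)
    show "p \<in> topspace (mtop N)" using charts_at_topspace assms by blast
    fix U assume U: "openin (mtop N) U \<and> p \<in> U"
    then have "open (snd c ` (fst c \<inter> U))" "snd c p \<in> snd c ` (fst c \<inter> U)"
      using openin_chart_image[OF c(1)] c(2) by auto
    then have "\<forall>\<^sub>F i in F. snd c (f i) \<in> snd c ` (fst c \<inter> U)"
      using R topological_tendstoD by blast
    then show "\<forall>\<^sub>F i in F. f i \<in> U"
      using conjunct1[OF R]
    proof eventually_elim
      case (elim i)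
      then obtain q where "q \<in> fst c" "q \<in> U" "snd c (f i) = snd c q" by blast
      then show ?case using inj_onD[OF inj_chart[OF c(1)]] elim(2) by metis
    qed
  qed
qed

lemma limitin_chart_inv:
  assumes "c \<in> atlas N" "y \<in> coords c" "(g \<longlongrightarrow> y) F"
  shows "limitin (mtop N) (\<lambda>i. chart_inv c (g i)) (chart_inv c y) F"
proof -
  have ev: "\<forall>\<^sub>F i in F. g i \<in> coords c"
    by (rule topological_tendstoD[OF assms(3) open_coords[OF assms(1)] assms(2)])
  have cc: "c \<in> charts_at N (chart_inv c y)"
    using assms by (auto simp: charts_at_def)
  show ?thesis
    unfolding limitin_chart[OF cc]
  proof (intro conjI)
    show "\<forall>\<^sub>F i in F. chart_inv c (g i) \<in> fst c"
      using ev by eventually_elim (use assms(1) in auto)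
    have e: "\<forall>\<^sub>F i in F. g i = snd c (chart_inv c (g i))"
      using ev by eventually_elim (use assms(1) in auto)
    have "snd c (chart_inv c y) = y" using assms by auto
    then show "((\<lambda>i. snd c (chart_inv c (g i))) \<longlongrightarrow> snd c (chart_inv c y)) F"
      using assms(3) tendsto_cong[OF e] by simp
  qed
qed

lemma transition_Ck:
  "c \<in> atlas N \<Longrightarrow> d \<in> atlas N \<Longrightarrow> Ck_on k (snd d \<circ> chart_inv c) (snd c ` (fst c \<inter> fst d))"
  using smooth_manifold unfolding smooth_manifold_def by blast

lemma transition_derivative:
  assumes "c \<in> charts_at N p" "d \<in> charts_at N p"
  shows "((snd d \<circ> chart_inv c) has_derivative DT c d p) (at (snd c p))"
  using Ck_on_1_derivative[OF transition_Ck[of c d 1], of "snd c p"] assms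
  by (auto simp: charts_at_def)

lemma linear_DT: "c \<in> charts_at N p \<Longrightarrow> d \<in> charts_at N p \<Longrightarrow> linear (DT c d p)"
  using transition_derivative has_derivative_linear by blast

lemma chart_change_derivative:
  assumes "c \<in> charts_at N p" "c' \<in> charts_at N p"
    and g: "((g \<circ> chart_inv c) has_derivative D) (at (snd c p))"
  shows "((g \<circ> chart_inv c') has_derivative (D \<circ> DT c' c p)) (at (snd c' p))"
proof -
  have cc: "c \<in> atlas N" "c' \<in> atlas N" "p \<in> fst c" "p \<in> fst c'" using assms charts_atD by auto
  have "((g \<circ> chart_inv c \<circ> (snd c \<circ> chart_inv c')) has_derivative (D \<circ> DT c' c p)) (at (snd c' p))"
    using g cc transition_derivative[OF assms(2,1)]
    by (intro diff_chain_at) auto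
  then show ?thesis
  proof (rule has_derivative_transform_within_open)
    show "open (snd c' ` (fst c' \<inter> fst c))" using openin_chart_image cc openin_chart by blast
    show "snd c' p \<in> snd c' ` (fst c' \<inter> fst c)" using cc by auto
  qed (use cc in auto)
qed

lemma DT_self: "c \<in> charts_at N p \<Longrightarrow> DT c c p = id"
proof -
  assume c: "c \<in> charts_at N p"
  then have cc: "c \<in> atlas N" "p \<in> fst c" using charts_atD by auto
  have "((snd c \<circ> chart_inv c) has_derivative id) (at (snd c p))"
    by (rule has_derivative_transform_within_open[of id id _ UNIV "coords c"])
      (use cc open_coords in \<open>auto simp: id_def\<close>)
  then show ?thesis using transition_derivative[OF c c] has_derivative_unique by blast
qed

lemma DT_cocycle:
  assumes "c \<in> charts_at N p" "d \<in> charts_at N p" "e \<in> charts_at N p"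
  shows "DT d e p (DT c d p w) = DT c e p w"
proof -
  have "((snd e \<circ> chart_inv c) has_derivative (DT d e p \<circ> DT c d p)) (at (snd c p))"
    by (rule chart_change_derivative) (use assms transition_derivative in auto)
  then show ?thesis using transition_derivative[OF assms(1,3)] has_derivative_unique
    by (metis comp_apply)
qed

lemma tangent_of_coord_in:
  assumes "c \<in> charts_at N p"
  shows "tangent_of_coord N c p w \<in> tangent_space N p"
  using assms DT_cocycle by (auto simp: tangent_space_def tangent_of_coord_def)

lemma tangent_of_coord_self:
  "c \<in> charts_at N p \<Longrightarrow> tangent_of_coord N c p w c = w"
  using DT_self by (auto simp: tangent_of_coord_def)

lemma tangent_change:
  "v \<in> tangent_space N p \<Longrightarrow> c \<in> charts_at N p \<Longrightarrow> d \<in> charts_at N p \<Longrightarrow> v d = DT c d p (v c)"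
  unfolding tangent_space_def by blast

lemma tangent_of_coord_coord:
  assumes c: "c \<in> charts_at N p" and v: "v \<in> tangent_space N p"
  shows "tangent_of_coord N c p (v c) = v"
proof
  fix d
  show "tangent_of_coord N c p (v c) d = v d"
  proof (cases "d \<in> charts_at N p")
    case True
    then show ?thesis using tangent_change[OF v c True] by (simp add: tangent_of_coord_def)
  next
    case False
    then have "v d = 0" using v unfolding tangent_space_def by blast
    then show ?thesis using False by (simp add: tangent_of_coord_def)
  qed
qed

lemma continuous_tangent_of_coord:
  "c \<in> charts_at N p \<Longrightarrow> continuous_on S (tangent_of_coord N c p)"
proof (rule continuous_on_coordinatewise_then_product)
  fix d assume c: "c \<in> charts_at N p"
  show "continuous_on S (\<lambda>w. tangent_of_coord N c p w d)"
  proof (cases "d \<in> charts_at N p")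
    case True
    have "continuous_on S (DT c d p)"
      using linear_DT[OF c True] by (simp add: linear_conv_bounded_linear linear_continuous_on)
    then show ?thesis using True by (simp add: tangent_of_coord_def)
  qed (simp add: tangent_of_coord_def)
qed

text \<open>One coordinate vector determines all the others through the linear maps \<open>DT\<close>. Hence the product
  topology on families of coordinate vectors restricts to the Euclidean topology on each tangent space,
  and closedness and interior of a cone can be read off in any single chart.\<close>

lemma coord_closed:
  assumes c: "c \<in> charts_at N p" and K: "closedin (tangent_topology N p) K"
  shows "closed ((\<lambda>v. v c) ` K)"
proof -
  have sub: "K \<subseteq> tangent_space N p" using K closedin_subset by (fastforce simp: tangent_topology_def)
  have "(\<lambda>v. v c) ` K = tangent_of_coord N c p -` K"
  proof (intro equalityI subsetI)
    fix w assume "w \<in> (\<lambda>v. v c) ` K"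
    then obtain v where "v \<in> K" "w = v c" by blast
    then show "w \<in> tangent_of_coord N c p -` K"
      using tangent_of_coord_coord[OF c, of v] sub by auto
  next
    fix w assume "w \<in> tangent_of_coord N c p -` K"
    then show "w \<in> (\<lambda>v. v c) ` K"
      using tangent_of_coord_self[OF c, of w] by (intro image_eqI[of _ _ "tangent_of_coord N c p w"]) auto
  qed
  moreover obtain T where "closed T" "K = tangent_space N p \<inter> T"
    using K by (auto simp: tangent_topology_def closedin_closed)
  moreover have "tangent_of_coord N c p -` (tangent_space N p \<inter> T) = tangent_of_coord N c p -` T"
    using tangent_of_coord_in[OF c] by auto
  ultimately show ?thesis
    using closed_vimage[OF _ continuous_tangent_of_coord[OF c, of UNIV]] by simp
qed

lemma coord_interior:
  assumes c: "c \<in> charts_at N p" and sub: "K \<subseteq> tangent_space N p"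
  shows "v \<in> tangent_topology N p interior_of K \<longleftrightarrow>
         v \<in> tangent_space N p \<and> v c \<in> interior ((\<lambda>v. v c) ` K)"
proof
  assume v: "v \<in> tangent_topology N p interior_of K"
  then have vt: "v \<in> tangent_space N p"
    using subsetD[OF interior_of_subset v] sub by blast
  obtain U where U: "openin (top_of_set (tangent_space N p)) U" "v \<in> U" "U \<subseteq> K"
    using v unfolding interior_of_def tangent_topology_def by blast
  then obtain T where "open T" "U = tangent_space N p \<inter> T" unfolding openin_open by blast
  with U have T: "open T" "v \<in> T" "tangent_space N p \<inter> T \<subseteq> K" by auto
  have "open (tangent_of_coord N c p -` T)"
    by (rule open_vimage[OF T(1) continuous_tangent_of_coord[OF c]])
  moreover have "v c \<in> tangent_of_coord N c p -` T" using tangent_of_coord_coord[OF c vt] T by simp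
  moreover have "tangent_of_coord N c p -` T \<subseteq> (\<lambda>v. v c) ` K"
  proof
    fix w assume "w \<in> tangent_of_coord N c p -` T"
    then have "tangent_of_coord N c p w \<in> K" using T(3) tangent_of_coord_in[OF c] by auto
    then show "w \<in> (\<lambda>v. v c) ` K"
      using tangent_of_coord_self[OF c, of w] by (intro image_eqI[of _ _ "tangent_of_coord N c p w"]) auto
  qed
  ultimately show "v \<in> tangent_space N p \<and> v c \<in> interior ((\<lambda>v. v c) ` K)"
    using vt by (meson interior_maximal subsetD)
next
  assume v: "v \<in> tangent_space N p \<and> v c \<in> interior ((\<lambda>v. v c) ` K)"
  define U where "U = (\<lambda>v. v c) -` interior ((\<lambda>v. v c) ` K)"
  have "open U"
    unfolding U_def by (intro open_vimage) (auto intro: continuous_on_product_coordinates)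
  moreover have "tangent_space N p \<inter> U \<subseteq> K"
  proof
    fix u assume u: "u \<in> tangent_space N p \<inter> U"
    then obtain k where "k \<in> K" "u c = k c" unfolding U_def using interior_subset by blast
    then show "u \<in> K" using tangent_of_coord_coord[OF c] u sub by (metis IntE subsetD)
  qed
  moreover have "v \<in> U" using v by (simp add: U_def)
  moreover have "openin (top_of_set (tangent_space N p)) (tangent_space N p \<inter> U)"
    using \<open>open U\<close> by (rule openin_open_Int)
  ultimately show "v \<in> tangent_topology N p interior_of K"
    using v unfolding interior_of_def tangent_topology_def by blast
qed

end

text \<open>\<open>mdiff\<close> is computed in an unspecified chart; by the chain rule any chart around the point gives the
  same vector.\<close>

lemma mdiff_chart:
  assumes N: "manifold N" and c: "c \<in> charts_at N p"
    and d: "d \<in> charts_at N' (f p)" and v: "v \<in> tangent_space N p"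
    and D: "((snd d \<circ> f \<circ> chart_inv c) has_derivative D) (at (snd c p))"
  shows "mdiff N N' f p v d = D (v c)"
proof -
  interpret manifold N by fact
  define c' where "c' = (SOME c. c \<in> charts_at N p)"
  have c': "c' \<in> charts_at N p" unfolding c'_def using c by (rule someI)
  have "((snd d \<circ> f \<circ> chart_inv c') has_derivative D \<circ> DT c' c p) (at (snd c' p))"
    using chart_change_derivative[OF c c', of "snd d \<circ> f" D] D by (simp add: comp_assoc)
  then have "frechet_derivative (snd d \<circ> f \<circ> chart_inv c') (at (snd c' p)) = D \<circ> DT c' c p"
    using frechet_derivative_at by (metis (full_types))
  then show ?thesis
    using d tangent_change[OF v c' c] by (simp add: mdiff_def Let_def c'_def[symmetric])
qed


section \<open>Piecewise differentiable curves\<close>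

lemma limitin_subset:
  assumes "limitin X f l (at t within S)" "T \<subseteq> S"
  shows "limitin X f l (at t within T)"
  using assms filter_leD[OF at_le[OF assms(2)]] unfolding limitin_def by blast

lemma continuous_map_limitin:
  fixes S :: "'b::metric_space set"
  shows "continuous_map (top_of_set S) X \<gamma> \<longleftrightarrow> (\<forall>t\<in>S. limitin X \<gamma> (\<gamma> t) (at t within S))"
proof -
  have "atin (top_of_set S) t = at t within S" if "t \<in> S" for t
    using that by (simp add: atin_subtopology_within filter_eq_iff eventually_atin_within eventually_at_topological)
      (metis open_openin)
  then show ?thesis by (simp add: continuous_map_atin)
qed

context manifold begin

lemma curve_derivative:
  assumes c: "c \<in> charts_at N (\<gamma> t)" and t: "t \<in> S"
    and lim: "limitin (mtop N) \<gamma> (\<gamma> t) (at t within S)"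
    and w: "((snd c \<circ> \<gamma>) has_vector_derivative w) (at t within S)"
    and D: "((g \<circ> chart_inv c) has_derivative D) (at (snd c (\<gamma> t)))"
  shows "((g \<circ> \<gamma>) has_vector_derivative D w) (at t within S)"
proof -
  have ca: "c \<in> atlas N" "\<gamma> t \<in> fst c" using c charts_atD by blast+
  have "((g \<circ> chart_inv c) \<circ> (snd c \<circ> \<gamma>) has_vector_derivative D w) (at t within S)"
    by (rule vector_derivative_diff_chain_within[OF w has_derivative_at_withinI]) (simp only: comp_apply[of "snd c" \<gamma> t] D)
  moreover have "\<forall>\<^sub>F s in at t within S. ((g \<circ> chart_inv c) \<circ> (snd c \<circ> \<gamma>)) s = (g \<circ> \<gamma>) s"
    using conjunct1[OF lim[unfolded limitin_chart[OF c]]]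
    by eventually_elim (simp add: ca)
  ultimately show ?thesis
    unfolding has_vector_derivative_def
    by (rule has_derivative_transform_eventually) (simp_all add: ca t)
qed

lemma curve_chart_change:
  assumes "c \<in> charts_at N (\<gamma> t)" "d \<in> charts_at N (\<gamma> t)" "t \<in> S"
    and "limitin (mtop N) \<gamma> (\<gamma> t) (at t within S)"
    and "((snd c \<circ> \<gamma>) has_vector_derivative w) (at t within S)"
  shows "((snd d \<circ> \<gamma>) has_vector_derivative DT c d (\<gamma> t) w) (at t within S)"
  by (rule curve_derivative[OF assms(1,3,4,5) transition_derivative[OF assms(1,2)]])

text \<open>The body of \<open>C1_curve_on\<close> with the velocity made explicit and an arbitrary parameter set, so that it
  can be restricted, shifted and compared with the right velocity.\<close>

definition velocity_on :: "(real \<Rightarrow> ('a, 'e) tangent) \<Rightarrow> (real \<Rightarrow> 'a) \<Rightarrow> real set \<Rightarrow> bool" where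
  "velocity_on V \<gamma> S \<longleftrightarrow>
     continuous_map (top_of_set S) (mtop N) \<gamma> \<and>
     (\<forall>t\<in>S. V t \<in> tangent_space N (\<gamma> t) \<and>
        (\<forall>c\<in>charts_at N (\<gamma> t). ((snd c \<circ> \<gamma>) has_vector_derivative V t c) (at t within S))) \<and>
     (\<forall>c\<in>atlas N. continuous_on {t\<in>S. \<gamma> t \<in> fst c} (\<lambda>t. V t c))"

lemma C1_curve_on_velocity: "C1_curve_on N \<gamma> a b \<longleftrightarrow> (\<exists>V. velocity_on V \<gamma> {a..b})"
  unfolding C1_curve_on_def velocity_on_def by blast

lemma velocity_on_subset:
  assumes V: "velocity_on V \<gamma> S" and T: "T \<subseteq> S"
  shows "velocity_on V \<gamma> T"
  unfolding velocity_on_def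
proof (intro conjI ballI)
  show "continuous_map (top_of_set T) (mtop N) \<gamma>"
    using V T unfolding velocity_on_def by (meson continuous_map_from_subtopology_mono)
  fix t assume t: "t \<in> T"
  then have tS: "t \<in> S" using T by blast
  then show "V t \<in> tangent_space N (\<gamma> t)" using V unfolding velocity_on_def by blast
  fix c assume c: "c \<in> charts_at N (\<gamma> t)"
  have "((snd c \<circ> \<gamma>) has_vector_derivative V t c) (at t within S)"
    using V tS c unfolding velocity_on_def by blast
  then show "((snd c \<circ> \<gamma>) has_vector_derivative V t c) (at t within T)"
    using T by (rule has_vector_derivative_within_subset)
next
  fix c assume "c \<in> atlas N"
  then have "continuous_on {t\<in>S. \<gamma> t \<in> fst c} (\<lambda>t. V t c)" using V unfolding velocity_on_def by blast
  then show "continuous_on {t\<in>T. \<gamma> t \<in> fst c} (\<lambda>t. V t c)"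
    by (rule continuous_on_subset) (use T in blast)
qed

lemma velocity_on_cong:
  assumes V: "velocity_on V \<gamma> S" and eq: "\<And>t. t \<in> S \<Longrightarrow> \<gamma>' t = \<gamma> t"
  shows "velocity_on V \<gamma>' S"
  unfolding velocity_on_def
proof (intro conjI ballI)
  show "continuous_map (top_of_set S) (mtop N) \<gamma>'"
    using V eq unfolding velocity_on_def by (auto intro: continuous_map_eq)
  fix t assume t: "t \<in> S"
  then show "V t \<in> tangent_space N (\<gamma>' t)" using V eq unfolding velocity_on_def by auto
  fix c assume c: "c \<in> charts_at N (\<gamma>' t)"
  have "((snd c \<circ> \<gamma>) has_vector_derivative V t c) (at t within S)"
    using V t c eq unfolding velocity_on_def by auto
  then show "((snd c \<circ> \<gamma>') has_vector_derivative V t c) (at t within S)"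
    by (rule has_vector_derivative_transform[OF t, rotated]) (simp add: eq)
next
  fix c assume "c \<in> atlas N"
  then have "continuous_on {t\<in>S. \<gamma> t \<in> fst c} (\<lambda>t. V t c)" using V unfolding velocity_on_def by blast
  moreover have "{t\<in>S. \<gamma> t \<in> fst c} = {t\<in>S. \<gamma>' t \<in> fst c}" using eq by auto
  ultimately show "continuous_on {t\<in>S. \<gamma>' t \<in> fst c} (\<lambda>t. V t c)" by simp
qed

lemma velocity_on_shift:
  assumes V: "velocity_on V \<gamma> {a..b}"
  shows "velocity_on (\<lambda>t. V (t + k)) (\<lambda>t. \<gamma> (t + k)) {a - k..b - k}"
  unfolding velocity_on_def
proof (intro conjI ballI)
  let ?S = "{a - k..b - k}"
  have img: "(\<lambda>t. t + k) ` ?S = {a..b}"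
    by (auto simp: image_iff intro: bexI[of _ "x - k" for x])
  have cm: "continuous_map (top_of_set ?S) (top_of_set {a..b}) (\<lambda>t. t + k)"
    by (auto intro!: continuous_intros)
  show "continuous_map (top_of_set ?S) (mtop N) (\<lambda>t. \<gamma> (t + k))"
    using continuous_map_compose[OF cm, of "mtop N" \<gamma>] V unfolding velocity_on_def comp_def by blast
  fix t assume t: "t \<in> ?S"
  then have tk: "t + k \<in> {a..b}" by auto
  then show "V (t + k) \<in> tangent_space N (\<gamma> (t + k))" using V unfolding velocity_on_def by blast
  fix c assume c: "c \<in> charts_at N (\<gamma> (t + k))"
  have "((snd c \<circ> \<gamma>) has_vector_derivative V (t + k) c) (at (t + k) within {a..b})"
    using V tk c unfolding velocity_on_def by blast
  moreover have "((\<lambda>t. t + k) has_vector_derivative 1) (at t within ?S)"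
    by (auto intro!: derivative_eq_intros simp: has_vector_derivative_def)
  ultimately have "((snd c \<circ> \<gamma>) \<circ> (\<lambda>t. t + k) has_vector_derivative 1 *\<^sub>R V (t + k) c) (at t within ?S)"
    by (intro vector_diff_chain_within) (simp_all only: img)
  then show "((snd c \<circ> (\<lambda>t. \<gamma> (t + k))) has_vector_derivative V (t + k) c) (at t within ?S)"
    by (simp add: comp_def)
next
  let ?S = "{a - k..b - k}"
  fix c assume "c \<in> atlas N"
  then have "continuous_on {t\<in>{a..b}. \<gamma> t \<in> fst c} (\<lambda>t. V t c)" using V unfolding velocity_on_def by blast
  then show "continuous_on {t\<in>?S. \<gamma> (t + k) \<in> fst c} (\<lambda>t. V (t + k) c)"
    by (rule continuous_on_compose2) (auto intro!: continuous_intros)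
qed

lemma right_velocity_eq:
  assumes c: "c \<in> charts_at N (\<gamma> t)" and "limitin (mtop N) \<gamma> (\<gamma> t) (at_right t)"
    and "((snd c \<circ> \<gamma>) has_vector_derivative w) (at_right t)"
  shows "right_velocity N \<gamma> t = tangent_of_coord N c (\<gamma> t) w"
proof
  fix d
  show "right_velocity N \<gamma> t d = tangent_of_coord N c (\<gamma> t) w d"
  proof (cases "d \<in> charts_at N (\<gamma> t)")
    case True
    have "((snd d \<circ> \<gamma>) has_vector_derivative DT c d (\<gamma> t) w) (at t within {t..})"
      by (rule curve_chart_change) (use assms True in \<open>auto simp: at_within_Ici_at_right\<close>)
    then have "vector_derivative (snd d \<circ> \<gamma>) (at_right t) = DT c d (\<gamma> t) w"
      by (intro vector_derivative_within) (auto simp: at_within_Ici_at_right)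
    then show ?thesis using True by (simp add: right_velocity_def tangent_of_coord_def)
  qed (simp add: right_velocity_def tangent_of_coord_def)
qed

lemma right_velocity_velocity_on:
  assumes V: "velocity_on V \<gamma> {t..b}" and tb: "t < b"
  shows "right_velocity N \<gamma> t = V t"
proof -
  have at: "at t within {t..b} = at_right t" using tb by (rule at_within_Icc_at_right)
  have t: "t \<in> {t..b}" using tb by simp
  have "continuous_map (top_of_set {t..b}) (mtop N) \<gamma>" and Vt: "V t \<in> tangent_space N (\<gamma> t)"
    and der: "\<And>c. c \<in> charts_at N (\<gamma> t) \<Longrightarrow> ((snd c \<circ> \<gamma>) has_vector_derivative V t c) (at t within {t..b})"
    using V t unfolding velocity_on_def by blast+
  then have lim: "limitin (mtop N) \<gamma> (\<gamma> t) (at_right t)"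
    using t unfolding continuous_map_limitin at[symmetric] by blast
  obtain c where c: "c \<in> charts_at N (\<gamma> t)" using chart_exists[OF limitin_topspace[OF lim]] by blast
  have "((snd c \<circ> \<gamma>) has_vector_derivative V t c) (at_right t)"
    using der[OF c] unfolding at .
  then show ?thesis
    using right_velocity_eq[OF c lim] tangent_of_coord_coord[OF c Vt] by simp
qed

text \<open>Unlike the definition, this form does not ask the ends of a smooth piece to be breakpoints. It therefore
  survives passing to subintervals and adding breakpoints.\<close>

lemma piecewise_C1_curve_iff:
  assumes "t0 < t1"
  shows "piecewise_C1_curve N \<gamma> t0 t1 \<longleftrightarrow>
    continuous_map (top_of_set {t0..t1}) (mtop N) \<gamma> \<and>
    (\<exists>P. finite P \<and> (\<forall>a b. t0 \<le> a \<and> a < b \<and> b \<le> t1 \<and> P \<inter> {a<..<b} = {} \<longrightarrow> C1_curve_on N \<gamma> a b))"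
    (is "?L \<longleftrightarrow> ?C \<and> ?R")
proof
  assume ?L
  then obtain P where P: "finite P" "P \<subseteq> {t0..t1}" "t0 \<in> P" "t1 \<in> P"
    "\<And>a b. a \<in> P \<Longrightarrow> b \<in> P \<Longrightarrow> a < b \<Longrightarrow> P \<inter> {a<..<b} = {} \<Longrightarrow> C1_curve_on N \<gamma> a b" and ?C
    unfolding piecewise_C1_curve_def by blast
  have "C1_curve_on N \<gamma> a b" if ab: "t0 \<le> a" "a < b" "b \<le> t1" "P \<inter> {a<..<b} = {}" for a b
  proof -
    define p where "p = Max {x \<in> P. x \<le> a}"
    define q where "q = Min {x \<in> P. b \<le> x}"
    have p: "p \<in> {x \<in> P. x \<le> a}" unfolding p_def by (rule Max_in) (use P ab in auto)
    have q: "q \<in> {x \<in> P. b \<le> x}" unfolding q_def by (rule Min_in) (use P ab in auto)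
    have "P \<inter> {p<..<q} = {}"
    proof (rule ccontr)
      assume "P \<inter> {p<..<q} \<noteq> {}"
      then obtain x where x: "x \<in> P" "p < x" "x < q" by auto
      have "a < x" using Max_ge[of "{x \<in> P. x \<le> a}" x] x P(1) unfolding p_def[symmetric] by force
      moreover have "x < b" using Min_le[of "{x \<in> P. b \<le> x}" x] x P(1) unfolding q_def[symmetric] by force
      ultimately show False using ab(4) x(1) by auto
    qed
    then have "C1_curve_on N \<gamma> p q" using P(5)[of p q] p q ab(2) by auto
    then show ?thesis
      unfolding C1_curve_on_velocity using velocity_on_subset[of _ \<gamma> "{p..q}" "{a..b}"] p q by auto
  qed
  with P(1) \<open>?C\<close> show "?C \<and> ?R" by blast
next
  assume R: "?C \<and> ?R"
  then obtain P where P: "finite P"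
    "\<And>a b. t0 \<le> a \<Longrightarrow> a < b \<Longrightarrow> b \<le> t1 \<Longrightarrow> P \<inter> {a<..<b} = {} \<Longrightarrow> C1_curve_on N \<gamma> a b" by blast
  let ?P = "insert t0 (insert t1 (P \<inter> {t0..t1}))"
  have "C1_curve_on N \<gamma> a b" if "a \<in> ?P" "b \<in> ?P" "a < b" "?P \<inter> {a<..<b} = {}" for a b
  proof (rule P(2))
    show "t0 \<le> a" "b \<le> t1" using that assms by auto
    then show "P \<inter> {a<..<b} = {}" using that by fastforce
  qed (use that in auto)
  moreover have "finite ?P" "?P \<subseteq> {t0..t1}" using P(1) assms by auto
  ultimately show ?L using R unfolding piecewise_C1_curve_def
    by (intro conjI exI[of _ ?P]) blast+
qed

text \<open>Conal and strictly conal curves are the instances for the cones and for their interiors; cutting and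
  joining curves is treated once for both.\<close>

definition field_curve :: "('a \<Rightarrow> ('a, 'e) tangent set) \<Rightarrow> (real \<Rightarrow> 'a) \<Rightarrow> real \<Rightarrow> real \<Rightarrow> bool" where
  "field_curve K \<gamma> a b \<longleftrightarrow> a < b \<and> piecewise_C1_curve N \<gamma> a b \<and>
     (\<forall>t. a \<le> t \<and> t < b \<longrightarrow> right_velocity N \<gamma> t \<in> K (\<gamma> t))"

lemma conal_curve_field: "conal_curve N C \<gamma> a b \<longleftrightarrow> field_curve C \<gamma> a b"
  unfolding conal_curve_def field_curve_def by simp

lemma strictly_conal_curve_field:
  "strictly_conal_curve N C \<gamma> a b \<longleftrightarrow> field_curve (cone_interior N C) \<gamma> a b"
proof -
  have "v \<in> C p" if "v \<in> cone_interior N C p" for v p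
    using that unfolding cone_interior_def by (rule subsetD[OF interior_of_subset])
  then show ?thesis
    unfolding strictly_conal_curve_def conal_curve_def field_curve_def by blast
qed

lemma conal_ll_le: "conal_ll N C x y \<Longrightarrow> conal_le N C x y"
  unfolding conal_ll_def conal_le_def strictly_conal_curve_def by blast

lemma field_curveE:
  assumes "field_curve K \<gamma> t0 t1"
  obtains P where "t0 < t1" "continuous_map (top_of_set {t0..t1}) (mtop N) \<gamma>" "finite P"
    "\<And>a b. t0 \<le> a \<Longrightarrow> a < b \<Longrightarrow> b \<le> t1 \<Longrightarrow> P \<inter> {a<..<b} = {} \<Longrightarrow> \<exists>V. velocity_on V \<gamma> {a..b}"
    "\<And>a b V. t0 \<le> a \<Longrightarrow> a < b \<Longrightarrow> b \<le> t1 \<Longrightarrow> velocity_on V \<gamma> {a..b} \<Longrightarrow> V a \<in> K (\<gamma> a)"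
proof -
  have lt: "t0 < t1" using assms by (simp add: field_curve_def)
  then obtain P where P: "continuous_map (top_of_set {t0..t1}) (mtop N) \<gamma>" "finite P"
    "\<And>a b. t0 \<le> a \<Longrightarrow> a < b \<Longrightarrow> b \<le> t1 \<Longrightarrow> P \<inter> {a<..<b} = {} \<Longrightarrow> \<exists>V. velocity_on V \<gamma> {a..b}"
    using assms unfolding field_curve_def piecewise_C1_curve_iff[OF lt] C1_curve_on_velocity by blast
  have "V a \<in> K (\<gamma> a)" if "t0 \<le> a" "a < b" "b \<le> t1" "velocity_on V \<gamma> {a..b}" for a b V
    using right_velocity_velocity_on[OF that(4,2)] assms that unfolding field_curve_def by fastforce
  with lt P that show ?thesis by blast
qed

lemma next_breakpoint:
  assumes "finite P" "t < (t1::real)"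
  shows "\<exists>b. t < b \<and> b \<le> t1 \<and> P \<inter> {t<..<b} = {}"
proof -
  let ?b = "Min (insert t1 {x\<in>P. t < x})"
  have "?b \<in> insert t1 {x\<in>P. t < x}" using assms by (intro Min_in) auto
  then have "t < ?b" using assms by auto
  moreover have "?b \<le> t1" using assms by simp
  moreover have "P \<inter> {t<..<?b} = {}" using assms(1) by (auto simp: not_less)
  ultimately show ?thesis by blast
qed

lemma field_curveI:
  assumes lt: "t0 < t1" and cont: "continuous_map (top_of_set {t0..t1}) (mtop N) \<gamma>" and P: "finite P"
    and V: "\<And>a b. t0 \<le> a \<Longrightarrow> a < b \<Longrightarrow> b \<le> t1 \<Longrightarrow> P \<inter> {a<..<b} = {} \<Longrightarrow>
      \<exists>V. velocity_on V \<gamma> {a..b} \<and> V a \<in> K (\<gamma> a)"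
  shows "field_curve K \<gamma> t0 t1"
  unfolding field_curve_def
proof (intro conjI allI impI lt)
  show "piecewise_C1_curve N \<gamma> t0 t1"
    unfolding piecewise_C1_curve_iff[OF lt] C1_curve_on_velocity
  proof (intro conjI cont exI[of _ P] P allI impI)
    fix a b assume "t0 \<le> a \<and> a < b \<and> b \<le> t1 \<and> P \<inter> {a<..<b} = {}"
    then show "\<exists>V. velocity_on V \<gamma> {a..b}" using V[of a b] by blast
  qed
  fix t assume t: "t0 \<le> t \<and> t < t1"
  then obtain b where b: "t < b" "b \<le> t1" "P \<inter> {t<..<b} = {}" using next_breakpoint[OF P] by blast
  then obtain V where "velocity_on V \<gamma> {t..b}" "V t \<in> K (\<gamma> t)" using assms(4)[of t b] t by blast
  then show "right_velocity N \<gamma> t \<in> K (\<gamma> t)" using right_velocity_velocity_on b(1) by simp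
qed

lemma field_curve_subinterval:
  assumes \<gamma>: "field_curve K \<gamma> t0 t1" and ab: "t0 \<le> a" "a < b" "b \<le> t1"
  shows "field_curve K \<gamma> a b"
proof -
  obtain P where P: "t0 < t1" "continuous_map (top_of_set {t0..t1}) (mtop N) \<gamma>" "finite P"
    "\<And>a b. t0 \<le> a \<Longrightarrow> a < b \<Longrightarrow> b \<le> t1 \<Longrightarrow> P \<inter> {a<..<b} = {} \<Longrightarrow> \<exists>V. velocity_on V \<gamma> {a..b}"
    "\<And>a b V. t0 \<le> a \<Longrightarrow> a < b \<Longrightarrow> b \<le> t1 \<Longrightarrow> velocity_on V \<gamma> {a..b} \<Longrightarrow> V a \<in> K (\<gamma> a)"
    using field_curveE[OF \<gamma>] by metis
  show ?thesis
  proof (rule field_curveI[OF ab(2) _ P(3)])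
    show "continuous_map (top_of_set {a..b}) (mtop N) \<gamma>"
      by (rule continuous_map_from_subtopology_mono[OF P(2)]) (use ab in auto)
    fix a' b' assume *: "a \<le> a'" "a' < b'" "b' \<le> b" "P \<inter> {a'<..<b'} = {}"
    then have le: "t0 \<le> a'" "b' \<le> t1" using ab by auto
    then show "\<exists>V. velocity_on V \<gamma> {a'..b'} \<and> V a' \<in> K (\<gamma> a')"
      using P(4)[OF le(1) *(2) le(2) *(4)] P(5)[OF le(1) *(2) le(2)] by blast
  qed
qed

lemma field_curve_shift:
  assumes \<gamma>: "field_curve K \<gamma> t0 t1"
  shows "field_curve K (\<lambda>t. \<gamma> (t + k)) (t0 - k) (t1 - k)"
proof -
  obtain P where P: "t0 < t1" "continuous_map (top_of_set {t0..t1}) (mtop N) \<gamma>" "finite P"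
    "\<And>a b. t0 \<le> a \<Longrightarrow> a < b \<Longrightarrow> b \<le> t1 \<Longrightarrow> P \<inter> {a<..<b} = {} \<Longrightarrow> \<exists>V. velocity_on V \<gamma> {a..b}"
    "\<And>a b V. t0 \<le> a \<Longrightarrow> a < b \<Longrightarrow> b \<le> t1 \<Longrightarrow> velocity_on V \<gamma> {a..b} \<Longrightarrow> V a \<in> K (\<gamma> a)"
    using field_curveE[OF \<gamma>] by metis
  show ?thesis
  proof (rule field_curveI)
    show "t0 - k < t1 - k" using P(1) by simp
    have cm: "continuous_map (top_of_set {t0 - k..t1 - k}) (top_of_set {t0..t1}) (\<lambda>t. t + k)"
      by (auto intro!: continuous_intros)
    show "continuous_map (top_of_set {t0 - k..t1 - k}) (mtop N) (\<lambda>t. \<gamma> (t + k))"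
      using continuous_map_compose[OF cm P(2)] unfolding comp_def .
    show "finite ((\<lambda>x. x - k) ` P)" using P(3) by simp
    fix a b assume *: "t0 - k \<le> a" "a < b" "b \<le> t1 - k" "(\<lambda>x. x - k) ` P \<inter> {a<..<b} = {}"
    have "P \<inter> {a + k<..<b + k} = {}"
    proof (rule ccontr)
      assume "P \<inter> {a + k<..<b + k} \<noteq> {}"
      then obtain x where "x \<in> P" "a + k < x" "x < b + k" by auto
      then have "x - k \<in> (\<lambda>x. x - k) ` P \<inter> {a<..<b}" by auto
      then show False using *(4) by blast
    qed
    moreover have le: "t0 \<le> a + k" "a + k < b + k" "b + k \<le> t1" using * by auto
    ultimately obtain V where V: "velocity_on V \<gamma> {a + k..b + k}" using P(4) by blast
    then have "V (a + k) \<in> K (\<gamma> (a + k))" using P(5) le by blast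
    moreover have "velocity_on (\<lambda>t. V (t + k)) (\<lambda>t. \<gamma> (t + k)) {a..b}"
      using velocity_on_shift[OF V, of k] by simp
    ultimately show "\<exists>V. velocity_on V (\<lambda>t. \<gamma> (t + k)) {a..b} \<and> V a \<in> K (\<gamma> (a + k))" by blast
  qed
qed

lemma field_curve_join:
  assumes \<gamma>: "field_curve K \<gamma> a b" and \<delta>: "field_curve K \<delta> b c" and eq: "\<gamma> b = \<delta> b"
  shows "field_curve K (\<lambda>t. if t \<le> b then \<gamma> t else \<delta> t) a c" (is "field_curve K ?j a c")
proof -
  obtain P where P: "a < b" "continuous_map (top_of_set {a..b}) (mtop N) \<gamma>" "finite P"
    "\<And>r s. a \<le> r \<Longrightarrow> r < s \<Longrightarrow> s \<le> b \<Longrightarrow> P \<inter> {r<..<s} = {} \<Longrightarrow> \<exists>V. velocity_on V \<gamma> {r..s}"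
    "\<And>r s V. a \<le> r \<Longrightarrow> r < s \<Longrightarrow> s \<le> b \<Longrightarrow> velocity_on V \<gamma> {r..s} \<Longrightarrow> V r \<in> K (\<gamma> r)"
    using field_curveE[OF \<gamma>] by metis
  obtain Q where Q: "b < c" "continuous_map (top_of_set {b..c}) (mtop N) \<delta>" "finite Q"
    "\<And>r s. b \<le> r \<Longrightarrow> r < s \<Longrightarrow> s \<le> c \<Longrightarrow> Q \<inter> {r<..<s} = {} \<Longrightarrow> \<exists>V. velocity_on V \<delta> {r..s}"
    "\<And>r s V. b \<le> r \<Longrightarrow> r < s \<Longrightarrow> s \<le> c \<Longrightarrow> velocity_on V \<delta> {r..s} \<Longrightarrow> V r \<in> K (\<delta> r)"
    using field_curveE[OF \<delta>] by metis
  show ?thesis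
  proof (rule field_curveI)
    show "a < c" using P(1) Q(1) by simp
    show "finite (insert b (P \<union> Q))" using P(3) Q(3) by simp
    show "continuous_map (top_of_set {a..c}) (mtop N) ?j"
    proof (rule continuous_map_cases_le)
      have 1: "{x \<in> topspace (top_of_set {a..c}). x \<le> b} = {a..b}" using Q(1) by auto
      have 2: "{x \<in> topspace (top_of_set {a..c}). b \<le> x} = {b..c}" using P(1) by auto
      have 3: "{a..c} \<inter> {a..b} = {a..b}" "{a..c} \<inter> {b..c} = {b..c}" using P(1) Q(1) by auto
      show "continuous_map (subtopology (top_of_set {a..c}) {x \<in> topspace (top_of_set {a..c}). x \<le> b}) (mtop N) \<gamma>"
        unfolding 1 subtopology_subtopology 3 by (rule P(2))
      show "continuous_map (subtopology (top_of_set {a..c}) {x \<in> topspace (top_of_set {a..c}). b \<le> x}) (mtop N) \<delta>"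
        unfolding 2 subtopology_subtopology 3 by (rule Q(2))
    qed (auto simp: eq continuous_map_in_subtopology)
    fix r s assume *: "a \<le> r" "r < s" "s \<le> c" "insert b (P \<union> Q) \<inter> {r<..<s} = {}"
    then consider "s \<le> b" | "b \<le> r" by fastforce
    then show "\<exists>V. velocity_on V ?j {r..s} \<and> V r \<in> K (?j r)"
    proof cases
      case 1
      have "P \<inter> {r<..<s} = {}" using *(4) by blast
      then obtain V where V: "velocity_on V \<gamma> {r..s}" using P(4) * 1 by blast
      then have "V r \<in> K (\<gamma> r)" using P(5) * 1 by blast
      moreover have "velocity_on V ?j {r..s}" by (rule velocity_on_cong[OF V]) (use 1 in auto)
      ultimately show ?thesis using 1 *(2) by (intro exI[of _ V]) simp
    next
      case 2
      have "Q \<inter> {r<..<s} = {}" using *(4) by blast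
      then obtain V where V: "velocity_on V \<delta> {r..s}" using Q(4) * 2 by blast
      then have "V r \<in> K (\<delta> r)" using Q(5) * 2 by blast
      moreover have j: "?j t = \<delta> t" if "b \<le> t" for t using that eq by (cases "t = b") auto
      have "velocity_on V ?j {r..s}"
      proof (rule velocity_on_cong[OF V])
        fix t assume "t \<in> {r..s}"
        then show "?j t = \<delta> t" using 2 by (intro j) simp
      qed
      ultimately show ?thesis using j[OF 2] by (intro exI[of _ V]) simp
    qed
  qed
qed

lemma field_curve_trans:
  assumes \<gamma>: "field_curve K \<gamma> a b" and \<delta>: "field_curve K \<delta> c d" and eq: "\<gamma> b = \<delta> c"
  shows "\<exists>\<eta> e. field_curve K \<eta> a e \<and> \<eta> a = \<gamma> a \<and> \<eta> e = \<delta> d"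
proof -
  let ?\<delta> = "\<lambda>t. \<delta> (t + (c - b))" and ?e = "d - (c - b)"
  have "field_curve K ?\<delta> b ?e" using field_curve_shift[OF \<delta>, of "c - b"] by simp
  then have "field_curve K (\<lambda>t. if t \<le> b then \<gamma> t else ?\<delta> t) a ?e"
    by (rule field_curve_join[OF \<gamma>]) (simp add: eq)
  moreover have "a < b" "c < d" using \<gamma> \<delta> unfolding field_curve_def by auto
  ultimately show ?thesis by (intro exI conjI) (assumption, auto)
qed

lemma conal_ll_trans: "conal_ll N C x y \<Longrightarrow> conal_ll N C y z \<Longrightarrow> conal_ll N C x z"
  unfolding conal_ll_def strictly_conal_curve_field using field_curve_trans by metis

text \<open>Together with openness of the chronological sets, intermediate points make the relation open in
  both arguments at once.\<close>

lemma conal_ll_dense: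
  assumes "conal_ll N C x y"
  shows "\<exists>z. conal_ll N C x z \<and> conal_ll N C z y"
proof -
  obtain \<gamma> a b where \<gamma>: "field_curve (cone_interior N C) \<gamma> a b" "\<gamma> a = x" "\<gamma> b = y"
    using assms unfolding conal_ll_def strictly_conal_curve_field by blast
  then have "a < b" unfolding field_curve_def by simp
  then have "field_curve (cone_interior N C) \<gamma> a ((a + b) / 2)" "field_curve (cone_interior N C) \<gamma> ((a + b) / 2) b"
    using field_curve_subinterval[OF \<gamma>(1)] by auto
  with \<gamma> show ?thesis unfolding conal_ll_def strictly_conal_curve_field by blast
qed

lemma field_curve_topspace:
  assumes "field_curve K \<gamma> a b" "a \<le> t" "t \<le> b"
  shows "\<gamma> t \<in> topspace (mtop N)"
proof -
  have "continuous_map (top_of_set {a..b}) (mtop N) \<gamma>"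
    using assms(1) unfolding field_curve_def piecewise_C1_curve_def by blast
  then show ?thesis using continuous_map_image_subset_topspace assms(2,3) by fastforce
qed

lemma conal_le_topspace: "conal_le N C x y \<Longrightarrow> x \<in> topspace (mtop N) \<and> y \<in> topspace (mtop N)"
  unfolding conal_le_def conal_curve_field using field_curve_topspace
  by (metis field_curve_def order_less_imp_le order_refl)

end


section \<open>Linear perturbations of cones\<close>

lemma near_identity_surj:
  fixes A :: "'a::euclidean_space \<Rightarrow> 'a"
  assumes A: "linear A" and near: "\<And>h. norm (A h - h) \<le> e * norm h" and e: "0 \<le> e" "e \<le> 1/2"
  shows "\<exists>w'. w = A w' \<and> norm (w' - w) \<le> 2 * e * norm w"
proof -
  have half: "norm (A h - h) \<le> norm h / 2" for h
    using near[of h] mult_right_mono[OF e(2) norm_ge_zero[of h]] by simp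
  have "inj A"
    unfolding linear_injective_0[OF A]
  proof (intro allI impI)
    fix h assume "A h = 0"
    then show "h = 0" using half[of h] by simp
  qed
  then have "surj A" by (rule linear_inj_imp_surj[OF A])
  then obtain w' where w': "w = A w'" by (metis surjD)
  have "norm w' \<le> norm (A w') + norm (A w' - w')" by (metis norm_minus_commute norm_triangle_sub)
  then have "norm w' \<le> 2 * norm w" using half[of w'] w' by simp
  then have "e * norm w' \<le> e * (2 * norm w)"
    using e(1) by (rule mult_left_mono)
  then have "norm (w' - w) \<le> 2 * e * norm w"
    using near[of w'] w' by (simp add: norm_minus_commute)
  with w' show ?thesis by blast
qed

text \<open>Used to keep a fixed vector in the interior of all neighbouring cones.\<close>

lemma near_identity_interior:
  fixes K :: "'a::euclidean_space set"
  assumes v: "v \<in> interior K"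
  shows "\<exists>e>0. \<forall>A. linear A \<and> (\<forall>h. norm (A h - h) \<le> e * norm h) \<longrightarrow> v \<in> interior (A ` K)"
proof -
  obtain r where r: "r > 0" "ball v r \<subseteq> interior K"
    using v open_interior openE by metis
  define e where "e = min (1/2) (r / (4 * (norm v + 1)))"
  have "e > 0" using r(1) norm_ge_zero[of v] by (simp add: e_def add_nonneg_pos)
  moreover have "e \<le> 1/2" unfolding e_def by (rule min.cobounded1)
  ultimately have e: "e > 0" "0 \<le> e" "e \<le> 1/2" by simp_all
  have "2 * e * norm v < r"
  proof -
    have "e \<le> r / (4 * (norm v + 1))" unfolding e_def by (rule min.cobounded2)
    moreover have "0 < 4 * (norm v + 1)" using norm_ge_zero[of v] by (simp add: add_nonneg_pos)
    ultimately have "e * (4 * (norm v + 1)) \<le> r" by (simp only: pos_le_divide_eq)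
    then have "e * (2 * norm v) + (e * (2 * norm v) + 4 * e) \<le> r" by (simp add: algebra_simps)
    moreover have "0 \<le> e * (2 * norm v)" using e by simp
    ultimately have "e * (2 * norm v) < r" using e(1) by linarith
    then show ?thesis by (simp add: mult.assoc mult.left_commute)
  qed
  moreover have "v \<in> interior (A ` K)" if A: "linear A" "\<forall>h. norm (A h - h) \<le> e * norm h"
    and lt: "2 * e * norm v < r" for A
  proof -
    have sA: "surj A" using near_identity_surj[OF A(1), of e] A(2) e(2,3) by (metis surjI surj_def)
    obtain v' where v': "v = A v'" "norm (v' - v) \<le> 2 * e * norm v"
      using near_identity_surj[OF A(1), of e v] A(2) e(2,3) by blast
    then have "v' \<in> interior K" using r lt by (auto simp: dist_norm norm_minus_commute)
    then have "v \<in> A ` interior K" using v' by blast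
    moreover have "open (A ` interior K)" by (rule open_surjective_linear_image[OF open_interior A(1) sA])
    moreover have "A ` interior K \<subseteq> A ` K" by (rule image_mono[OF interior_subset])
    ultimately show ?thesis using interior_maximal by blast
  qed
  ultimately show ?thesis using e(1) by blast
qed

text \<open>The unit vectors of \<open>K1\<close> form a compact set, so \<open>L\<close> maps them into \<open>K2\<close> with a uniform margin \<open>r\<close>; by
  homogeneity the margin at \<open>L u\<close> is \<open>r * norm u\<close>. Perturbing both cones and the map by at most \<open>e\<close> costs
  only a multiple of \<open>e * norm u\<close>. The estimate is uniform also for vectors tending to \<open>0\<close>, which is what
  curves with vanishing velocity require.\<close>

lemma strictly_positive_map_near:
  fixes L :: "'a::euclidean_space \<Rightarrow> 'b::euclidean_space"
  assumes L: "linear L" and K1: "closed K1" "\<And>a u. a \<ge> 0 \<Longrightarrow> u \<in> K1 \<Longrightarrow> a *\<^sub>R u \<in> K1"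
    and K2: "0 \<in> K2" "\<And>a u. a \<ge> 0 \<Longrightarrow> u \<in> K2 \<Longrightarrow> a *\<^sub>R u \<in> K2"
    and pos: "\<And>u. u \<in> K1 \<Longrightarrow> u \<noteq> 0 \<Longrightarrow> L u \<in> interior K2"
  shows "\<exists>e>0. \<forall>A1 A2 L' w. linear A1 \<and> linear A2 \<and> linear L' \<and> (\<forall>h. norm (A1 h - h) \<le> e * norm h) \<and>
    (\<forall>h. norm (A2 h - h) \<le> e * norm h) \<and> (\<forall>h. norm (L' h - L h) \<le> e * norm h) \<and> w \<in> A1 ` K1 \<longrightarrow>
    L' w \<in> A2 ` K2"
proof -
  have "compact (L ` (sphere 0 1 \<inter> K1))"
  proof (rule compact_continuous_image)
    show "continuous_on (sphere 0 1 \<inter> K1) L"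
      using L by (simp add: linear_conv_bounded_linear linear_continuous_on)
    show "compact (sphere 0 1 \<inter> K1)" using K1(1) by (intro compact_Int_closed) auto
  qed
  moreover have "L ` (sphere 0 1 \<inter> K1) \<subseteq> interior K2"
  proof clarify
    fix u assume "u \<in> sphere 0 1" "u \<in> K1"
    then show "L u \<in> interior K2" using pos[of u] by (cases "u = 0") auto
  qed
  ultimately obtain r where r: "r > 0" "(\<Union>x\<in>L ` (sphere 0 1 \<inter> K1). ball x r) \<subseteq> interior K2"
    using compact_subset_open_imp_ball_epsilon_subset[OF _ open_interior] by metis
  have slack: "y \<in> K2" if u: "u \<in> K1" "u \<noteq> 0" "norm (y - L u) < r * norm u" for u y
  proof -
    let ?u = "(1 / norm u) *\<^sub>R u" and ?y = "(1 / norm u) *\<^sub>R y"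
    have "?u \<in> sphere 0 1 \<inter> K1" using K1(2)[of "1 / norm u" u] u by auto
    moreover have "L ?u = (1 / norm u) *\<^sub>R L u" by (rule linear_cmul[OF L])
    then have "?y - L ?u = (1 / norm u) *\<^sub>R (y - L u)" by (simp add: scaleR_diff_right)
    then have "norm (?y - L ?u) = norm (y - L u) / norm u" by simp
    then have "norm (?y - L ?u) < r" using u by (simp add: divide_less_eq)
    then have "?y \<in> ball (L ?u) r" by (simp add: dist_norm norm_minus_commute)
    ultimately have "?y \<in> interior K2" using r(2) by blast
    then have "?y \<in> K2" using interior_subset by blast
    from K2(2)[OF norm_ge_zero[of u] this] show ?thesis using u(2) by simp
  qed
  obtain B where B: "B > 0" "\<And>h. norm (L h) \<le> B * norm h"
    using linear_bounded_pos[OF L] by metis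
  \<comment> \<open>\<open>6 + 5 * B\<close> is the sum of the coefficients of \<open>e * norm u\<close> in the three errors below\<close>
  define e where "e = min (1/2) (r / (2 * (6 + 5 * B)))"
  have "e > 0" using r(1) B(1) by (simp add: e_def)
  moreover have "e \<le> 1/2" unfolding e_def by (rule min.cobounded1)
  ultimately have e: "e > 0" "0 \<le> e" "e \<le> 1/2" by simp_all
  have "e \<le> r / (2 * (6 + 5 * B))" unfolding e_def by (rule min.cobounded2)
  moreover have "0 < 2 * (6 + 5 * B)" using B(1) by simp
  ultimately have "e * (2 * (6 + 5 * B)) \<le> r" by (simp only: pos_le_divide_eq)
  moreover have "0 < e * (6 + 5 * B)" using e(1) B(1) by simp
  ultimately have er: "e * (6 + 5 * B) < r" by (simp only: mult.left_commute[of e 2])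
  have "L' w \<in> A2 ` K2" if A: "linear A1" "linear A2" "linear L'" "\<forall>h. norm (A1 h - h) \<le> e * norm h"
    "\<forall>h. norm (A2 h - h) \<le> e * norm h" "\<forall>h. norm (L' h - L h) \<le> e * norm h" "w \<in> A1 ` K1" for A1 A2 L' w
  proof -
    obtain u where u: "u \<in> K1" "w = A1 u" using A(7) by blast
    show ?thesis
    proof (cases "u = 0")
      case True
      then have "L' w = A2 0" using u linear_0 A(1,2,3) by metis
      then show ?thesis using K2(1) by blast
    next
      case False
      have nu: "norm u > 0" using False by simp
      have 1: "norm (w - u) \<le> e * norm u" using A(4) u by blast
      moreover have "e * norm u \<le> norm u" using e nu by (simp add: mult_le_cancel_right1)
      ultimately have w: "norm w \<le> 2 * norm u" using norm_triangle_sub[of w u] by simp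
      have Lw: "norm (L' w - L w) \<le> e * (2 * norm u)"
        using A(6)[rule_format, of w] mult_left_mono[OF w, of e] e(1) by linarith
      have "L w - L u = L (w - u)" by (simp add: linear_diff[OF L])
      then have "norm (L w - L u) \<le> B * norm (w - u)" using B(2) by simp
      also have "\<dots> \<le> B * (e * norm u)" using 1 B(1) by simp
      finally have 2: "norm (L w - L u) \<le> B * (e * norm u)" .
      have "norm (L w) \<le> B * (2 * norm u)"
        using B(2)[of w] mult_left_mono[OF w, of B] B(1) by linarith
      moreover have "e * (2 * norm u) \<le> 1 * (2 * norm u)" using e nu by (intro mult_right_mono) auto
      ultimately have "norm (L' w) \<le> B * (2 * norm u) + 2 * norm u"
        using Lw norm_triangle_sub[of "L' w" "L w"] by simp
      then have 3: "2 * e * norm (L' w) \<le> 2 * e * (B * (2 * norm u) + 2 * norm u)"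
        using e(1) by (intro mult_left_mono) auto
      obtain w' where w': "L' w = A2 w'" "norm (w' - L' w) \<le> 2 * e * norm (L' w)"
        using near_identity_surj[OF A(2), of e "L' w"] A(5) e(2,3) by blast
      have "norm (w' - L u) \<le> norm (w' - L' w) + norm (L' w - L w) + norm (L w - L u)"
        by norm
      also have "\<dots> \<le> 2 * e * (B * (2 * norm u) + 2 * norm u) + e * (2 * norm u) + B * (e * norm u)"
        using w'(2) 3 Lw 2 by linarith
      also have "\<dots> = e * (6 + 5 * B) * norm u" by (simp add: algebra_simps)
      also have "\<dots> < r * norm u" using er nu by simp
      finally have "w' \<in> K2" by (rule slack[OF u(1) False])
      then show ?thesis using w'(1) by blast
    qed
  qed
  with e(1) show ?thesis by blast
qed

lemma cone_add_interior:
  fixes K :: "'a::real_normed_vector set"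
  assumes "w \<in> K" "v \<in> interior K" "\<And>x y. x \<in> K \<Longrightarrow> y \<in> K \<Longrightarrow> x + y \<in> K"
  shows "w + v \<in> interior K"
proof (rule interiorI)
  show "open ((+) w ` interior K)" by (rule open_translation) simp
  show "w + v \<in> (+) w ` interior K" using assms(2) by blast
  show "(+) w ` interior K \<subseteq> K" using assms(1,3) interior_subset by blast
qed

section \<open>Curves moved by maps and by charts\<close>

context manifold begin

lemma DT_tendsto:
  assumes c: "c \<in> charts_at N p" and d: "d \<in> charts_at N p"
    and lim: "limitin (mtop N) g p F"
  shows "((\<lambda>i. DT c d (g i) h) \<longlongrightarrow> DT c d p h) F"
proof -
  have ca: "c \<in> atlas N" "d \<in> atlas N" "p \<in> fst c" "p \<in> fst d" using charts_atD c d by blast+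
  let ?T = "snd c ` (fst c \<inter> fst d)"
  have "open ?T" by (rule openin_chart_image[OF ca(1) openin_chart[OF ca(2)]])
  then have "isCont (\<lambda>y. frechet_derivative (snd d \<circ> chart_inv c) (at y) h) (snd c p)"
    using Ck_on_1_continuous[OF transition_Ck[OF ca(1,2)], of h] ca
    by (simp add: continuous_on_eq_continuous_at)
  then show ?thesis
    by (rule isCont_tendsto_compose[OF _ conjunct2[OF lim[unfolded limitin_chart[OF c]]]])
qed

text \<open>One chart per parameter is enough: the other charts follow from continuity of the derivatives of the
  transition maps.\<close>

lemma velocity_onI:
  assumes cont: "\<And>t. t \<in> S \<Longrightarrow> limitin (mtop N) \<gamma> (\<gamma> t) (at t within S)"
    and tan: "\<And>t. t \<in> S \<Longrightarrow> V t \<in> tangent_space N (\<gamma> t)"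
    and loc: "\<And>t. t \<in> S \<Longrightarrow> \<exists>c\<in>charts_at N (\<gamma> t).
      ((snd c \<circ> \<gamma>) has_vector_derivative V t c) (at t within S) \<and> ((\<lambda>s. V s c) \<longlongrightarrow> V t c) (at t within S)"
  shows "velocity_on V \<gamma> S"
  unfolding velocity_on_def
proof (intro conjI ballI)
  show "continuous_map (top_of_set S) (mtop N) \<gamma>" unfolding continuous_map_limitin using cont by blast
  fix t assume t: "t \<in> S"
  show "V t \<in> tangent_space N (\<gamma> t)" by (rule tan[OF t])
  fix d assume d: "d \<in> charts_at N (\<gamma> t)"
  obtain c where c: "c \<in> charts_at N (\<gamma> t)" "((snd c \<circ> \<gamma>) has_vector_derivative V t c) (at t within S)"
    using loc[OF t] by blast
  show "((snd d \<circ> \<gamma>) has_vector_derivative V t d) (at t within S)"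
    unfolding tangent_change[OF tan[OF t] c(1) d]
    by (rule curve_chart_change[OF c(1) d t cont[OF t] c(2)])
next
  fix d assume da: "d \<in> atlas N"
  show "continuous_on {t\<in>S. \<gamma> t \<in> fst d} (\<lambda>t. V t d)"
    unfolding continuous_on_def
  proof
    fix t assume "t \<in> {t\<in>S. \<gamma> t \<in> fst d}"
    then have t: "t \<in> S" and d: "d \<in> charts_at N (\<gamma> t)" using da by (auto simp: charts_at_def)
    obtain c where c: "c \<in> charts_at N (\<gamma> t)" "((\<lambda>s. V s c) \<longlongrightarrow> V t c) (at t within S)"
      using loc[OF t] by blast
    have ev: "\<forall>\<^sub>F s in at t within S. c \<in> charts_at N (\<gamma> s) \<and> d \<in> charts_at N (\<gamma> s)"
    proof -
      have "\<forall>\<^sub>F s in at t within S. \<gamma> s \<in> fst c" "\<forall>\<^sub>F s in at t within S. \<gamma> s \<in> fst d"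
        using cont[OF t] limitin_chart[OF c(1)] limitin_chart[OF d] by blast+
      then show ?thesis
        by eventually_elim (use da charts_atD(1)[OF c(1)] in \<open>simp add: charts_at_def\<close>)
    qed
    have "((\<lambda>s. DT c d (\<gamma> s) (V s c)) \<longlongrightarrow> DT c d (\<gamma> t) (V t c)) (at t within S)"
    proof (rule linear_family_tendsto[OF _ linear_DT[OF c(1) d] _ c(2)])
      show "\<forall>\<^sub>F s in at t within S. linear (DT c d (\<gamma> s))"
        using ev by eventually_elim (rule linear_DT; blast)
    qed (rule DT_tendsto[OF c(1) d cont[OF t]])
    moreover have "\<forall>\<^sub>F s in at t within S. DT c d (\<gamma> s) (V s c) = V s d"
    proof -
      have "\<forall>\<^sub>F s in at t within S. s \<in> S" by (simp add: eventually_at_filter)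
      with ev show ?thesis
      proof eventually_elim
        case (elim s)
        show ?case using tangent_change[OF tan, of s c d] elim by simp
      qed
    qed
    ultimately have "((\<lambda>s. V s d) \<longlongrightarrow> V t d) (at t within S)"
      unfolding tangent_change[OF tan[OF t] c(1) d] by (rule Lim_transform_eventually)
    then show "((\<lambda>t. V t d) \<longlongrightarrow> V t d) (at t within {t \<in> S. \<gamma> t \<in> fst d})"
      by (rule tendsto_within_subset) blast
  qed
qed

lemma velocity_onD:
  assumes "velocity_on V \<gamma> S" "t \<in> S"
  shows "limitin (mtop N) \<gamma> (\<gamma> t) (at t within S)" "V t \<in> tangent_space N (\<gamma> t)"
    and "c \<in> charts_at N (\<gamma> t) \<Longrightarrow> ((snd c \<circ> \<gamma>) has_vector_derivative V t c) (at t within S)"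
    and "c \<in> charts_at N (\<gamma> t) \<Longrightarrow> ((\<lambda>s. V s c) \<longlongrightarrow> V t c) (at t within S)"
proof -
  have "continuous_map (top_of_set S) (mtop N) \<gamma>" using assms(1) unfolding velocity_on_def by blast
  then show lim: "limitin (mtop N) \<gamma> (\<gamma> t) (at t within S)" 
    unfolding continuous_map_limitin using assms(2) by blast
  show "V t \<in> tangent_space N (\<gamma> t)" using assms unfolding velocity_on_def by blast
  assume c: "c \<in> charts_at N (\<gamma> t)"
  then show "((snd c \<circ> \<gamma>) has_vector_derivative V t c) (at t within S)"
    using assms unfolding velocity_on_def by blast
  have ca: "c \<in> atlas N" "\<gamma> t \<in> fst c" using charts_atD c by blast+
  then have "continuous_on {t\<in>S. \<gamma> t \<in> fst c} (\<lambda>t. V t c)" using assms(1) unfolding velocity_on_def by blast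
  then have *: "((\<lambda>s. V s c) \<longlongrightarrow> V t c) (at t within {t\<in>S. \<gamma> t \<in> fst c})"
    using assms(2) ca unfolding continuous_on_def by blast
  have "\<forall>\<^sub>F s in at t within S. \<gamma> s \<in> fst c" using lim limitin_chart[OF c] by blast
  then obtain T where T: "open T" "t \<in> T" "\<And>s. s \<in> T \<Longrightarrow> s \<noteq> t \<Longrightarrow> s \<in> S \<Longrightarrow> \<gamma> s \<in> fst c"
    unfolding eventually_at_topological by blast
  have "at t within {t\<in>S. \<gamma> t \<in> fst c} = at t within S"
    by (rule at_within_nhd[OF T(2,1)]) (use T(3) in blast)
  with * show "((\<lambda>s. V s c) \<longlongrightarrow> V t c) (at t within S)" by simp
qed

abbreviation DM :: "('a \<Rightarrow> 'a) \<Rightarrow> ('a, 'e) chart \<Rightarrow> ('a, 'e) chart \<Rightarrow> 'a \<Rightarrow> 'e \<Rightarrow> 'e" where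
  "DM f c d p \<equiv> frechet_derivative (snd d \<circ> f \<circ> chart_inv c) (at (snd c p))"

lemma DM_derivative:
  assumes f: "Ck_map 1 N N f" and c: "c \<in> charts_at N p" and d: "d \<in> charts_at N (f p)"
  shows "((snd d \<circ> f \<circ> chart_inv c) has_derivative DM f c d p) (at (snd c p))"
    and "limitin (mtop N) g p F \<Longrightarrow> ((\<lambda>i. DM f c d (g i) h) \<longlongrightarrow> DM f c d p h) F"
proof -
  have ca: "c \<in> atlas N" "d \<in> atlas N" "p \<in> fst c" "f p \<in> fst d" using charts_atD c d by blast+
  have Ck: "Ck_on 1 (snd d \<circ> f \<circ> chart_inv c) (snd c ` {p \<in> fst c. f p \<in> fst d})"
    using f ca(1,2) unfolding Ck_map_def by blast
  show "((snd d \<circ> f \<circ> chart_inv c) has_derivative DM f c d p) (at (snd c p))"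
    by (rule Ck_on_1_derivative[OF Ck]) (use ca in blast)
  assume lim: "limitin (mtop N) g p F"
  have "openin (mtop N) {p \<in> topspace (mtop N). f p \<in> fst d}"
    using f openin_chart[OF ca(2)] unfolding Ck_map_def continuous_map_def by blast
  then have "open (snd c ` (fst c \<inter> {p \<in> topspace (mtop N). f p \<in> fst d}))"
    by (rule openin_chart_image[OF ca(1)])
  moreover have "fst c \<inter> {p \<in> topspace (mtop N). f p \<in> fst d} = {p \<in> fst c. f p \<in> fst d}"
    using openin_subset[OF openin_chart[OF ca(1)]] by blast
  ultimately have "open (snd c ` {p \<in> fst c. f p \<in> fst d})" by simp
  then have "isCont (\<lambda>y. frechet_derivative (snd d \<circ> f \<circ> chart_inv c) (at y) h) (snd c p)"
    using Ck_on_1_continuous[OF Ck, of h] ca by (simp add: continuous_on_eq_continuous_at)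
  then show "((\<lambda>i. DM f c d (g i) h) \<longlongrightarrow> DM f c d p h) F"
    by (rule isCont_tendsto_compose[OF _ conjunct2[OF lim[unfolded limitin_chart[OF c]]]])
qed

lemma mdiff_DM:
  assumes f: "Ck_map 1 N N f" and c: "c \<in> charts_at N p" and d: "d \<in> charts_at N (f p)"
    and v: "v \<in> tangent_space N p"
  shows "mdiff N N f p v d = DM f c d p (v c)"
  by (rule mdiff_chart[OF manifold_axioms c d v DM_derivative(1)[OF f c d]])

lemma mdiff_tangent_space:
  assumes f: "Ck_map 1 N N f" and p: "p \<in> topspace (mtop N)" and v: "v \<in> tangent_space N p"
  shows "mdiff N N f p v \<in> tangent_space N (f p)"
proof -
  obtain c where c: "c \<in> charts_at N p" using chart_exists[OF p] by blast
  have "mdiff N N f p v e = DT d e (f p) (mdiff N N f p v d)"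
    if d: "d \<in> charts_at N (f p)" and e: "e \<in> charts_at N (f p)" for d e
  proof -
    have ca: "c \<in> atlas N" "d \<in> atlas N" "p \<in> fst c" "f p \<in> fst d" using charts_atD c d by blast+
    have "((snd e \<circ> chart_inv d) \<circ> (snd d \<circ> f \<circ> chart_inv c) has_derivative (DT d e (f p) \<circ> DM f c d p)) (at (snd c p))"
      using ca transition_derivative[OF d e] DM_derivative(1)[OF f c d] by (intro diff_chain_at) auto
    moreover have "\<forall>\<^sub>F y in at (snd c p). ((snd e \<circ> chart_inv d) \<circ> (snd d \<circ> f \<circ> chart_inv c)) y = (snd e \<circ> f \<circ> chart_inv c) y"
    proof -
      have "limitin (mtop N) (\<lambda>y. chart_inv c y) (chart_inv c (snd c p)) (at (snd c p))"
        by (rule limitin_chart_inv) (use ca in auto)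
      then have "limitin (mtop N) (f \<circ> chart_inv c) (f p) (at (snd c p))"
        using continuous_map_limit[of "mtop N" "mtop N" f] f ca unfolding Ck_map_def by fastforce
      then have "\<forall>\<^sub>F y in at (snd c p). f (chart_inv c y) \<in> fst d"
        unfolding limitin_chart[OF d] by simp
      then show ?thesis by eventually_elim (use ca in simp)
    qed
    ultimately have "(snd e \<circ> f \<circ> chart_inv c has_derivative (DT d e (f p) \<circ> DM f c d p)) (at (snd c p))"
      by (rule has_derivative_transform_eventually) (use ca in auto)
    then have "DM f c e p = DT d e (f p) \<circ> DM f c d p"
      using DM_derivative(1)[OF f c e] has_derivative_unique by blast
    then show ?thesis unfolding mdiff_DM[OF f c d v] mdiff_DM[OF f c e v] by simp
  qed
  moreover have "mdiff N N f p v e = 0" if "e \<notin> charts_at N (f p)" for e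
    using that by (simp add: mdiff_def Let_def)
  ultimately show ?thesis unfolding tangent_space_def by blast
qed

lemma velocity_on_image:
  assumes f: "Ck_map 1 N N f" and V: "velocity_on V \<gamma> S"
  shows "velocity_on (\<lambda>t. mdiff N N f (\<gamma> t) (V t)) (\<lambda>t. f (\<gamma> t)) S"
proof (rule velocity_onI)
  fix t assume t: "t \<in> S"
  note lim = velocity_onD(1)[OF V t] and tan = velocity_onD(2)[OF V t]
  have fc: "continuous_map (mtop N) (mtop N) f" using f unfolding Ck_map_def by blast
  show lim': "limitin (mtop N) (\<lambda>t. f (\<gamma> t)) (f (\<gamma> t)) (at t within S)"
    using continuous_map_limit[OF fc lim] by (simp add: comp_def)
  show "mdiff N N f (\<gamma> t) (V t) \<in> tangent_space N (f (\<gamma> t))"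
    by (rule mdiff_tangent_space[OF f limitin_topspace[OF lim] tan])
  obtain c where c: "c \<in> charts_at N (\<gamma> t)" using chart_exists[OF limitin_topspace[OF lim]] by blast
  obtain d where d: "d \<in> charts_at N (f (\<gamma> t))" using chart_exists[OF limitin_topspace[OF lim']] by blast
  have "((snd d \<circ> f) \<circ> \<gamma> has_vector_derivative DM f c d (\<gamma> t) (V t c)) (at t within S)"
    by (rule curve_derivative[OF c t lim velocity_onD(3)[OF V t c] DM_derivative(1)[OF f c d]])
  then have 1: "(snd d \<circ> (\<lambda>t. f (\<gamma> t)) has_vector_derivative mdiff N N f (\<gamma> t) (V t) d) (at t within S)"
    unfolding mdiff_DM[OF f c d tan] by (simp add: comp_def)
  have ev: "\<forall>\<^sub>F s in at t within S. s \<in> S \<and> c \<in> charts_at N (\<gamma> s) \<and> d \<in> charts_at N (f (\<gamma> s))"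
  proof -
    have "\<forall>\<^sub>F s in at t within S. \<gamma> s \<in> fst c" "\<forall>\<^sub>F s in at t within S. f (\<gamma> s) \<in> fst d"
      "\<forall>\<^sub>F s in at t within S. s \<in> S"
      using lim lim' unfolding limitin_chart[OF c] limitin_chart[OF d] by (simp_all add: eventually_at_filter)
    then show ?thesis
      by eventually_elim (use charts_atD(1)[OF c] charts_atD(1)[OF d] in \<open>simp add: charts_at_def\<close>)
  qed
  have "((\<lambda>s. DM f c d (\<gamma> s) (V s c)) \<longlongrightarrow> DM f c d (\<gamma> t) (V t c)) (at t within S)"
  proof (rule linear_family_tendsto[OF _ has_derivative_linear[OF DM_derivative(1)[OF f c d]] _ velocity_onD(4)[OF V t c]])
    show "\<forall>\<^sub>F s in at t within S. linear (DM f c d (\<gamma> s))"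
      using ev by eventually_elim (rule has_derivative_linear, rule DM_derivative(1)[OF f]; blast)
  qed (rule DM_derivative(2)[OF f c d lim])
  moreover have "\<forall>\<^sub>F s in at t within S. DM f c d (\<gamma> s) (V s c) = mdiff N N f (\<gamma> s) (V s) d"
    using ev
  proof eventually_elim
    case (elim s)
    show ?case using mdiff_DM[OF f _ _ velocity_onD(2)[OF V], of c s d] elim by simp
  qed
  ultimately have "((\<lambda>s. mdiff N N f (\<gamma> s) (V s) d) \<longlongrightarrow> mdiff N N f (\<gamma> t) (V t) d) (at t within S)"
    unfolding mdiff_DM[OF f c d tan] by (rule Lim_transform_eventually)
  with 1 d show "\<exists>c\<in>charts_at N (f (\<gamma> t)). (snd c \<circ> (\<lambda>t. f (\<gamma> t)) has_vector_derivative mdiff N N f (\<gamma> t) (V t) c) (at t within S) \<and>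
      ((\<lambda>s. mdiff N N f (\<gamma> s) (V s) c) \<longlongrightarrow> mdiff N N f (\<gamma> t) (V t) c) (at t within S)"
    by blast
qed

lemma velocity_on_chart:
  assumes c: "c \<in> atlas N" and \<xi>: "\<And>t. t \<in> S \<Longrightarrow> \<xi> t \<in> coords c"
    and der: "\<And>t. t \<in> S \<Longrightarrow> (\<xi> has_vector_derivative \<xi>' t) (at t within S)"
    and cont: "continuous_on S \<xi>'"
  shows "velocity_on (\<lambda>t. tangent_of_coord N c (chart_inv c (\<xi> t)) (\<xi>' t)) (\<lambda>t. chart_inv c (\<xi> t)) S"
proof (rule velocity_onI)
  fix t assume t: "t \<in> S"
  have ch: "c \<in> charts_at N (chart_inv c (\<xi> s))" if "s \<in> S" for s
    using c \<xi>[OF that] by (auto simp: charts_at_def)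
  have "(\<xi> \<longlongrightarrow> \<xi> t) (at t within S)"
    using has_vector_derivative_continuous[OF der[OF t]] by (simp add: continuous_within)
  then show "limitin (mtop N) (\<lambda>t. chart_inv c (\<xi> t)) (chart_inv c (\<xi> t)) (at t within S)"
    by (rule limitin_chart_inv[OF c \<xi>[OF t]])
  show "tangent_of_coord N c (chart_inv c (\<xi> t)) (\<xi>' t) \<in> tangent_space N (chart_inv c (\<xi> t))"
    by (rule tangent_of_coord_in[OF ch[OF t]])
  have eq: "(snd c \<circ> (\<lambda>t. chart_inv c (\<xi> t))) s = \<xi> s" if "s \<in> S" for s
    using c \<xi>[OF that] by auto
  have "(snd c \<circ> (\<lambda>t. chart_inv c (\<xi> t)) has_vector_derivative \<xi>' t) (at t within S)"
    by (rule has_vector_derivative_transform[OF t _ der[OF t]]) (rule eq)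
  moreover have "((\<lambda>s. tangent_of_coord N c (chart_inv c (\<xi> s)) (\<xi>' s) c) \<longlongrightarrow> \<xi>' t) (at t within S)"
  proof (rule Lim_transform_eventually)
    show "(\<xi>' \<longlongrightarrow> \<xi>' t) (at t within S)" using cont t unfolding continuous_on_def by blast
    have "\<forall>\<^sub>F s in at t within S. s \<in> S" by (simp add: eventually_at_filter)
    then show "\<forall>\<^sub>F s in at t within S. \<xi>' s = tangent_of_coord N c (chart_inv c (\<xi> s)) (\<xi>' s) c"
      by eventually_elim (simp add: tangent_of_coord_self[OF ch])
  qed
  ultimately show "\<exists>e\<in>charts_at N (chart_inv c (\<xi> t)).
      (snd e \<circ> (\<lambda>t. chart_inv c (\<xi> t)) has_vector_derivative tangent_of_coord N c (chart_inv c (\<xi> t)) (\<xi>' t) e) (at t within S) \<and>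
      ((\<lambda>s. tangent_of_coord N c (chart_inv c (\<xi> s)) (\<xi>' s) e) \<longlongrightarrow> tangent_of_coord N c (chart_inv c (\<xi> t)) (\<xi>' t) e) (at t within S)"
    using ch[OF t] tangent_of_coord_self[OF ch[OF t]] by (intro bexI[of _ c]) simp_all
qed

text \<open>A continuous curve whose derivative vanishes outside finitely many parameters is locally constant. The local
  statement is propagated by the bisection principle \<open>Bolzano\<close>.\<close>

lemma nonconstant_curve_moves:
  assumes \<gamma>: "field_curve K \<gamma> t0 t1" and ne: "\<gamma> t0 \<noteq> \<gamma> t1"
  shows "\<exists>a b V. t0 \<le> a \<and> a < b \<and> b \<le> t1 \<and> velocity_on V \<gamma> {a..b} \<and> (\<forall>s\<in>{a..b}. V s \<noteq> (\<lambda>c. 0))"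
proof (rule ccontr)
  assume contr: "\<not> ?thesis"
  obtain P where P: "t0 < t1" "continuous_map (top_of_set {t0..t1}) (mtop N) \<gamma>" "finite P"
    "\<And>a b. t0 \<le> a \<Longrightarrow> a < b \<Longrightarrow> b \<le> t1 \<Longrightarrow> P \<inter> {a<..<b} = {} \<Longrightarrow> \<exists>V. velocity_on V \<gamma> {a..b}"
    using field_curveE[OF \<gamma>] by metis
  have zero: "V a = (\<lambda>c. 0)" if ab: "t0 \<le> a" "a < b" "b \<le> t1" and V: "velocity_on V \<gamma> {a..b}" for a b V
  proof (rule ccontr)
    assume nz: "V a \<noteq> (\<lambda>c. 0)"
    have a: "a \<in> {a..b}" using ab by simp
    obtain c where c: "V a c \<noteq> 0" using nz by (auto simp: fun_eq_iff)
    have cc: "c \<in> charts_at N (\<gamma> a)"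
      using velocity_onD(2)[OF V a] c unfolding tangent_space_def by blast
    have "\<forall>\<^sub>F s in at a within {a..b}. V s c \<noteq> 0"
      by (rule tendsto_imp_eventually_ne[OF velocity_onD(4)[OF V a cc] c])
    then have "\<forall>\<^sub>F s in at_right a. V s c \<noteq> 0"
      unfolding at_within_Icc_at_right[OF ab(2)] .
    then obtain b' where b': "b' > a" "\<And>s. a < s \<Longrightarrow> s < b' \<Longrightarrow> V s c \<noteq> 0"
      unfolding eventually_at_right_field by blast
    define b'' where "b'' = min b ((a + b') / 2)"
    have lt: "a < b''" "b'' \<le> b" "b'' < b'" using b'(1) ab(2) unfolding b''_def by (auto simp: min_def)
    have "V s \<noteq> (\<lambda>c. 0)" if "s \<in> {a..b''}" for s
    proof (cases "s = a")
      case False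
      then have "V s c \<noteq> 0" using b'(2)[of s] that lt by simp
      then show ?thesis by auto
    qed (use nz in simp)
    moreover have "velocity_on V \<gamma> {a..b''}" by (rule velocity_on_subset[OF V]) (use lt in auto)
    ultimately show False using contr ab lt by (meson order_trans)
  qed
  have "t0 \<le> t0 \<and> t1 \<le> t1 \<longrightarrow> \<gamma> t0 = \<gamma> t1"
  proof (rule Bolzano[where P = "\<lambda>a b. t0 \<le> a \<and> b \<le> t1 \<longrightarrow> \<gamma> a = \<gamma> b"])
    show "t0 \<le> t1" using P(1) by simp
    fix a b c assume "t0 \<le> a \<and> b \<le> t1 \<longrightarrow> \<gamma> a = \<gamma> b" "t0 \<le> b \<and> c \<le> t1 \<longrightarrow> \<gamma> b = \<gamma> c" "a \<le> b" "b \<le> c"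
    then show "t0 \<le> a \<and> c \<le> t1 \<longrightarrow> \<gamma> a = \<gamma> c" by auto
  next
    fix x assume x: "t0 \<le> x" "x \<le> t1"
    have lim: "limitin (mtop N) \<gamma> (\<gamma> t) (at t within {t0..t1})" if "t \<in> {t0..t1}" for t
      using P(2) that unfolding continuous_map_limitin by blast
    have limx: "limitin (mtop N) \<gamma> (\<gamma> x) (at x within {t0..t1})" using lim x by simp
    obtain c where c: "c \<in> charts_at N (\<gamma> x)" using chart_exists[OF limitin_topspace[OF limx]] by blast
    have ca: "c \<in> atlas N" "\<gamma> x \<in> fst c" using charts_atD c by blast+
    have "\<forall>\<^sub>F s in at x within {t0..t1}. \<gamma> s \<in> fst c" using limx limitin_chart[OF c] by blast
    then obtain r where r: "r > 0" "\<And>s. s \<in> {t0..t1} \<Longrightarrow> s \<noteq> x \<Longrightarrow> dist s x < r \<Longrightarrow> \<gamma> s \<in> fst c"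
      unfolding eventually_at by blast
    have "\<gamma> a = \<gamma> b" if ab: "a \<le> x" "x \<le> b" "b - a < r" "t0 \<le> a" "b \<le> t1" for a b
    proof -
      have dom: "\<gamma> s \<in> fst c" if "s \<in> {a..b}" for s
        using r(2)[of s] ca(2) that ab by (cases "s = x") (auto simp: dist_real_def)
      then have ch: "c \<in> charts_at N (\<gamma> s)" if "s \<in> {a..b}" for s
        using that ca(1) by (simp add: charts_at_def)
      have "(snd c \<circ> \<gamma>) b = (snd c \<circ> \<gamma>) a"
      proof (rule has_derivative_zero_unique_strong_interval[where k = "insert a (insert b P)"])
        show "finite (insert a (insert b P))" using P(3) by simp
        show "continuous_on {a..b} (snd c \<circ> \<gamma>)"
          unfolding continuous_on_def
        proof
          fix s assume s: "s \<in> {a..b}"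
          have "limitin (mtop N) \<gamma> (\<gamma> s) (at s within {a..b})"
            by (rule limitin_subset[OF lim]) (use s ab in auto)
          then show "((snd c \<circ> \<gamma>) \<longlongrightarrow> (snd c \<circ> \<gamma>) s) (at s within {a..b})"
            unfolding limitin_chart[OF ch[OF s]] by (simp add: comp_def)
        qed
        fix s assume s: "s \<in> {a..b} - insert a (insert b P)"
        then have "open ({a<..<b} - P)" "s \<in> {a<..<b} - P"
          using P(3) by (auto intro: open_Diff finite_imp_closed)
        then obtain e where e: "e > 0" "cball s e \<subseteq> {a<..<b} - P"
          unfolding open_contains_cball by blast
        have e': "{s - e..s + e} \<subseteq> {a<..<b} - P" using e(2) by (simp add: cball_eq_atLeastAtMost)
        moreover have "s - e \<in> {s - e..s + e}" "s + e \<in> {s - e..s + e}" using e(1) by auto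
        ultimately have "s - e \<in> {a<..<b}" "s + e \<in> {a<..<b}" by blast+
        then have le: "t0 \<le> s - e" "s + e \<le> t1" "s - e < s + e" using ab e(1) by auto
        have "{s - e<..<s + e} \<subseteq> {s - e..s + e}" by auto
        then have "P \<inter> {s - e<..<s + e} = {}" using e' by blast
        then obtain V where V: "velocity_on V \<gamma> {s - e..s + e}" using P(4) le by blast
        have "velocity_on V \<gamma> {s..s + e}" by (rule velocity_on_subset[OF V]) (use e in auto)
        then have "V s = (\<lambda>c. 0)" using zero[of s "s + e" V] e(1) le by auto
        moreover have "((snd c \<circ> \<gamma>) has_vector_derivative V s c) (at s within {s - e..s + e})"
          by (rule velocity_onD(3)[OF V _ ch]) (use s e in auto)
        ultimately have "((snd c \<circ> \<gamma>) has_vector_derivative 0) (at s within {s - e..s + e})" by simp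
        then have "((snd c \<circ> \<gamma>) has_vector_derivative 0) (at s)"
          using at_within_Icc_at[of "s - e" s "s + e"] e(1) by simp
        then show "((snd c \<circ> \<gamma>) has_derivative (\<lambda>h. 0)) (at s within {a..b})"
          unfolding has_vector_derivative_def by (simp add: has_derivative_at_withinI)
      qed (use ab in auto)
      moreover have "a \<in> {a..b}" "b \<in> {a..b}" using ab by auto
      ultimately show ?thesis using inj_onD[OF inj_chart[OF ca(1)]] dom by (metis comp_apply)
    qed
    with r(1) show "\<exists>d>0. \<forall>a b. a \<le> x \<and> x \<le> b \<and> b - a < d \<longrightarrow> t0 \<le> a \<and> b \<le> t1 \<longrightarrow> \<gamma> a = \<gamma> b"
      by blast
  qed
  with ne show False by simp
qed

end


section \<open>Pushing conal curves into the interior\<close>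

lemma cone_scale_interior:
  fixes K :: "'a::real_normed_vector set"
  assumes "v \<in> interior K" "a > 0" "\<And>a x. a \<ge> 0 \<Longrightarrow> x \<in> K \<Longrightarrow> a *\<^sub>R x \<in> K"
  shows "a *\<^sub>R v \<in> interior K"
proof (rule interiorI)
  show "open ((*\<^sub>R) a ` interior K)" by (rule open_scaling) (use assms(2) in auto)
  show "a *\<^sub>R v \<in> (*\<^sub>R) a ` interior K" using assms(1) by blast
  show "(*\<^sub>R) a ` interior K \<subseteq> K"
  proof clarify
    fix x assume "x \<in> interior K"
    then have "x \<in> K" using interior_subset by blast
    then show "a *\<^sub>R x \<in> K" using assms(2,3) by simp
  qed
qed

context manifold begin

definition coord_cone :: "('a \<Rightarrow> ('a, 'e) tangent set) \<Rightarrow> ('a, 'e) chart \<Rightarrow> 'a \<Rightarrow> 'e set" where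
  "coord_cone C c p = (\<lambda>v. v c) ` C p"

text \<open>The only regularity of the cone field that the argument uses: in a chart, nearby cones are linear images
  of one another under maps close to the identity.\<close>

definition continuous_cone_field :: "('a \<Rightarrow> ('a, 'e) tangent set) \<Rightarrow> bool" where
  "continuous_cone_field C \<longleftrightarrow> (\<forall>p. \<forall>c\<in>charts_at N p. \<forall>e>0. \<exists>U. openin (mtop N) U \<and> p \<in> U \<and> U \<subseteq> fst c \<and>
     (\<forall>q\<in>U. \<exists>A. linear A \<and> (\<forall>h. norm (A h - h) \<le> e * norm h) \<and> coord_cone C c q = A ` coord_cone C c p))"

lemma cone_field_at: "cone_field N C \<Longrightarrow> p \<in> topspace (mtop N) \<Longrightarrow> closed_convex_cone N p (C p)"
  unfolding cone_field_def by blast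

lemma cone_field_tangent:
  assumes "cone_field N C" "p \<in> topspace (mtop N)"
  shows "C p \<subseteq> tangent_space N p"
proof -
  have "closedin (tangent_topology N p) (C p)"
    using cone_field_at[OF assms] unfolding closed_convex_cone_def by blast
  then show ?thesis using closedin_subset unfolding tangent_topology_def by fastforce
qed

lemma coord_cone_props:
  assumes C: "cone_field N C" and c: "c \<in> charts_at N p"
  shows "closed (coord_cone C c p)" "0 \<in> coord_cone C c p"
    and "\<And>a x. a \<ge> 0 \<Longrightarrow> x \<in> coord_cone C c p \<Longrightarrow> a *\<^sub>R x \<in> coord_cone C c p"
    and "\<And>x y. x \<in> coord_cone C c p \<Longrightarrow> y \<in> coord_cone C c p \<Longrightarrow> x + y \<in> coord_cone C c p"
proof -
  have K: "closedin (tangent_topology N p) (C p)" "C p \<noteq> {}"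
    "\<And>u v. u \<in> C p \<Longrightarrow> v \<in> C p \<Longrightarrow> (\<lambda>c. u c + v c) \<in> C p"
    "\<And>a v. a \<ge> 0 \<Longrightarrow> v \<in> C p \<Longrightarrow> (\<lambda>c. a *\<^sub>R v c) \<in> C p"
    using cone_field_at[OF C charts_at_topspace[OF c]] unfolding closed_convex_cone_def by blast+
  show "closed (coord_cone C c p)" unfolding coord_cone_def by (rule coord_closed[OF c K(1)])
  show scale: "a *\<^sub>R x \<in> coord_cone C c p" if a: "a \<ge> 0" and x: "x \<in> coord_cone C c p" for a x
  proof -
    obtain v where v: "v \<in> C p" "x = v c" using x unfolding coord_cone_def by blast
    show ?thesis unfolding coord_cone_def v(2) by (rule image_eqI[OF _ K(4)[OF a v(1)]]) simp
  qed
  show "x + y \<in> coord_cone C c p" if x: "x \<in> coord_cone C c p" and y: "y \<in> coord_cone C c p" for x y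
  proof -
    obtain u v where u: "u \<in> C p" "x = u c" and v: "v \<in> C p" "y = v c"
      using x y unfolding coord_cone_def by blast
    show ?thesis unfolding coord_cone_def u(2) v(2) by (rule image_eqI[OF _ K(3)[OF u(1) v(1)]]) simp
  qed
  obtain v where "v \<in> C p" using K(2) by blast
  then have "v c \<in> coord_cone C c p" unfolding coord_cone_def by blast
  from scale[OF order_refl this] show "0 \<in> coord_cone C c p" by simp
qed

lemma cone_interior_coord:
  assumes C: "cone_field N C" and c: "c \<in> charts_at N p"
  shows "v \<in> cone_interior N C p \<longleftrightarrow> v \<in> tangent_space N p \<and> v c \<in> interior (coord_cone C c p)"
  unfolding cone_interior_def coord_cone_def
  by (rule coord_interior[OF c cone_field_tangent[OF C charts_at_topspace[OF c]]])

text \<open>The drift \<open>(t - k) *\<^sub>R w\<close> in the chart vanishes at \<open>t = k\<close>. Taking \<open>k\<close> to be an end of the parameter interval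
  keeps that end of the curve fixed and displaces the other one by as little as desired.\<close>

lemma conal_ll_translated:
  assumes C: "cone_field N C" and d: "d \<in> atlas N" and \<gamma>: "continuous_map (top_of_set {a..b}) (mtop N) \<eta>" "a < b" "finite P"
    and dom: "\<And>t. t \<in> {a..b} \<Longrightarrow> \<eta> t \<in> fst d"
    and u: "\<And>t. t \<in> {a..b} \<Longrightarrow> snd d (\<eta> t) + (t - k) *\<^sub>R w \<in> coords d"
    and V: "\<And>r s. a \<le> r \<Longrightarrow> r < s \<Longrightarrow> s \<le> b \<Longrightarrow> P \<inter> {r<..<s} = {} \<Longrightarrow> \<exists>V. velocity_on V \<eta> {r..s} \<and>
      V r d + w \<in> interior (coord_cone C d (chart_inv d (snd d (\<eta> r) + (r - k) *\<^sub>R w)))"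
  shows "conal_ll N C (chart_inv d (snd d (\<eta> a) + (a - k) *\<^sub>R w)) (chart_inv d (snd d (\<eta> b) + (b - k) *\<^sub>R w))"
proof -
  define \<xi> where "\<xi> t = snd d (\<eta> t) + (t - k) *\<^sub>R w" for t
  have ch: "d \<in> charts_at N (\<eta> t)" if "t \<in> {a..b}" for t using dom[OF that] d by (simp add: charts_at_def)
  have ch': "d \<in> charts_at N (chart_inv d (\<xi> t))" if "t \<in> {a..b}" for t
    using u[OF that] d unfolding \<xi>_def[symmetric] by (auto simp: charts_at_def)
  have lim: "limitin (mtop N) \<eta> (\<eta> t) (at t within {a..b})" if "t \<in> {a..b}" for t
    using \<gamma>(1) that unfolding continuous_map_limitin by blast
  have "field_curve (cone_interior N C) (\<lambda>t. chart_inv d (\<xi> t)) a b"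
  proof (rule field_curveI[OF \<gamma>(2) _ \<gamma>(3)])
    show "continuous_map (top_of_set {a..b}) (mtop N) (\<lambda>t. chart_inv d (\<xi> t))"
      unfolding continuous_map_limitin
    proof
      fix t assume t: "t \<in> {a..b}"
      have "((\<lambda>s. snd d (\<eta> s)) \<longlongrightarrow> snd d (\<eta> t)) (at t within {a..b})"
        using lim[OF t] unfolding limitin_chart[OF ch[OF t]] by blast
      then have "(\<xi> \<longlongrightarrow> \<xi> t) (at t within {a..b})" unfolding \<xi>_def by (intro tendsto_intros)
      moreover have "\<xi> t \<in> coords d" unfolding \<xi>_def by (rule u[OF t])
      ultimately show "limitin (mtop N) (\<lambda>t. chart_inv d (\<xi> t)) (chart_inv d (\<xi> t)) (at t within {a..b})"
        by (intro limitin_chart_inv d)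
    qed
    fix r s assume rs: "a \<le> r" "r < s" "s \<le> b" "P \<inter> {r<..<s} = {}"
    then obtain V where V: "velocity_on V \<eta> {r..s}" "V r d + w \<in> interior (coord_cone C d (chart_inv d (\<xi> r)))"
      using assms(8) unfolding \<xi>_def by blast
    have sub: "t \<in> {a..b}" if "t \<in> {r..s}" for t using that rs by auto
    have r: "r \<in> {r..s}" using rs by simp
    have vel: "velocity_on (\<lambda>t. tangent_of_coord N d (chart_inv d (\<xi> t)) (V t d + w)) (\<lambda>t. chart_inv d (\<xi> t)) {r..s}"
    proof (rule velocity_on_chart[OF d])
      fix t assume t: "t \<in> {r..s}"
      show "\<xi> t \<in> coords d" unfolding \<xi>_def by (rule u[OF sub[OF t]])
      have "((snd d \<circ> \<eta>) has_vector_derivative V t d) (at t within {r..s})"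
        by (rule velocity_onD(3)[OF V(1) t ch[OF sub[OF t]]])
      moreover have "((\<lambda>t. (t - k) *\<^sub>R w) has_vector_derivative w) (at t within {r..s})"
        unfolding has_vector_derivative_def by (auto intro!: derivative_eq_intros)
      ultimately have "((\<lambda>t. (snd d \<circ> \<eta>) t + (t - k) *\<^sub>R w) has_vector_derivative V t d + w) (at t within {r..s})"
        by (rule has_vector_derivative_add)
      then show "(\<xi> has_vector_derivative V t d + w) (at t within {r..s})"
        by (simp add: \<xi>_def[abs_def])
    next
      have "continuous_on {r..s} (\<lambda>t. V t d)"
        unfolding continuous_on_def using velocity_onD(4)[OF V(1) _ ch[OF sub]] by blast
      then show "continuous_on {r..s} (\<lambda>t. V t d + w)" by (intro continuous_intros)
    qed
    have "tangent_of_coord N d (chart_inv d (\<xi> r)) (V r d + w) \<in> cone_interior N C (chart_inv d (\<xi> r))"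
      unfolding cone_interior_coord[OF C ch'[OF sub[OF r]]] tangent_of_coord_self[OF ch'[OF sub[OF r]]]
      using V(2) tangent_of_coord_in[OF ch'[OF sub[OF r]]] by blast
    with vel show "\<exists>V. velocity_on V (\<lambda>t. chart_inv d (\<xi> t)) {r..s} \<and> V r \<in> cone_interior N C (chart_inv d (\<xi> r))"
      by blast
  qed
  then show ?thesis unfolding conal_ll_def strictly_conal_curve_field \<xi>_def by blast
qed

text \<open>Near the parameter \<open>s\<close>, work in a chart around \<open>f (\<gamma> s)\<close> and add to \<open>f \<circ> \<gamma>\<close> the drift \<open>(t - k) *\<^sub>R (e *\<^sub>R v)\<close>,
  where \<open>v\<close> is an interior vector of the cone. The displaced curve has velocity \<open>W + e *\<^sub>R v\<close>, with \<open>W\<close> the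
  velocity of \<open>f \<circ> \<gamma>\<close>. By strong positivity and continuity of the cone field, \<open>W\<close> lies in the cone at the
  displaced point as well, not only at the original one, and therefore \<open>W + e *\<^sub>R v\<close> is interior. For \<open>e \<rightarrow> 0\<close> this shows that each end of
  the piece is a limit of points strictly related to the other end. Strictness of the piece itself is not
  claimed, since \<open>\<gamma>\<close> may rest there.\<close>

lemma pushed_curve_locally_strict:
  assumes C: "solid_cone_field N C" and cc: "continuous_cone_field C" and f: "Ck_map 1 N N f"
    and pos: "\<And>x. x \<in> topspace (mtop N) \<Longrightarrow> mdiff N N f x ` (C x - {\<lambda>c. 0}) \<subseteq> cone_interior N C (f x)"
    and \<gamma>: "field_curve C \<gamma> t0 t1" and s: "t0 \<le> s" "s \<le> t1"
  shows "\<exists>r>0. \<forall>a b. a \<le> s \<and> s \<le> b \<and> b - a < r \<and> a < b \<and> t0 \<le> a \<and> b \<le> t1 \<longrightarrow>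
    (\<forall>U. openin (mtop N) U \<and> f (\<gamma> a) \<in> U \<longrightarrow> (\<exists>u\<in>U. conal_ll N C u (f (\<gamma> b)))) \<and>
    (\<forall>U. openin (mtop N) U \<and> f (\<gamma> b) \<in> U \<longrightarrow> (\<exists>u\<in>U. conal_ll N C (f (\<gamma> a)) u))"
proof -
  have Cf: "cone_field N C" using C unfolding solid_cone_field_def by blast
  obtain P where P: "t0 < t1" "continuous_map (top_of_set {t0..t1}) (mtop N) \<gamma>" "finite P"
    "\<And>a b. t0 \<le> a \<Longrightarrow> a < b \<Longrightarrow> b \<le> t1 \<Longrightarrow> P \<inter> {a<..<b} = {} \<Longrightarrow> \<exists>V. velocity_on V \<gamma> {a..b}"
    "\<And>a b V. t0 \<le> a \<Longrightarrow> a < b \<Longrightarrow> b \<le> t1 \<Longrightarrow> velocity_on V \<gamma> {a..b} \<Longrightarrow> V a \<in> C (\<gamma> a)"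
    using field_curveE[OF \<gamma>] by metis
  define \<eta> where "\<eta> t = f (\<gamma> t)" for t
  have fc: "continuous_map (mtop N) (mtop N) f" using f unfolding Ck_map_def by blast
  have \<eta>c: "continuous_map (top_of_set {t0..t1}) (mtop N) \<eta>"
    using continuous_map_compose[OF P(2) fc] unfolding \<eta>_def comp_def .
  have sI: "s \<in> {t0..t1}" using s by simp
  have lim: "limitin (mtop N) \<gamma> (\<gamma> s) (at s within {t0..t1})"
    and lim\<eta>: "limitin (mtop N) \<eta> (\<eta> s) (at s within {t0..t1})"
    using P(2) \<eta>c sI unfolding continuous_map_limitin by blast+
  have top: "\<gamma> s \<in> topspace (mtop N)" "\<eta> s \<in> topspace (mtop N)" by (rule limitin_topspace[OF lim], rule limitin_topspace[OF lim\<eta>])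
  obtain c where c: "c \<in> charts_at N (\<gamma> s)" using chart_exists[OF top(1)] by blast
  obtain d where d: "d \<in> charts_at N (\<eta> s)" using chart_exists[OF top(2)] by blast
  have d': "d \<in> charts_at N (f (\<gamma> s))" using d unfolding \<eta>_def .
  have ca: "c \<in> atlas N" "\<gamma> s \<in> fst c" "d \<in> atlas N" "\<eta> s \<in> fst d" using charts_atD c d by blast+
  let ?K1 = "coord_cone C c (\<gamma> s)" and ?K2 = "coord_cone C d (\<eta> s)" and ?L = "DM f c d (\<gamma> s)"
  have linL: "linear ?L" by (rule has_derivative_linear[OF DM_derivative(1)[OF f c d']])
  have posL: "?L u \<in> interior ?K2" if u: "u \<in> ?K1" "u \<noteq> 0" for u
  proof -
    obtain v where v: "v \<in> C (\<gamma> s)" "u = v c" using u(1) unfolding coord_cone_def by blast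
    then have "v \<in> C (\<gamma> s) - {\<lambda>c. 0}" using u(2) by auto
    then have "mdiff N N f (\<gamma> s) v \<in> cone_interior N C (\<eta> s)" using pos[OF top(1)] unfolding \<eta>_def by blast
    then have "mdiff N N f (\<gamma> s) v d \<in> interior ?K2" unfolding cone_interior_coord[OF Cf d] by blast
    moreover have "v \<in> tangent_space N (\<gamma> s)" using v(1) cone_field_tangent[OF Cf top(1)] by blast
    ultimately show ?thesis using mdiff_DM[OF f c d'] v(2) by simp
  qed
  obtain e1 where e1: "e1 > 0" "\<And>A1 A2 L' w. linear A1 \<Longrightarrow> linear A2 \<Longrightarrow> linear L' \<Longrightarrow>
      \<forall>h. norm (A1 h - h) \<le> e1 * norm h \<Longrightarrow> \<forall>h. norm (A2 h - h) \<le> e1 * norm h \<Longrightarrow>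
      \<forall>h. norm (L' h - ?L h) \<le> e1 * norm h \<Longrightarrow> w \<in> A1 ` ?K1 \<Longrightarrow> L' w \<in> A2 ` ?K2"
    using strictly_positive_map_near[OF linL coord_cone_props(1)[OF Cf c] coord_cone_props(3)[OF Cf c]
      coord_cone_props(2)[OF Cf d] coord_cone_props(3)[OF Cf d] posL] by auto
  obtain v where v: "v \<in> interior ?K2"
    using C top(2) cone_interior_coord[OF Cf d] unfolding solid_cone_field_def by blast
  obtain e2 where e2: "e2 > 0" "\<And>A. linear A \<Longrightarrow> \<forall>h. norm (A h - h) \<le> e2 * norm h \<Longrightarrow> v \<in> interior (A ` ?K2)"
    using near_identity_interior[OF v] by blast
  obtain U1 where U1: "openin (mtop N) U1" "\<gamma> s \<in> U1" "U1 \<subseteq> fst c"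
    "\<And>q. q \<in> U1 \<Longrightarrow> \<exists>A. linear A \<and> (\<forall>h. norm (A h - h) \<le> e1 * norm h) \<and> coord_cone C c q = A ` ?K1"
    using cc c e1(1) unfolding continuous_cone_field_def by meson
  have "min e1 e2 > 0" using e1(1) e2(1) by simp
  then obtain U2 where U2: "openin (mtop N) U2" "\<eta> s \<in> U2" "U2 \<subseteq> fst d"
    "\<And>q. q \<in> U2 \<Longrightarrow> \<exists>A. linear A \<and> (\<forall>h. norm (A h - h) \<le> min e1 e2 * norm h) \<and> coord_cone C d q = A ` ?K2"
    using cc d unfolding continuous_cone_field_def by meson
  have U2': "\<exists>A. linear A \<and> (\<forall>h. norm (A h - h) \<le> e1 * norm h) \<and> (\<forall>h. norm (A h - h) \<le> e2 * norm h) \<and> coord_cone C d q = A ` ?K2"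
    if q: "q \<in> U2" for q
  proof -
    obtain A where A: "linear A" "\<And>h. norm (A h - h) \<le> min e1 e2 * norm h" "coord_cone C d q = A ` ?K2"
      using U2(4)[OF q] by blast
    have "min e1 e2 * norm h \<le> e1 * norm h" "min e1 e2 * norm h \<le> e2 * norm h" for h :: 'e
      by (auto intro: mult_right_mono)
    then show ?thesis using A order_trans by meson
  qed
  have "open (snd d ` (fst d \<inter> U2))" by (rule openin_chart_image[OF ca(3) U2(1)])
  moreover have "snd d (\<eta> s) \<in> snd d ` (fst d \<inter> U2)" using ca(4) U2(2) by blast
  ultimately obtain R where R: "R > 0" "ball (snd d (\<eta> s)) R \<subseteq> snd d ` (fst d \<inter> U2)"
    by (meson openE)
  have inU2: "y \<in> coords d" "chart_inv d y \<in> U2" if "norm (y - snd d (\<eta> s)) < R" for y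
  proof -
    have "y \<in> ball (snd d (\<eta> s)) R" using that by (simp add: dist_norm norm_minus_commute)
    then obtain q where "q \<in> fst d" "q \<in> U2" "y = snd d q" using R(2) by blast
    then show "y \<in> coords d" "chart_inv d y \<in> U2" using ca(3) by auto
  qed
  define good where "good t \<longleftrightarrow> \<gamma> t \<in> U1 \<and> \<eta> t \<in> fst d \<and> norm (snd d (\<eta> t) - snd d (\<eta> s)) < R / 2 \<and>
    (\<forall>h. norm (DM f c d (\<gamma> t) h - ?L h) \<le> e1 * norm h)" for t
  have "\<forall>\<^sub>F t in at s within {t0..t1}. good t"
  proof -
    have 1: "\<forall>\<^sub>F t in at s within {t0..t1}. \<gamma> t \<in> U1"
      using lim U1(1,2) unfolding limitin_def by blast
    have 2: "\<forall>\<^sub>F t in at s within {t0..t1}. \<eta> t \<in> fst d"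
      and l: "((\<lambda>t. snd d (\<eta> t)) \<longlongrightarrow> snd d (\<eta> s)) (at s within {t0..t1})"
      using lim\<eta> unfolding limitin_chart[OF d] by blast+
    have 3: "\<forall>\<^sub>F t in at s within {t0..t1}. norm (snd d (\<eta> t) - snd d (\<eta> s)) < R / 2"
      using tendstoD[OF l, of "R / 2"] R(1) by (simp add: dist_norm)
    have "\<forall>\<^sub>F t in at s within {t0..t1}. linear (DM f c d (\<gamma> t))"
      using 1 2
    proof eventually_elim
      case (elim t)
      then have "c \<in> charts_at N (\<gamma> t)" "d \<in> charts_at N (f (\<gamma> t))"
        using U1(3) ca unfolding charts_at_def \<eta>_def by auto
      then show ?case by (rule has_derivative_linear[OF DM_derivative(1)[OF f]])
    qed
    then have 4: "\<forall>\<^sub>F t in at s within {t0..t1}. \<forall>h. norm (DM f c d (\<gamma> t) h - ?L h) \<le> e1 * norm h"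
      by (rule linear_family_near[OF _ linL DM_derivative(2)[OF f c d' lim] e1(1)])
    show ?thesis using 1 2 3 4 unfolding good_def by eventually_elim blast
  qed
  moreover have "good s" unfolding good_def using U1(2) ca(4) R(1) e1(1) by simp
  ultimately obtain r where r: "r > 0" "\<And>t. t \<in> {t0..t1} \<Longrightarrow> dist t s < r \<Longrightarrow> good t"
    unfolding eventually_at by metis
  have claim: "conal_ll N C (chart_inv d (snd d (\<eta> a) + (a - k) *\<^sub>R (e *\<^sub>R v))) (chart_inv d (snd d (\<eta> b) + (b - k) *\<^sub>R (e *\<^sub>R v)))"
    if ab: "a \<le> s" "s \<le> b" "b - a < r" "a < b" "t0 \<le> a" "b \<le> t1" and k: "k \<in> {a..b}" and e: "e > 0" "(b - a) * norm (e *\<^sub>R v) < R / 2"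
    for a b k e
  proof -
    have gd: "good t" if "t \<in> {a..b}" for t
      by (rule r(2)) (use that ab in \<open>auto simp: dist_real_def\<close>)
    have near: "norm (snd d (\<eta> t) + (t - k) *\<^sub>R (e *\<^sub>R v) - snd d (\<eta> s)) < R" if t: "t \<in> {a..b}" for t
    proof -
      have "norm ((t - k) *\<^sub>R (e *\<^sub>R v)) = \<bar>t - k\<bar> * norm (e *\<^sub>R v)" by (rule norm_scaleR)
      also have "\<dots> \<le> (b - a) * norm (e *\<^sub>R v)" by (rule mult_right_mono) (use t k in auto)
      finally have "norm ((t - k) *\<^sub>R (e *\<^sub>R v)) < R / 2" using e(2) by linarith
      moreover have "norm (snd d (\<eta> t) - snd d (\<eta> s)) < R / 2" using gd[OF t] unfolding good_def by blast
      moreover have "norm (snd d (\<eta> t) + (t - k) *\<^sub>R (e *\<^sub>R v) - snd d (\<eta> s)) \<le>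
          norm (snd d (\<eta> t) - snd d (\<eta> s)) + norm ((t - k) *\<^sub>R (e *\<^sub>R v))"
        using norm_triangle_ineq[of "snd d (\<eta> t) - snd d (\<eta> s)" "(t - k) *\<^sub>R (e *\<^sub>R v)"] by (simp add: algebra_simps)
      ultimately show ?thesis by linarith
    qed
    show ?thesis
    proof (rule conal_ll_translated[OF Cf ca(3) _ ab(4) P(3)])
      show "continuous_map (top_of_set {a..b}) (mtop N) \<eta>"
        by (rule continuous_map_from_subtopology_mono[OF \<eta>c]) (use ab in auto)
      show "\<eta> t \<in> fst d" if "t \<in> {a..b}" for t using gd[OF that] unfolding good_def by blast
      show "snd d (\<eta> t) + (t - k) *\<^sub>R (e *\<^sub>R v) \<in> coords d" if "t \<in> {a..b}" for t
        by (rule inU2(1)[OF near[OF that]])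
      fix r' s' assume rs: "a \<le> r'" "r' < s'" "s' \<le> b" "P \<inter> {r'<..<s'} = {}"
      have le: "t0 \<le> r'" "s' \<le> t1" and r': "r' \<in> {a..b}" "r' \<in> {r'..s'}" using rs ab by auto
      obtain V where V: "velocity_on V \<gamma> {r'..s'}" using P(4)[OF le(1) rs(2) le(2) rs(4)] by blast
      have VC: "V r' \<in> C (\<gamma> r')" by (rule P(5)[OF le(1) rs(2) le(2) V])
      have g: "\<gamma> r' \<in> U1" "\<eta> r' \<in> fst d" "\<forall>h. norm (DM f c d (\<gamma> r') h - ?L h) \<le> e1 * norm h"
        using gd[OF r'(1)] unfolding good_def by blast+
      have cr: "c \<in> charts_at N (\<gamma> r')" and dr: "d \<in> charts_at N (f (\<gamma> r'))"
        using g U1(3) ca unfolding charts_at_def \<eta>_def by auto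
      let ?u = "chart_inv d (snd d (\<eta> r') + (r' - k) *\<^sub>R (e *\<^sub>R v))"
      have u: "?u \<in> U2" by (rule inU2(2)[OF near[OF r'(1)]])
      then have du: "d \<in> charts_at N ?u" using U2(3) ca(3) unfolding charts_at_def by blast
      obtain A1 where A1: "linear A1" "\<forall>h. norm (A1 h - h) \<le> e1 * norm h" "coord_cone C c (\<gamma> r') = A1 ` ?K1"
        using U1(4)[OF g(1)] by blast
      obtain A2 where A2: "linear A2" "\<forall>h. norm (A2 h - h) \<le> e1 * norm h" "\<forall>h. norm (A2 h - h) \<le> e2 * norm h"
        "coord_cone C d ?u = A2 ` ?K2"
        using U2'[OF u] by blast
      have linD: "linear (DM f c d (\<gamma> r'))" by (rule has_derivative_linear[OF DM_derivative(1)[OF f cr dr]])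
      have "V r' c \<in> coord_cone C c (\<gamma> r')" using VC unfolding coord_cone_def by blast
      then have "V r' c \<in> A1 ` ?K1" unfolding A1(3) .
      from e1(2)[OF A1(1) A2(1) linD A1(2) A2(2) g(3) this]
      have "DM f c d (\<gamma> r') (V r' c) \<in> coord_cone C d ?u" unfolding A2(4) .
      then have W: "mdiff N N f (\<gamma> r') (V r') d \<in> coord_cone C d ?u"
        using mdiff_DM[OF f cr dr velocity_onD(2)[OF V r'(2)]] by simp
      have "v \<in> interior (coord_cone C d ?u)" unfolding A2(4) by (rule e2(2)[OF A2(1,3)])
      then have "e *\<^sub>R v \<in> interior (coord_cone C d ?u)"
        by (rule cone_scale_interior[OF _ e(1) coord_cone_props(3)[OF Cf du]])
      then have "mdiff N N f (\<gamma> r') (V r') d + e *\<^sub>R v \<in> interior (coord_cone C d ?u)"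
        by (rule cone_add_interior[OF W _ coord_cone_props(4)[OF Cf du]])
      moreover have "velocity_on (\<lambda>t. mdiff N N f (\<gamma> t) (V t)) \<eta> {r'..s'}"
        unfolding \<eta>_def by (rule velocity_on_image[OF f V])
      ultimately show "\<exists>V. velocity_on V \<eta> {r'..s'} \<and> V r' d + e *\<^sub>R v \<in> interior (coord_cone C d ?u)" by blast
    qed
  qed
  have approach: "\<exists>e>0. (b - a) * norm (e *\<^sub>R v) < R / 2 \<and> chart_inv d (snd d (\<eta> t) + k *\<^sub>R (e *\<^sub>R v)) \<in> U"
    if t: "\<eta> t \<in> fst d" and U: "openin (mtop N) U" "\<eta> t \<in> U" for a b k t U
  proof -
    have "((\<lambda>e. snd d (\<eta> t) + k *\<^sub>R (e *\<^sub>R v)) \<longlongrightarrow> snd d (\<eta> t) + k *\<^sub>R (0 *\<^sub>R v)) (at_right 0)"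
      by (intro tendsto_intros)
    then have "((\<lambda>e. snd d (\<eta> t) + k *\<^sub>R (e *\<^sub>R v)) \<longlongrightarrow> snd d (\<eta> t)) (at_right 0)" by simp
    from limitin_chart_inv[OF ca(3) _ this]
    have "limitin (mtop N) (\<lambda>e. chart_inv d (snd d (\<eta> t) + k *\<^sub>R (e *\<^sub>R v))) (\<eta> t) (at_right 0)"
      using t ca(3) by auto
    then have 1: "\<forall>\<^sub>F e in at_right 0. chart_inv d (snd d (\<eta> t) + k *\<^sub>R (e *\<^sub>R v)) \<in> U"
      using U unfolding limitin_def by blast
    have "((\<lambda>e. (b - a) * norm (e *\<^sub>R v)) \<longlongrightarrow> (b - a) * norm (0 *\<^sub>R v)) (at_right 0)"
      by (intro tendsto_intros)
    then have 2: "\<forall>\<^sub>F e in at_right 0. (b - a) * norm (e *\<^sub>R v) < R / 2"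
      by (rule order_tendstoD(2)) (use R(1) in simp)
    have 3: "\<forall>\<^sub>F e in at_right 0. e > (0::real)" by (rule eventually_at_right_less)
    have "\<forall>\<^sub>F e in at_right (0::real). e > 0 \<and> (b - a) * norm (e *\<^sub>R v) < R / 2 \<and> chart_inv d (snd d (\<eta> t) + k *\<^sub>R (e *\<^sub>R v)) \<in> U"
      using 1 2 3 by eventually_elim blast
    then show ?thesis using eventually_happens'[OF trivial_limit_at_right_real] by blast
  qed
  have "(\<exists>u\<in>U. conal_ll N C u (\<eta> b))" if ab: "a \<le> s" "s \<le> b" "b - a < r" "a < b" "t0 \<le> a" "b \<le> t1"
    and U: "openin (mtop N) U" "\<eta> a \<in> U" for a b U
  proof -
    have g: "good a" "good b" by (rule r(2); use ab in \<open>auto simp: dist_real_def\<close>)+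
    then have dom: "\<eta> a \<in> fst d" "\<eta> b \<in> fst d" unfolding good_def by blast+
    obtain e where e: "e > 0" "(b - a) * norm (e *\<^sub>R v) < R / 2" "chart_inv d (snd d (\<eta> a) + (a - b) *\<^sub>R (e *\<^sub>R v)) \<in> U"
      using approach[OF dom(1) U] by blast
    have "conal_ll N C (chart_inv d (snd d (\<eta> a) + (a - b) *\<^sub>R (e *\<^sub>R v))) (chart_inv d (snd d (\<eta> b) + (b - b) *\<^sub>R (e *\<^sub>R v)))"
      by (rule claim[OF ab _ e(1,2)]) (use ab in simp)
    then show ?thesis using e(3) dom(2) ca(3) by auto
  qed
  moreover have "(\<exists>u\<in>U. conal_ll N C (\<eta> a) u)" if ab: "a \<le> s" "s \<le> b" "b - a < r" "a < b" "t0 \<le> a" "b \<le> t1"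
    and U: "openin (mtop N) U" "\<eta> b \<in> U" for a b U
  proof -
    have g: "good a" "good b" by (rule r(2); use ab in \<open>auto simp: dist_real_def\<close>)+
    then have dom: "\<eta> a \<in> fst d" "\<eta> b \<in> fst d" unfolding good_def by blast+
    obtain e where e: "e > 0" "(b - a) * norm (e *\<^sub>R v) < R / 2" "chart_inv d (snd d (\<eta> b) + (b - a) *\<^sub>R (e *\<^sub>R v)) \<in> U"
      using approach[OF dom(2) U] by blast
    have "conal_ll N C (chart_inv d (snd d (\<eta> a) + (a - a) *\<^sub>R (e *\<^sub>R v))) (chart_inv d (snd d (\<eta> b) + (b - a) *\<^sub>R (e *\<^sub>R v)))"
      by (rule claim[OF ab _ e(1,2)]) (use ab in simp)
    then show ?thesis using e(3) dom(1) ca(3) by auto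
  qed
  ultimately show ?thesis using r(1) unfolding \<eta>_def by (intro exI[of _ r]) blast
qed

text \<open>By the local statement and openness of the chronological sets, along \<open>f \<circ> \<gamma>\<close> the relation \<open>p \<lless> _\<close> is
  inherited forwards and \<open>_ \<lless> p\<close> backwards. It starts from a piece on which \<open>\<gamma>\<close> has no zero velocity, which
  exists because \<open>x \<noteq> y\<close>, and whose image is strictly conal.\<close>

theorem strongly_positive_map_conal_ll:
  assumes C: "solid_cone_field N C" and cc: "continuous_cone_field C" and f: "Ck_map 1 N N f"
    and pos: "\<And>x. x \<in> topspace (mtop N) \<Longrightarrow> mdiff N N f x ` (C x - {\<lambda>c. 0}) \<subseteq> cone_interior N C (f x)"
    and op: "\<And>p. openin (mtop N) (chron_future N C p)" "\<And>p. openin (mtop N) (chron_past N C p)"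
    and xy: "conal_le N C x y" "x \<noteq> y"
  shows "conal_ll N C (f x) (f y)"
proof -
  obtain \<gamma> t0 t1 where \<gamma>: "field_curve C \<gamma> t0 t1" "\<gamma> t0 = x" "\<gamma> t1 = y"
    using xy(1) unfolding conal_le_def conal_curve_field by blast
  have t01: "t0 < t1" using \<gamma>(1) unfolding field_curve_def by blast
  define Q where "Q a b \<longleftrightarrow> (t0 \<le> a \<and> b \<le> t1 \<longrightarrow>
      (\<forall>p. conal_ll N C p (f (\<gamma> a)) \<longrightarrow> conal_ll N C p (f (\<gamma> b))) \<and>
      (\<forall>p. conal_ll N C (f (\<gamma> b)) p \<longrightarrow> conal_ll N C (f (\<gamma> a)) p))" for a b
  have Q: "Q a b" if "a \<le> b" for a b
  proof (cases "t0 \<le> a \<and> b \<le> t1")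
    case True
    show ?thesis
    proof (rule Bolzano[of a b Q, OF that])
      fix a b c assume "Q a b" "Q b c" "a \<le> b" "b \<le> c"
      then show "Q a c" unfolding Q_def by (meson order_trans)
    next
      fix s assume "a \<le> s" "s \<le> b"
      then have s: "t0 \<le> s" "s \<le> t1" using True by auto
      have "\<exists>r>0. \<forall>a b. a \<le> s \<and> s \<le> b \<and> b - a < r \<and> a < b \<and> t0 \<le> a \<and> b \<le> t1 \<longrightarrow>
          (\<forall>U. openin (mtop N) U \<and> f (\<gamma> a) \<in> U \<longrightarrow> (\<exists>u\<in>U. conal_ll N C u (f (\<gamma> b)))) \<and>
          (\<forall>U. openin (mtop N) U \<and> f (\<gamma> b) \<in> U \<longrightarrow> (\<exists>u\<in>U. conal_ll N C (f (\<gamma> a)) u))"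
        by (rule pushed_curve_locally_strict[OF C cc f pos \<gamma>(1) s])
      then obtain r where r: "r > 0"
        "\<forall>a b. a \<le> s \<and> s \<le> b \<and> b - a < r \<and> a < b \<and> t0 \<le> a \<and> b \<le> t1 \<longrightarrow>
          (\<forall>U. openin (mtop N) U \<and> f (\<gamma> a) \<in> U \<longrightarrow> (\<exists>u\<in>U. conal_ll N C u (f (\<gamma> b)))) \<and>
          (\<forall>U. openin (mtop N) U \<and> f (\<gamma> b) \<in> U \<longrightarrow> (\<exists>u\<in>U. conal_ll N C (f (\<gamma> a)) u))"
        by (elim exE conjE)
      have "Q a' b'" if ab: "a' \<le> s" "s \<le> b'" "b' - a' < r" for a' b'
      proof (cases "a' < b'")
        case False
        then have "a' = b'" using ab by simp
        then show ?thesis unfolding Q_def by simp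
      next
        case lt: True
        have 1: "conal_ll N C p (f (\<gamma> b'))" if le: "t0 \<le> a'" "b' \<le> t1" and p: "conal_ll N C p (f (\<gamma> a'))" for p
        proof -
          have "f (\<gamma> a') \<in> chron_future N C p" using p unfolding chron_future_def by simp
          with r(2) ab lt le op(1)[of p] obtain u where "conal_ll N C p u" "conal_ll N C u (f (\<gamma> b'))"
            unfolding chron_future_def by blast
          then show ?thesis by (rule conal_ll_trans)
        qed
        have 2: "conal_ll N C (f (\<gamma> a')) p" if le: "t0 \<le> a'" "b' \<le> t1" and p: "conal_ll N C (f (\<gamma> b')) p" for p
        proof -
          have "f (\<gamma> b') \<in> chron_past N C p" using p unfolding chron_past_def by simp
          with r(2) ab lt le op(2)[of p] obtain u where "conal_ll N C u p" "conal_ll N C (f (\<gamma> a')) u"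
            unfolding chron_past_def by blast
          then show ?thesis using conal_ll_trans by blast
        qed
        show ?thesis unfolding Q_def using 1 2 by blast
      qed
      with r(1) show "\<exists>d>0. \<forall>a b. a \<le> s \<and> s \<le> b \<and> b - a < d \<longrightarrow> Q a b" by blast
    qed
  next
    case False
    then show ?thesis unfolding Q_def by blast
  qed
  obtain a b V where ab: "t0 \<le> a" "a < b" "b \<le> t1" and V: "velocity_on V \<gamma> {a..b}"
    and nz: "\<And>s. s \<in> {a..b} \<Longrightarrow> V s \<noteq> (\<lambda>c. 0)"
    using nonconstant_curve_moves[OF \<gamma>(1)] xy(2) \<gamma>(2,3) by blast
  have inC: "\<And>a b V. t0 \<le> a \<Longrightarrow> a < b \<Longrightarrow> b \<le> t1 \<Longrightarrow> velocity_on V \<gamma> {a..b} \<Longrightarrow> V a \<in> C (\<gamma> a)"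
    using field_curveE[OF \<gamma>(1)] by metis
  have "field_curve (cone_interior N C) (\<lambda>t. f (\<gamma> t)) a b"
  proof (rule field_curveI[OF ab(2) _ finite.emptyI])
    have W: "velocity_on (\<lambda>t. mdiff N N f (\<gamma> t) (V t)) (\<lambda>t. f (\<gamma> t)) {a..b}" by (rule velocity_on_image[OF f V])
    then show "continuous_map (top_of_set {a..b}) (mtop N) (\<lambda>t. f (\<gamma> t))" unfolding velocity_on_def by blast
    fix r s assume rs: "a \<le> r" "r < s" "s \<le> b"
    have r: "r \<in> {a..b}" using rs by simp
    have "velocity_on V \<gamma> {r..s}" by (rule velocity_on_subset[OF V]) (use rs in auto)
    then have "V r \<in> C (\<gamma> r)" using inC[of r s V] rs ab by simp
    then have "V r \<in> C (\<gamma> r) - {\<lambda>c. 0}" using nz[OF r] by simp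
    moreover have "\<gamma> r \<in> topspace (mtop N)" by (rule field_curve_topspace[OF \<gamma>(1)]) (use rs ab in auto)
    ultimately have "mdiff N N f (\<gamma> r) (V r) \<in> cone_interior N C (f (\<gamma> r))" using pos by blast
    moreover have "velocity_on (\<lambda>t. mdiff N N f (\<gamma> t) (V t)) (\<lambda>t. f (\<gamma> t)) {r..s}"
      by (rule velocity_on_subset[OF W]) (use rs in auto)
    ultimately show "\<exists>V. velocity_on V (\<lambda>t. f (\<gamma> t)) {r..s} \<and> V r \<in> cone_interior N C (f (\<gamma> r))" by blast
  qed
  then have "conal_ll N C (f (\<gamma> a)) (f (\<gamma> b))"
    unfolding conal_ll_def strictly_conal_curve_field by blast
  then have "conal_ll N C (f (\<gamma> t0)) (f (\<gamma> b))" using Q[of t0 a] ab unfolding Q_def by simp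
  then have "conal_ll N C (f (\<gamma> t0)) (f (\<gamma> t1))" using Q[of b t1] ab unfolding Q_def by simp
  then show ?thesis using \<gamma>(2,3) by simp
qed

end


section \<open>Homogeneous cone fields are continuous\<close>

lemma Ck_on_1_cong:
  assumes S: "open S" and eq: "\<And>x. x \<in> S \<Longrightarrow> f x = g x" and f: "Ck_on 1 f S"
  shows "Ck_on 1 g S"
proof -
  have fd: "f differentiable (at x)" if "x \<in> S" for x using f that by simp
  have g: "g differentiable (at x)" if x: "x \<in> S" for x
    using has_derivative_transform_within_open[where f = f and g = g, OF _ S x eq] fd[OF x] unfolding differentiable_def by blast
  have D: "frechet_derivative f (at x) = frechet_derivative g (at x)" if x: "x \<in> S" for x
    by (rule frechet_derivative_transform_within_open[OF fd[OF x] S x eq])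
  have "continuous_on S (\<lambda>x. frechet_derivative g (at x) v)" for v
    using Ck_on_1_continuous[OF f, of v] continuous_on_cong[OF refl, of S "\<lambda>x. frechet_derivative f (at x) v" "\<lambda>x. frechet_derivative g (at x) v"] D
    by simp
  with g show ?thesis by simp
qed

lemma Ck_on_1_slice:
  fixes F :: "'b::real_normed_vector \<times> 'a::real_normed_vector \<Rightarrow> 'f::real_normed_vector"
  assumes F: "Ck_on 1 F D"
  shows "Ck_on 1 (\<lambda>y. F (x, y)) {y. (x, y) \<in> D}"
    and "(x, y) \<in> D \<Longrightarrow> frechet_derivative (\<lambda>y. F (x, y)) (at y) h = frechet_derivative F (at (x, y)) (0, h)"
proof -
  have der: "((\<lambda>y. F (x, y)) has_derivative (\<lambda>h. frechet_derivative F (at (x, y)) (0, h))) (at y)"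
    if "(x, y) \<in> D" for x y
  proof -
    have "(F \<circ> Pair x has_derivative frechet_derivative F (at (x, y)) \<circ> (\<lambda>h. (0, h))) (at y)"
      by (rule diff_chain_at) (auto intro!: derivative_eq_intros Ck_on_1_derivative[OF F] that)
    then show ?thesis by (simp add: comp_def)
  qed
  have eq: "frechet_derivative (\<lambda>y. F (x, y)) (at y) = (\<lambda>h. frechet_derivative F (at (x, y)) (0, h))"
    if "(x, y) \<in> D" for x y
    using frechet_derivative_at[OF der[OF that]] by simp
  then show "(x, y) \<in> D \<Longrightarrow> frechet_derivative (\<lambda>y. F (x, y)) (at y) h = frechet_derivative F (at (x, y)) (0, h)"
    by simp
  have "continuous_on {y. (x, y) \<in> D} (\<lambda>y. frechet_derivative F (at (x, y)) (0, v))" for v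
    by (rule continuous_on_compose2[OF Ck_on_1_continuous[OF F, of "(0, v)"]]) (auto intro!: continuous_intros)
  then have "continuous_on {y. (x, y) \<in> D} (\<lambda>y. frechet_derivative (\<lambda>y. F (x, y)) (at y) v)" for v
    using continuous_on_cong[OF refl, of "{y. (x, y) \<in> D}" "\<lambda>y. frechet_derivative (\<lambda>y. F (x, y)) (at y) v" "\<lambda>y. frechet_derivative F (at (x, y)) (0, v)"] eq
    by simp
  moreover have "(\<lambda>y. F (x, y)) differentiable (at y)" if "y \<in> {y. (x, y) \<in> D}" for y
    using der that unfolding differentiable_def by blast
  ultimately show "Ck_on 1 (\<lambda>y. F (x, y)) {y. (x, y) \<in> D}" by simp
qed

lemma is_chart_inv_continuous:
  assumes "is_chart X c"
  shows "continuous_map (top_of_set (snd c ` fst c)) X (chart_inv c)"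
proof -
  have c: "openin X (fst c)" "homeomorphic_map (subtopology X (fst c)) (top_of_set (snd c ` fst c)) (snd c)"
    using assms unfolding is_chart_def by blast+
  have ts: "topspace (subtopology X (fst c)) = fst c"
    using openin_subset[OF c(1)] by auto
  obtain g where g: "homeomorphic_maps (subtopology X (fst c)) (top_of_set (snd c ` fst c)) (snd c) g"
    using c(2) homeomorphic_map_maps by blast
  have inj: "inj_on (snd c) (fst c)" using homeomorphic_imp_injective_map[OF c(2)] ts by simp
  have "continuous_map (top_of_set (snd c ` fst c)) X g"
    using g unfolding homeomorphic_maps_def by (simp add: continuous_map_in_subtopology)
  moreover have "g y = chart_inv c y" if y: "y \<in> snd c ` fst c" for y
  proof -
    obtain p where p: "p \<in> fst c" "y = snd c p" using y by blast
    then have "g (snd c p) = p" using g ts unfolding homeomorphic_maps_def by blast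
    then show ?thesis using p inj by simp
  qed
  ultimately show ?thesis by (rule continuous_map_eq) simp
qed

text \<open>Applied to the group multiplication and to the flow, whose smoothness is given on product manifolds.\<close>

lemma Ck_map_prod_chart:
  fixes N1 :: "('a, 'e1::euclidean_space) manifold" and N2 :: "('b, 'e2::euclidean_space) manifold"
    and N3 :: "('c, 'e3::euclidean_space) manifold"
  assumes F: "Ck_map 1 (prod_manifold N1 N2) N3 (\<lambda>(x, y). F x y)"
    and a: "a \<in> atlas N1" "is_chart (mtop N1) a" and b: "b \<in> atlas N2" "is_chart (mtop N2) b"
    and c: "c \<in> atlas N3" "openin (mtop N3) (fst c)"
  defines "D \<equiv> {(s, y). s \<in> snd a ` fst a \<and> y \<in> snd b ` fst b \<and> F (chart_inv a s) (chart_inv b y) \<in> fst c}"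
  shows "open D" and "Ck_on 1 (\<lambda>(s, y). snd c (F (chart_inv a s) (chart_inv b y))) D"
proof -
  let ?A = "snd a ` fst a" and ?B = "snd b ` fst b"
  have opn: "open ?A" "open ?B" using a(2) b(2) unfolding is_chart_def by blast+
  have inj: "inj_on (snd a) (fst a)" "inj_on (snd b) (fst b)"
    and sub: "fst a \<subseteq> topspace (mtop N1)" "fst b \<subseteq> topspace (mtop N2)"
  proof -
    show sub: "fst a \<subseteq> topspace (mtop N1)" "fst b \<subseteq> topspace (mtop N2)"
      using a(2) b(2) openin_subset unfolding is_chart_def by blast+
    have "topspace (subtopology (mtop N1) (fst a)) = fst a" "topspace (subtopology (mtop N2) (fst b)) = fst b"
      using sub by auto
    moreover have "homeomorphic_map (subtopology (mtop N1) (fst a)) (top_of_set ?A) (snd a)"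
      "homeomorphic_map (subtopology (mtop N2) (fst b)) (top_of_set ?B) (snd b)"
      using a(2) b(2) unfolding is_chart_def by blast+
    ultimately show "inj_on (snd a) (fst a)" "inj_on (snd b) (fst b)"
      using homeomorphic_imp_injective_map by metis+
  qed
  let ?pc = "(fst a \<times> fst b, map_prod (snd a) (snd b))"
  have pc: "?pc \<in> atlas (prod_manifold N1 N2)"
    using a(1) b(1) unfolding prod_manifold_def by (simp del: ex_simps split_paired_Ex) blast
  have pinv: "chart_inv ?pc (s, y) = (chart_inv a s, chart_inv b y)" if "s \<in> ?A" "y \<in> ?B" for s y
  proof -
    obtain p q where pq: "p \<in> fst a" "s = snd a p" "q \<in> fst b" "y = snd b q" using \<open>s \<in> ?A\<close> \<open>y \<in> ?B\<close> by blast
    have "inj_on (map_prod (snd a) (snd b)) (fst a \<times> fst b)" by (rule map_prod_inj_on[OF inj])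
    then have "inv_into (fst a \<times> fst b) (map_prod (snd a) (snd b)) (map_prod (snd a) (snd b) (p, q)) = (p, q)"
      by (rule inv_into_f_f) (use pq in simp)
    then show ?thesis using pq inj by simp
  qed
  have img: "D = snd ?pc ` {p \<in> fst ?pc. (\<lambda>(x, y). F x y) p \<in> fst c}"
  proof (intro equalityI subsetI)
    fix z assume "z \<in> D"
    then obtain p q where pq: "p \<in> fst a" "q \<in> fst b" "z = (snd a p, snd b q)" "F (chart_inv a (snd a p)) (chart_inv b (snd b q)) \<in> fst c"
      unfolding D_def by blast
    then have "F p q \<in> fst c" using inj by simp
    then show "z \<in> snd ?pc ` {p \<in> fst ?pc. (\<lambda>(x, y). F x y) p \<in> fst c}"
      using pq by (intro image_eqI[of _ _ "(p, q)"]) auto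
  next
    fix z assume "z \<in> snd ?pc ` {p \<in> fst ?pc. (\<lambda>(x, y). F x y) p \<in> fst c}"
    then obtain p q where "p \<in> fst a" "q \<in> fst b" "F p q \<in> fst c" "z = (snd a p, snd b q)" by auto
    then show "z \<in> D" unfolding D_def using inj by simp
  qed
  have "continuous_map (top_of_set (?A \<times> ?B)) (top_of_set ?A) fst" "continuous_map (top_of_set (?A \<times> ?B)) (top_of_set ?B) snd"
    by (auto intro!: continuous_intros)
  then have "continuous_map (top_of_set (?A \<times> ?B)) (mtop N1) (chart_inv a \<circ> fst)" "continuous_map (top_of_set (?A \<times> ?B)) (mtop N2) (chart_inv b \<circ> snd)"
    using is_chart_inv_continuous[OF a(2)] is_chart_inv_continuous[OF b(2)] continuous_map_compose by blast+
  then have "continuous_map (top_of_set (?A \<times> ?B)) (prod_topology (mtop N1) (mtop N2)) (\<lambda>z. ((chart_inv a \<circ> fst) z, (chart_inv b \<circ> snd) z))"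
    by (rule continuous_map_pairedI)
  moreover have "continuous_map (prod_topology (mtop N1) (mtop N2)) (mtop N3) (\<lambda>(x, y). F x y)"
    using F unfolding Ck_map_def prod_manifold_def by simp
  ultimately have cm: "continuous_map (top_of_set (?A \<times> ?B)) (mtop N3) ((\<lambda>(x, y). F x y) \<circ> (\<lambda>z. ((chart_inv a \<circ> fst) z, (chart_inv b \<circ> snd) z)))"
    by (rule continuous_map_compose)
  have "openin (top_of_set (?A \<times> ?B)) {z \<in> topspace (top_of_set (?A \<times> ?B)). ((\<lambda>(x, y). F x y) \<circ> (\<lambda>z. ((chart_inv a \<circ> fst) z, (chart_inv b \<circ> snd) z))) z \<in> fst c}"
    by (rule openin_continuous_map_preimage[OF cm c(2)])
  moreover have "{z \<in> topspace (top_of_set (?A \<times> ?B)). ((\<lambda>(x, y). F x y) \<circ> (\<lambda>z. ((chart_inv a \<circ> fst) z, (chart_inv b \<circ> snd) z))) z \<in> fst c} = D"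
    unfolding D_def by auto
  ultimately show oD: "open D" using open_Times[OF opn] openin_open_eq by auto
  have "Ck_on 1 (snd c \<circ> (\<lambda>(x, y). F x y) \<circ> chart_inv ?pc) D"
    using F pc c(1) unfolding Ck_map_def img by blast
  then show "Ck_on 1 (\<lambda>(s, y). snd c (F (chart_inv a s) (chart_inv b y))) D"
  proof (rule Ck_on_1_cong[OF oD, rotated])
    fix z assume "z \<in> D"
    then obtain s y where z: "z = (s, y)" "s \<in> ?A" "y \<in> ?B" unfolding D_def by blast
    show "(snd c \<circ> (\<lambda>(x, y). F x y) \<circ> chart_inv ?pc) z = (\<lambda>(s, y). snd c (F (chart_inv a s) (chart_inv b y))) z"
      unfolding z(1) comp_apply pinv[OF z(2,3)] by simp
  qed
qed

text \<open>With \<open>R\<close> a linear right inverse of the derivative at \<open>x0\<close>, the map \<open>u \<mapsto> pr (x0 + R u)\<close> has derivative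
  \<open>id\<close> at \<open>0\<close>, and the inverse function theorem applies to it.\<close>

lemma local_section:
  fixes pr :: "'e::euclidean_space \<Rightarrow> 'f::euclidean_space"
  assumes \<Omega>: "open \<Omega>" "x0 \<in> \<Omega>" and Ck: "Ck_on 1 pr \<Omega>" and surj: "surj (frechet_derivative pr (at x0))"
  obtains V \<sigma> R where "open V" "pr x0 \<in> V" "\<sigma> (pr x0) = x0" "\<And>y. y \<in> V \<Longrightarrow> \<sigma> y \<in> \<Omega> \<and> pr (\<sigma> y) = y"
    "linear R" "\<And>h. frechet_derivative pr (at x0) (R h) = h" "(\<sigma> has_derivative R) (at (pr x0))"
proof -
  note der = Ck_on_1_derivative[OF Ck]
  have linL: "linear (frechet_derivative pr (at x0))" using has_derivative_linear[OF der[OF \<Omega>(2)]] .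
  then obtain R where R: "linear R" "frechet_derivative pr (at x0) \<circ> R = id"
    using linear_surjective_right_inverse[OF linL surj] by blast
  have blR: "bounded_linear R" using R(1) by (simp add: linear_conv_bounded_linear)
  define q where "q u = x0 + R u" for u
  have qder: "(q has_derivative R) (at u)" for u
    unfolding q_def by (auto intro!: derivative_eq_intros bounded_linear_imp_has_derivative blR)
  have qcont: "continuous_on UNIV q"
    by (intro continuous_at_imp_continuous_on ballI has_derivative_continuous[OF qder])
  define U where "U = q -` \<Omega>"
  have U: "open U" "0 \<in> U" unfolding U_def
    using open_vimage[OF \<Omega>(1) qcont] \<Omega>(2) by (simp_all add: q_def linear_0[OF R(1)])
  define \<psi> where "\<psi> u = pr (q u)" for u
  define \<psi>' where "\<psi>' u = Blinfun (\<lambda>h. frechet_derivative pr (at (q u)) (R h))" for u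
  have \<psi>'_bl: "bounded_linear (\<lambda>h. frechet_derivative pr (at (q u)) (R h))" if "u \<in> U" for u
    using bounded_linear_compose[OF has_derivative_bounded_linear[OF der] blR] that by (simp add: U_def)
  then have app: "blinfun_apply (\<psi>' u) = (\<lambda>h. frechet_derivative pr (at (q u)) (R h))" if "u \<in> U" for u
    using bounded_linear_Blinfun_apply that unfolding \<psi>'_def by blast
  have \<psi>der: "(\<psi> has_derivative blinfun_apply (\<psi>' u)) (at u)" if u: "u \<in> U" for u
  proof -
    have "(pr \<circ> q has_derivative frechet_derivative pr (at (q u)) \<circ> R) (at u)"
      using u by (intro diff_chain_at qder der) (simp add: U_def)
    then show ?thesis unfolding app[OF u] \<psi>_def comp_def .
  qed
  have \<psi>cont: "continuous_on U \<psi>'"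
  proof (rule continuous_on_blinfun_componentwise)
    fix i :: 'f assume "i \<in> Basis"
    have "continuous_on U (\<lambda>u. frechet_derivative pr (at (q u)) (R i))"
      by (rule continuous_on_compose2[OF Ck_on_1_continuous[OF Ck, of "R i"] continuous_on_subset[OF qcont]])
        (auto simp: U_def)
    then show "continuous_on U (\<lambda>u. blinfun_apply (\<psi>' u) i)"
      using continuous_on_cong[OF refl, of U "\<lambda>u. blinfun_apply (\<psi>' u) i" "\<lambda>u. frechet_derivative pr (at (q u)) (R i)"] app by simp
  qed
  have q0: "q 0 = x0" by (simp add: q_def linear_0[OF R(1)])
  have LR: "frechet_derivative pr (at x0) (R h) = h" for h using R(2) by (metis comp_apply id_apply)
  have id0: "\<psi>' 0 = id_blinfun"
    by (rule blinfun_eqI) (simp add: app[OF U(2)] q0 LR)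
  then have "id_blinfun o\<^sub>L \<psi>' 0 = id_blinfun" by (intro blinfun_eqI) simp
  then obtain U' V g g' where g: "open U'" "U' \<subseteq> U" "0 \<in> U'" "open V" "\<psi> 0 \<in> V" "homeomorphism U' V \<psi> g"
    "\<And>y. y \<in> V \<Longrightarrow> (g has_derivative (g' y)) (at y)"
    "\<And>y. y \<in> V \<Longrightarrow> g' y = inv_into UNIV (blinfun_apply (\<psi>'(g y)))"
    using inverse_function_theorem[OF U(1) \<psi>der \<psi>cont U(2)] by metis
  have \<psi>0: "\<psi> 0 = pr x0" by (simp add: \<psi>_def q0)
  have g0: "g (\<psi> 0) = 0" using homeomorphism_apply1[OF g(6,3)] .
  have "g' (\<psi> 0) = inv_into UNIV (blinfun_apply id_blinfun)" using g(8)[OF g(5)] g0 id0 by simp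
  also have "blinfun_apply id_blinfun = (id :: 'f \<Rightarrow> 'f)" by (simp add: id_blinfun.rep_eq id_def)
  finally have g'0: "g' (\<psi> 0) = id" by (simp only: inv_id)
  have "(q \<circ> g has_derivative R \<circ> id) (at (\<psi> 0))"
    using diff_chain_at[OF g(7)[OF g(5)] qder] unfolding g'0 .
  then have 1: "((\<lambda>y. q (g y)) has_derivative R) (at (pr x0))" by (simp add: comp_def \<psi>0)
  have 2: "q (g y) \<in> \<Omega> \<and> pr (q (g y)) = y" if y: "y \<in> V" for y
  proof -
    have "g y \<in> U'" using homeomorphism_image2[OF g(6)] y by blast
    then have "q (g y) \<in> \<Omega>" using g(2) unfolding U_def by blast
    moreover have "\<psi> (g y) = y" by (rule homeomorphism_apply2[OF g(6) y])
    ultimately show ?thesis by (simp add: \<psi>_def)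
  qed
  show ?thesis
    by (rule that[of V "\<lambda>y. q (g y)" R]) (use g(4,5) g0 q0 \<psi>0 1 2 R(1) LR in auto)
qed

text \<open>Let \<open>p = g0 H\<close> and let \<open>k\<close> be a local section of the projection with \<open>k p = g0\<close>. Then \<open>b q = k q g0\<^sup>-\<^sup>1\<close> moves
  \<open>p\<close> to \<open>q\<close>, and near \<open>p\<close> left translation by \<open>b q\<close> is the composition of the section, left multiplication
  by \<open>b q\<close> in \<open>G\<close>, and the projection. This shows that the translation is differentiable at \<open>p\<close>, and that
  its derivative there depends continuously on \<open>q\<close> and is the identity for \<open>q = p\<close>.\<close>

lemma homogeneous_cone_field_continuous:
  fixes NG :: "('g, 'e::euclidean_space) manifold" and M :: "('g set, 'f::euclidean_space) manifold"
  assumes lg: "lie_group G NG" and H: "subgroup H G" and hs: "homogeneous_space G NG H M"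
    and C: "cone_field M C" and hom: "homogeneous_cone_field M (carrier G) (lact G) C"
  shows "manifold.continuous_cone_field M C"
proof -
  interpret grp: group G using lg unfolding lie_group_def by blast
  interpret NG: manifold NG using lg unfolding lie_group_def by unfold_locales blast
  interpret M: manifold M using hs unfolding homogeneous_space_def by unfold_locales blast
  let ?\<pi> = "\<lambda>g. g <#\<^bsub>G\<^esub> H"
  have HG: "H \<subseteq> carrier G" by (rule subgroup.subset[OF H])
  have carrier: "carrier G = topspace (mtop NG)" using lg unfolding lie_group_def by blast
  have mult: "Ck_map 1 (prod_manifold NG NG) NG (\<lambda>(x, y). x \<otimes>\<^bsub>G\<^esub> y)"
    using lg unfolding lie_group_def smooth_map_def by blast
  have proj: "Ck_map 1 NG M ?\<pi>" using hs unfolding homogeneous_space_def smooth_map_def by blast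
  show ?thesis unfolding M.continuous_cone_field_def
  proof (intro allI ballI impI)
    fix p c and e :: real assume c: "c \<in> charts_at M p" and e: "e > 0"
    have ca: "c \<in> atlas M" "p \<in> fst c" using M.charts_atD c by blast+
    have "p \<in> topspace (mtop M)" by (rule M.charts_at_topspace[OF c])
    then obtain g0 where g0: "g0 \<in> carrier G" "p = ?\<pi> g0"
      using hs unfolding homogeneous_space_def LCOSETS_def by auto
    obtain c0 where c0: "c0 \<in> charts_at NG g0" using NG.chart_exists g0(1) carrier by metis
    obtain c1 where c1: "c1 \<in> charts_at NG \<one>\<^bsub>G\<^esub>" using NG.chart_exists grp.one_closed carrier by metis
    have c0a: "c0 \<in> atlas NG" "g0 \<in> fst c0" using NG.charts_atD c0 by blast+
    have c1a: "c1 \<in> atlas NG" "\<one>\<^bsub>G\<^esub> \<in> fst c1" using NG.charts_atD c1 by blast+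
    have fst_carrier: "fst c0 \<subseteq> carrier G" "fst c1 \<subseteq> carrier G"
      using openin_subset[OF NG.openin_chart] c0a c1a carrier by blast+
    let ?p = "snd c p" and ?k0 = "snd c0 g0" and ?b0 = "snd c1 \<one>\<^bsub>G\<^esub>"
    define pr where "pr = snd c \<circ> ?\<pi> \<circ> chart_inv c0"
    define \<Omega> where "\<Omega> = snd c0 ` {g \<in> fst c0. ?\<pi> g \<in> fst c}"
    have Ck_pr: "Ck_on 1 pr \<Omega>" using proj c0a(1) ca(1) unfolding Ck_map_def pr_def \<Omega>_def by blast
    have "openin (mtop NG) {g \<in> topspace (mtop NG). ?\<pi> g \<in> fst c}"
      by (rule openin_continuous_map_preimage[OF _ M.openin_chart[OF ca(1)]]) (use proj in \<open>simp add: Ck_map_def\<close>)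
    from NG.openin_chart_image[OF c0a(1) this]
    have "open (snd c0 ` (fst c0 \<inter> {g \<in> topspace (mtop NG). ?\<pi> g \<in> fst c}))" .
    also have "fst c0 \<inter> {g \<in> topspace (mtop NG). ?\<pi> g \<in> fst c} = {g \<in> fst c0. ?\<pi> g \<in> fst c}"
      using fst_carrier(1) carrier by blast
    finally have \<Omega>: "open \<Omega>" unfolding \<Omega>_def .
    have k0: "?k0 \<in> \<Omega>" unfolding \<Omega>_def using c0a(2) ca(2) g0(2) by blast
    have pr_k0: "pr ?k0 = ?p" unfolding pr_def using c0a g0(2) by simp
    let ?L = "frechet_derivative pr (at ?k0)"
    have derL: "(pr has_derivative ?L) (at ?k0)" by (rule Ck_on_1_derivative[OF Ck_pr k0])
    have "surj ?L"
      unfolding surj_def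
    proof
      fix w :: 'f
      have "tangent_of_coord M c p w \<in> tangent_space M p" by (rule M.tangent_of_coord_in[OF c])
      then obtain h where h: "h \<in> tangent_space NG g0" "tangent_of_coord M c p w = mdiff NG M ?\<pi> g0 h"
        using hs g0 unfolding homogeneous_space_def by blast
      have "mdiff NG M ?\<pi> g0 h c = ?L (h c0)"
        unfolding pr_def
        by (rule mdiff_chart[OF NG.manifold_axioms c0 _ h(1) derL[unfolded pr_def]]) (use c g0(2) in simp)
      then have "w = ?L (h c0)" using M.tangent_of_coord_self[OF c, of w] h(2) by simp
      then show "\<exists>h. w = ?L h" by blast
    qed
    from local_section[OF \<Omega> k0 Ck_pr this] obtain V \<sigma> R where
      V: "open V" "?p \<in> V" and \<sigma>p: "\<sigma> ?p = ?k0" and \<sigma>: "\<And>y. y \<in> V \<Longrightarrow> \<sigma> y \<in> \<Omega> \<and> pr (\<sigma> y) = y"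
      and R: "linear R" "\<And>h. ?L (R h) = h" and \<sigma>der: "(\<sigma> has_derivative R) (at ?p)"
      unfolding pr_k0 by metis
    have \<sigma>lim: "(\<sigma> \<longlongrightarrow> ?k0) (nhds ?p)"
    proof -
      have "(\<sigma> \<longlongrightarrow> \<sigma> ?p) (nhds ?p)"
        using has_derivative_continuous[OF \<sigma>der] unfolding isCont_def tendsto_at_iff_tendsto_nhds .
      then show ?thesis by (simp only: \<sigma>p)
    qed
    define k where "k y = chart_inv c0 (\<sigma> y)" for y
    have k: "k y \<in> fst c0" "snd c0 (k y) = \<sigma> y" "?\<pi> (k y) \<in> fst c" "snd c (?\<pi> (k y)) = y" if y: "y \<in> V" for y
    proof -
      obtain g where g: "g \<in> fst c0" "?\<pi> g \<in> fst c" "\<sigma> y = snd c0 g" using \<sigma>[OF y] unfolding \<Omega>_def by blast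
      then have kg: "k y = g" unfolding k_def using c0a(1) by simp
      show "k y \<in> fst c0" "snd c0 (k y) = \<sigma> y" "?\<pi> (k y) \<in> fst c" using g kg by simp_all
      have "pr (\<sigma> y) = snd c (?\<pi> (k y))" unfolding pr_def k_def by simp
      then show "snd c (?\<pi> (k y)) = y" using \<sigma>[OF y] by simp
    qed
    have klim: "limitin (mtop NG) k g0 (nhds ?p)"
    proof -
      have "limitin (mtop NG) (\<lambda>y. chart_inv c0 (\<sigma> y)) (chart_inv c0 ?k0) (nhds ?p)"
        by (rule NG.limitin_chart_inv[OF c0a(1) _ \<sigma>lim]) (use c0a(2) in blast)
      then show ?thesis unfolding k_def using c0a by simp
    qed
    \<comment> \<open>the group element moving \<open>p\<close> to the point with coordinates \<open>y\<close>\<close>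
    define b where "b y = k y \<otimes>\<^bsub>G\<^esub> inv\<^bsub>G\<^esub> g0" for y
    have bG: "b y \<in> carrier G" "b y \<otimes>\<^bsub>G\<^esub> g0 = k y" if "y \<in> V" for y
      using k(1)[OF that] fst_carrier(1) g0(1) unfolding b_def by (auto simp: grp.m_assoc)
    have blim: "limitin (mtop NG) b \<one>\<^bsub>G\<^esub> (nhds ?p)"
    proof -
      have "continuous_map (prod_topology (mtop NG) (mtop NG)) (mtop NG) (\<lambda>(x, y). x \<otimes>\<^bsub>G\<^esub> y)"
        using mult unfolding Ck_map_def prod_manifold_def by simp
      moreover have "continuous_map (mtop NG) (prod_topology (mtop NG) (mtop NG)) (\<lambda>x. (x, inv\<^bsub>G\<^esub> g0))"
        using g0(1) carrier by (intro continuous_map_pairedI) auto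
      ultimately have "continuous_map (mtop NG) (mtop NG) ((\<lambda>(x, y). x \<otimes>\<^bsub>G\<^esub> y) \<circ> (\<lambda>x. (x, inv\<^bsub>G\<^esub> g0)))"
        using continuous_map_compose by blast
      from continuous_map_limit[OF this klim] show ?thesis
        using g0(1) unfolding b_def by (simp add: comp_def)
    qed
    have b1lim: "((\<lambda>y. snd c1 (b y)) \<longlongrightarrow> ?b0) (nhds ?p)" and bdom: "\<forall>\<^sub>F y in nhds ?p. b y \<in> fst c1"
      using blim[unfolded NG.limitin_chart[OF c1]] by blast+
    define D where "D = {(s, y). s \<in> snd c1 ` fst c1 \<and> y \<in> snd c0 ` fst c0 \<and> chart_inv c1 s \<otimes>\<^bsub>G\<^esub> chart_inv c0 y \<in> fst c0}"
    define \<mu> where "\<mu> = (\<lambda>(s, y). snd c0 (chart_inv c1 s \<otimes>\<^bsub>G\<^esub> chart_inv c0 y))"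
    have D: "open D" and \<mu>: "Ck_on 1 \<mu> D"
      unfolding D_def \<mu>_def
      by (rule Ck_map_prod_chart[OF mult c1a(1) NG.is_chart[OF c1a(1)] c0a(1) NG.is_chart[OF c0a(1)] c0a(1) NG.openin_chart[OF c0a(1)]])+
    have inD: "(snd c1 (b y), ?k0) \<in> D" "\<mu> (snd c1 (b y), ?k0) = \<sigma> y" if "y \<in> V" "b y \<in> fst c1" for y
      unfolding D_def \<mu>_def using that k[OF that(1)] bG[OF that(1)] c1a(1) c0a by auto
    have bp: "b ?p = \<one>\<^bsub>G\<^esub>"
    proof -
      have "k ?p = g0" unfolding k_def \<sigma>p using c0a by simp
      then show ?thesis unfolding b_def using g0(1) by simp
    qed
    define Q where "Q y h = frechet_derivative \<mu> (at (snd c1 (b y), ?k0)) (0, h)" for y h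
    define A where "A y h = frechet_derivative pr (at (\<sigma> y)) (Q y (R h))" for y h
    have Qder: "((\<lambda>x. \<mu> (snd c1 (b y), x)) has_derivative Q y) (at ?k0)" if "y \<in> V" "b y \<in> fst c1" for y
    proof -
      have "?k0 \<in> {x. (snd c1 (b y), x) \<in> D}" using inD(1)[OF that] by blast
      from Ck_on_1_derivative[OF Ck_on_1_slice(1)[OF \<mu>] this]
      have "((\<lambda>x. \<mu> (snd c1 (b y), x)) has_derivative frechet_derivative (\<lambda>x. \<mu> (snd c1 (b y), x)) (at ?k0)) (at ?k0)" .
      also have "frechet_derivative (\<lambda>x. \<mu> (snd c1 (b y), x)) (at ?k0) = Q y"
        by (rule ext) (simp only: Q_def Ck_on_1_slice(2)[OF \<mu> inD(1)[OF that]])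
      finally show ?thesis .
    qed
    have pr_der: "(pr has_derivative frechet_derivative pr (at (\<sigma> y))) (at (\<sigma> y))" if "y \<in> V" for y
      by (rule Ck_on_1_derivative[OF Ck_pr]) (use \<sigma>[OF that] in blast)
    have Q1: "Q ?p = id"
    proof -
      have "((\<lambda>x. \<mu> (snd c1 (b ?p), x)) has_derivative id) (at ?k0)"
      proof (rule has_derivative_transform_within_open[of id id _ UNIV "snd c0 ` fst c0"])
        show "(id has_derivative id) (at ?k0)" by (simp add: id_def)
        show "open (snd c0 ` fst c0)" by (rule NG.open_coords[OF c0a(1)])
        show "?k0 \<in> snd c0 ` fst c0" using c0a(2) by blast
        fix x assume "x \<in> snd c0 ` fst c0"
        then obtain g where "g \<in> fst c0" "x = snd c0 g" by blast
        then show "id x = \<mu> (snd c1 (b ?p), x)"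
          unfolding \<mu>_def bp using c1a c0a(1) fst_carrier(1) by auto
      qed
      moreover have "((\<lambda>x. \<mu> (snd c1 (b ?p), x)) has_derivative Q ?p) (at ?k0)"
        by (rule Qder) (use V(2) bp c1a(2) in simp_all)
      ultimately show ?thesis using has_derivative_unique by blast
    qed
    have ev: "\<forall>\<^sub>F y in nhds ?p. y \<in> V \<and> b y \<in> fst c1"
      using eventually_nhds_in_open[OF V] bdom by eventually_elim blast
    have Qlim: "((\<lambda>y. Q y h) \<longlongrightarrow> h) (nhds ?p)" for h
    proof -
      have "(?b0, ?k0) \<in> D" using inD(1)[of ?p] V(2) bp c1a(2) by simp
      then have "isCont (\<lambda>z. frechet_derivative \<mu> (at z) (0, h)) (?b0, ?k0)"
        using Ck_on_1_continuous[OF \<mu>, of "(0, h)"] D by (simp add: continuous_on_eq_continuous_at)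
      moreover have "((\<lambda>y. (snd c1 (b y), ?k0)) \<longlongrightarrow> (?b0, ?k0)) (nhds ?p)"
        by (intro tendsto_Pair b1lim tendsto_const)
      ultimately have "((\<lambda>y. Q y h) \<longlongrightarrow> frechet_derivative \<mu> (at (?b0, ?k0)) (0, h)) (nhds ?p)"
        unfolding Q_def by (rule isCont_tendsto_compose)
      moreover have "frechet_derivative \<mu> (at (?b0, ?k0)) (0, h) = h"
        using fun_cong[OF Q1, of h] unfolding Q_def bp by simp
      ultimately show ?thesis by simp
    qed
    have Plim: "((\<lambda>y. frechet_derivative pr (at (\<sigma> y)) h) \<longlongrightarrow> ?L h) (nhds ?p)" for h
    proof -
      have "isCont (\<lambda>z. frechet_derivative pr (at z) h) ?k0"
        using Ck_on_1_continuous[OF Ck_pr, of h] \<Omega> k0 by (simp add: continuous_on_eq_continuous_at)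
      then show ?thesis by (rule isCont_tendsto_compose[OF _ \<sigma>lim])
    qed
    have linA: "\<forall>\<^sub>F y in nhds ?p. linear (A y)"
      using ev
    proof eventually_elim
      case (elim y)
      have "linear (frechet_derivative pr (at (\<sigma> y)) \<circ> (Q y \<circ> R))"
        using elim has_derivative_linear[OF pr_der] has_derivative_linear[OF Qder] R(1)
        by (intro linear_compose) blast+
      then show ?case by (simp add: A_def[abs_def] comp_def)
    qed
    have "\<forall>\<^sub>F y in nhds ?p. \<forall>h. norm (A y h - h) \<le> e * norm h"
    proof (rule linear_family_near[OF linA linear_id[unfolded id_def] _ e])
      fix h :: 'f
      have "((\<lambda>y. frechet_derivative pr (at (\<sigma> y)) (Q y (R h))) \<longlongrightarrow> ?L (R h)) (nhds ?p)"
      proof (rule linear_family_tendsto[OF _ has_derivative_linear[OF derL] Plim Qlim])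
        show "\<forall>\<^sub>F y in nhds ?p. linear (frechet_derivative pr (at (\<sigma> y)))"
          using ev by eventually_elim (rule has_derivative_linear[OF pr_der]; blast)
      qed
      then show "((\<lambda>y. A y h) \<longlongrightarrow> h) (nhds ?p)" unfolding A_def R(2) .
    qed
    with ev linA have "\<forall>\<^sub>F y in nhds ?p. (y \<in> V \<and> b y \<in> fst c1) \<and> linear (A y) \<and> (\<forall>h. norm (A y h - h) \<le> e * norm h)"
      by eventually_elim blast
    then obtain W where W: "open W" "?p \<in> W"
      "\<And>y. y \<in> W \<Longrightarrow> (y \<in> V \<and> b y \<in> fst c1) \<and> linear (A y) \<and> (\<forall>h. norm (A y h - h) \<le> e * norm h)"
      unfolding eventually_nhds by blast
    have cone: "M.coord_cone C c q = A (snd c q) ` M.coord_cone C c p" if q: "q \<in> fst c" "snd c q \<in> W" for q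
    proof -
      let ?y = "snd c q"
      have yV: "?y \<in> V" and yb: "b ?y \<in> fst c1" using W(3)[OF q(2)] by blast+
      have q': "?\<pi> (k ?y) = q"
        using inj_onD[OF M.inj_chart[OF ca(1)] k(4)[OF yV] k(3)[OF yV] q(1)] .
      have act: "lact G (b ?y) (?\<pi> g) = ?\<pi> (b ?y \<otimes>\<^bsub>G\<^esub> g)" if "g \<in> carrier G" for g
        unfolding lact_def by (rule grp.lcos_m_assoc[OF HG bG(1)[OF yV] that])
      have actp: "lact G (b ?y) p = q"
        using act[OF g0(1)] bG(2)[OF yV] q' unfolding g0(2)[symmetric] by simp
      have "(pr \<circ> ((\<lambda>x. \<mu> (snd c1 (b ?y), x)) \<circ> \<sigma>) has_derivative frechet_derivative pr (at (\<sigma> ?y)) \<circ> (Q ?y \<circ> R)) (at ?p)"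
      proof (rule diff_chain_at)
        show "((\<lambda>x. \<mu> (snd c1 (b ?y), x)) \<circ> \<sigma> has_derivative (Q ?y \<circ> R)) (at ?p)"
          by (rule diff_chain_at[OF \<sigma>der]) (unfold \<sigma>p, rule Qder[OF yV yb])
        show "(pr has_derivative frechet_derivative pr (at (\<sigma> ?y))) (at (((\<lambda>x. \<mu> (snd c1 (b ?y), x)) \<circ> \<sigma>) ?p))"
          using pr_der[OF yV] inD(2)[OF yV yb] by (simp add: \<sigma>p)
      qed
      then have dA: "(pr \<circ> ((\<lambda>x. \<mu> (snd c1 (b ?y), x)) \<circ> \<sigma>) has_derivative A ?y) (at ?p)"
        by (simp add: A_def[abs_def] comp_def)
      have "(snd c \<circ> lact G (b ?y) \<circ> chart_inv c has_derivative A ?y) (at ?p)"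
      proof (rule has_derivative_transform_eventually[OF dA])
        have D': "\<forall>\<^sub>F y' in nhds ?p. (snd c1 (b ?y), \<sigma> y') \<in> D"
        proof -
          have "((\<lambda>y'. (snd c1 (b ?y), \<sigma> y')) \<longlongrightarrow> (snd c1 (b ?y), ?k0)) (nhds ?p)"
            by (intro tendsto_Pair tendsto_const \<sigma>lim)
          then show ?thesis using topological_tendstoD[OF _ D inD(1)[OF yV yb]] by blast
        qed
        have eq: "(pr \<circ> ((\<lambda>x. \<mu> (snd c1 (b ?y), x)) \<circ> \<sigma>)) y' = (snd c \<circ> lact G (b ?y) \<circ> chart_inv c) y'"
          if y': "y' \<in> V" "(snd c1 (b ?y), \<sigma> y') \<in> D" for y'
        proof -
          have "chart_inv c y' = ?\<pi> (k y')" using M.chart_inv_chart[OF ca(1) k(3)[OF y'(1)]] k(4)[OF y'(1)] by simp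
          then have "(snd c \<circ> lact G (b ?y) \<circ> chart_inv c) y' = snd c (?\<pi> (b ?y \<otimes>\<^bsub>G\<^esub> k y'))"
            using act[of "k y'"] k(1)[OF y'(1)] fst_carrier(1) by auto
          moreover have "b ?y \<otimes>\<^bsub>G\<^esub> k y' \<in> fst c0"
            using y'(2) yb c1a(1) unfolding D_def k_def by simp
          then have "pr (\<mu> (snd c1 (b ?y), \<sigma> y')) = snd c (?\<pi> (b ?y \<otimes>\<^bsub>G\<^esub> k y'))"
            unfolding pr_def \<mu>_def using yb c1a(1) c0a(1) by (simp add: k_def)
          ultimately show ?thesis by simp
        qed
        have "\<forall>\<^sub>F y' in nhds ?p. (pr \<circ> ((\<lambda>x. \<mu> (snd c1 (b ?y), x)) \<circ> \<sigma>)) y' = (snd c \<circ> lact G (b ?y) \<circ> chart_inv c) y'"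
          using D' eventually_nhds_in_open[OF V] by eventually_elim (rule eq)
        then show "\<forall>\<^sub>F y' in at ?p. (pr \<circ> ((\<lambda>x. \<mu> (snd c1 (b ?y), x)) \<circ> \<sigma>)) y' = (snd c \<circ> lact G (b ?y) \<circ> chart_inv c) y'"
          and "(pr \<circ> ((\<lambda>x. \<mu> (snd c1 (b ?y), x)) \<circ> \<sigma>)) ?p = (snd c \<circ> lact G (b ?y) \<circ> chart_inv c) ?p"
          unfolding eventually_nhds_conv_at by blast+
      qed simp
      have cq: "c \<in> charts_at M (lact G (b ?y) p)" unfolding actp using q(1) ca(1) by (simp add: charts_at_def)
      have md: "mdiff M M (lact G (b ?y)) p v c = A ?y (v c)" if "v \<in> C p" for v
        by (rule mdiff_chart[OF M.manifold_axioms c cq _ \<open>(snd c \<circ> lact G (b ?y) \<circ> chart_inv c has_derivative A ?y) (at ?p)\<close>])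
          (use that M.cone_field_tangent[OF C M.charts_at_topspace[OF c]] in blast)
      have "C q = mdiff M M (lact G (b ?y)) p ` C p"
        using hom bG(1)[OF yV] M.charts_at_topspace[OF c] actp unfolding homogeneous_cone_field_def by metis
      then have "M.coord_cone C c q = (\<lambda>v. mdiff M M (lact G (b ?y)) p v c) ` C p"
        unfolding M.coord_cone_def by (simp add: image_image)
      also have "\<dots> = (\<lambda>v. A ?y (v c)) ` C p" by (rule image_cong[OF refl md])
      finally show ?thesis unfolding M.coord_cone_def by (simp add: image_image)
    qed
    show "\<exists>U. openin (mtop M) U \<and> p \<in> U \<and> U \<subseteq> fst c \<and> (\<forall>q\<in>U. \<exists>A. linear A \<and> (\<forall>h. norm (A h - h) \<le> e * norm h) \<and>
        M.coord_cone C c q = A ` M.coord_cone C c p)"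
    proof (intro exI conjI)
      show "openin (mtop M) {q \<in> fst c. snd c q \<in> W}" by (rule M.openin_chart_preimage[OF ca(1) W(1)])
      show "p \<in> {q \<in> fst c. snd c q \<in> W}" using ca(2) W(2) by simp
      show "\<forall>q\<in>{q \<in> fst c. snd c q \<in> W}. \<exists>A. linear A \<and> (\<forall>h. norm (A h - h) \<le> e * norm h) \<and>
        M.coord_cone C c q = A ` M.coord_cone C c p"
      proof
        fix q assume "q \<in> {q \<in> fst c. snd c q \<in> W}"
        then have q: "q \<in> fst c" "snd c q \<in> W" by simp_all
        show "\<exists>A. linear A \<and> (\<forall>h. norm (A h - h) \<le> e * norm h) \<and> M.coord_cone C c q = A ` M.coord_cone C c p"
          using cone[OF q] W(3)[OF q(2)] by blast
      qed
    qed blast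
  qed
qed


section \<open>Strongly monotone flows and invariant measures\<close>

text \<open>If the new set were separated, the part of the separation which does not contain \<open>x\<close> would be clopen
  in all of \<open>B\<close>.\<close>

lemma connectedin_insert_clopen:
  assumes B: "connectedin X B" and x: "x \<in> B" "closedin X {x}" and W: "openin X W" and K: "closedin X K"
    and eq: "\<And>y. y \<in> B \<Longrightarrow> y \<noteq> x \<Longrightarrow> y \<in> W \<longleftrightarrow> y \<in> K"
  shows "connectedin X (insert x {y \<in> B. y \<noteq> x \<and> y \<in> W})" (is "connectedin X ?S")
proof -
  have BX: "B \<subseteq> topspace X" using connectedin_subset_topspace[OF B] .
  have no: False if E: "openin X E1" "openin X E2" "?S \<subseteq> E1 \<union> E2" "E1 \<inter> E2 \<inter> ?S = {}" "x \<in> E1" "E2 \<inter> ?S \<noteq> {}" for E1 E2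
  proof -
    define F1 where "F1 = E1 \<union> (topspace X - K)"
    define F2 where "F2 = E2 \<inter> W \<inter> (topspace X - {x})"
    have "openin X F1" unfolding F1_def using E(1) K by (intro openin_Un openin_diff) auto
    moreover have "openin X F2" unfolding F2_def using E(2) W x(2) by (intro openin_Int openin_diff) auto
    moreover have "B \<subseteq> F1 \<union> F2"
    proof
      fix y assume y: "y \<in> B"
      show "y \<in> F1 \<union> F2"
      proof (cases "y = x \<or> y \<notin> K")
        case True
        then show ?thesis using E(5) y BX unfolding F1_def by blast
      next
        case False
        then have "y \<in> ?S" "y \<in> W" "y \<noteq> x" using eq y by blast+
        then show ?thesis using E(3) y BX unfolding F1_def F2_def by blast
      qed
    qed
    moreover have "F1 \<inter> F2 \<inter> B = {}"
    proof (rule ccontr)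
      assume "F1 \<inter> F2 \<inter> B \<noteq> {}"
      then obtain y where y: "y \<in> F1" "y \<in> F2" "y \<in> B" by blast
      then have "y \<in> ?S" "y \<in> E2" "y \<in> K" using eq unfolding F2_def by blast+
      then show False using y(1) E(4) unfolding F1_def by blast
    qed
    moreover have "F1 \<inter> B \<noteq> {}" using E(5) x(1) unfolding F1_def by blast
    moreover have "F2 \<inter> B \<noteq> {}"
    proof -
      obtain y where y: "y \<in> E2" "y \<in> ?S" using E(6) by blast
      then have "y \<noteq> x" using E(4,5) by blast
      then show ?thesis using y BX unfolding F2_def by blast
    qed
    ultimately show False using B unfolding connectedin by blast
  qed
  show ?thesis unfolding connectedin
  proof (intro conjI notI)
    show "?S \<subseteq> topspace X" using BX x(1) by blast
    assume "\<exists>E1 E2. openin X E1 \<and> openin X E2 \<and> ?S \<subseteq> E1 \<union> E2 \<and> E1 \<inter> E2 \<inter> ?S = {} \<and> E1 \<inter> ?S \<noteq> {} \<and> E2 \<inter> ?S \<noteq> {}"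
    then obtain E1 E2 where E: "openin X E1" "openin X E2" "?S \<subseteq> E1 \<union> E2" "E1 \<inter> E2 \<inter> ?S = {}" "E1 \<inter> ?S \<noteq> {}" "E2 \<inter> ?S \<noteq> {}"
      by blast
    have "x \<in> E1 \<or> x \<in> E2" using E(3) by blast
    moreover have "E2 \<inter> E1 \<inter> ?S = {}" "?S \<subseteq> E2 \<union> E1" using E(3,4) by blast+
    ultimately show False using no[OF E(1,2,3,4) _ E(6)] no[OF E(2,1) _ _ _ E(5)] by blast
  qed
qed

text \<open>For fixed \<open>x\<close> the points related to \<open>x\<close> and those unrelated to \<open>x\<close> split \<open>B - {x}\<close> into clopen parts \<open>U\<close> and
  \<open>V\<close>. If \<open>y \<in> U\<close> and \<open>z \<in> V\<close>, then \<open>U \<union> {x}\<close> is connected and avoids \<open>z\<close>, so \<open>z\<close> is unrelated to \<open>y\<close> as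
  it is to \<open>x\<close>; but \<open>V \<union> {x}\<close> is connected and avoids \<open>y\<close>, so \<open>y\<close> is related to \<open>z\<close> as it is to \<open>x\<close>.\<close>

lemma connected_symmetric_dichotomy:
  assumes B: "connectedin X B" and T1: "\<And>x. x \<in> B \<Longrightarrow> closedin X {x}"
    and sym: "\<And>x y. R x y \<Longrightarrow> R y x"
    and W: "\<And>x. x \<in> B \<Longrightarrow> openin X (W x)" and K: "\<And>x. x \<in> B \<Longrightarrow> closedin X (K x)"
    and RW: "\<And>x y. x \<in> B \<Longrightarrow> y \<in> B \<Longrightarrow> x \<noteq> y \<Longrightarrow> R x y \<longleftrightarrow> y \<in> W x"
    and RK: "\<And>x y. x \<in> B \<Longrightarrow> y \<in> B \<Longrightarrow> x \<noteq> y \<Longrightarrow> R x y \<longleftrightarrow> y \<in> K x"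
  shows "(\<forall>x\<in>B. \<forall>y\<in>B. x \<noteq> y \<longrightarrow> R x y) \<or> (\<forall>x\<in>B. \<forall>y\<in>B. x \<noteq> y \<longrightarrow> \<not> R x y)"
proof -
  have BX: "B \<subseteq> topspace X" using connectedin_subset_topspace[OF B] .
  have const: "R z a \<longleftrightarrow> R z b"
    if S: "connectedin X S" "S \<subseteq> B" "z \<in> B" "z \<notin> S" and ab: "a \<in> S" "b \<in> S" for z S a b
  proof -
    have 1: "R z y \<longleftrightarrow> y \<in> W z" "R z y \<longleftrightarrow> y \<in> K z" if "y \<in> S" for y
      using RW[of z y] RK[of z y] S that by blast+
    have op: "openin X (W z)" "openin X (topspace X - K z)" using W[OF S(3)] K[OF S(3)] by blast+
    have "S \<subseteq> W z \<union> (topspace X - K z)" "W z \<inter> (topspace X - K z) \<inter> S = {}"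
      using 1 S(2) BX by blast+
    then have "W z \<inter> S = {} \<or> (topspace X - K z) \<inter> S = {}"
      using S(1) op unfolding connectedin by blast
    then show ?thesis using 1 ab S(2) BX by blast
  qed
  have all: "R x z" if x: "x \<in> B" and y: "y \<in> B" "y \<noteq> x" "R x y" and z: "z \<in> B" "z \<noteq> x" for x y z
  proof (rule ccontr)
    assume nz: "\<not> R x z"
    have eq: "u \<in> W x \<longleftrightarrow> u \<in> K x" if "u \<in> B" "u \<noteq> x" for u using RW[of x u] RK[of x u] x that by blast
    have U: "connectedin X (insert x {u \<in> B. u \<noteq> x \<and> u \<in> W x})"
      by (rule connectedin_insert_clopen[OF B x T1[OF x] W[OF x] K[OF x] eq])
    have V: "connectedin X (insert x {u \<in> B. u \<noteq> x \<and> u \<in> topspace X - K x})"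
    proof (rule connectedin_insert_clopen[OF B x T1[OF x], where K = "topspace X - W x"])
      show "openin X (topspace X - K x)" "closedin X (topspace X - W x)" using W[OF x] K[OF x] by blast+
    qed (use eq in blast)
    have "R z x \<longleftrightarrow> R z y"
      by (rule const[OF U _ z(1)]) (use x y z nz RW[of x y] RW[of x z] in auto)
    moreover have "R y x \<longleftrightarrow> R y z"
      by (rule const[OF V _ y(1)]) (use x y z nz RK[of x y] RK[of x z] BX in auto)
    ultimately show False using sym y(3) nz by blast
  qed
  have "R u v" if ab: "a \<in> B" "b \<in> B" "a \<noteq> b" "R a b" and uv: "u \<in> B" "v \<in> B" "u \<noteq> v" for a b u v
  proof (cases "u = a")
    case True
    then show ?thesis using all[OF ab(1,2) _ ab(4) uv(2)] ab(3) uv(3) by blast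
  next
    case False
    then have "R a u" using all[OF ab(1,2) _ ab(4) uv(1)] ab(3) by blast
    then have "R u a" by (rule sym)
    then show ?thesis using all[OF uv(1) ab(1) _ _ uv(2)] False uv(3) by blast
  qed
  then show ?thesis by blast
qed

text \<open>The purely topological content of the theorem: no differentiable structure is involved, only an
  order, a stronger open relation, and a flow which turns the former into the latter.\<close>

locale strongly_monotone_flow =
  fixes X :: "'a topology" and le ll :: "'a \<Rightarrow> 'a \<Rightarrow> bool" and \<phi> :: "real \<Rightarrow> 'a \<Rightarrow> 'a" and \<mu> :: "'a measure"
  assumes Hausdorff: "Hausdorff_space X"
    and flow_continuous: "continuous_map (prod_topology euclideanreal X) X (\<lambda>(t, x). \<phi> t x)"
    and flow_0: "x \<in> topspace X \<Longrightarrow> \<phi> 0 x = x"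
    and flow_add: "x \<in> topspace X \<Longrightarrow> \<phi> (s + t) x = \<phi> s (\<phi> t x)"
    and open_future: "openin X {q. ll p q}" and open_past: "openin X {q. ll q p}"
    and ll_trans: "ll x y \<Longrightarrow> ll y z \<Longrightarrow> ll x z"
    and ll_dense: "ll x y \<Longrightarrow> \<exists>z. ll x z \<and> ll z y"
    and ll_le: "ll x y \<Longrightarrow> le x y"
    and quasi_closed: "x \<in> topspace X \<Longrightarrow> y \<in> topspace X \<Longrightarrow>
      (\<And>U V. openin X U \<Longrightarrow> openin X V \<Longrightarrow> x \<in> U \<Longrightarrow> y \<in> V \<Longrightarrow> \<exists>u\<in>U. \<exists>v\<in>V. ll u v) \<Longrightarrow> le x y"
    and push: "le x y \<Longrightarrow> x \<noteq> y \<Longrightarrow> t > 0 \<Longrightarrow> ll (\<phi> t x) (\<phi> t y)"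
    and borel: "borel_probability X \<mu>" and invariant: "invariant_measure \<phi> \<mu>"
begin

lemma flow_map_continuous: "continuous_map X X (\<phi> t)"
proof -
  have "continuous_map X (prod_topology euclideanreal X) (\<lambda>x. (t, x))"
    by (intro continuous_map_pairedI) auto
  from continuous_map_compose[OF this flow_continuous] show ?thesis by (simp add: comp_def)
qed

lemma orbit_continuous: "x \<in> topspace X \<Longrightarrow> continuous_map euclideanreal X (\<lambda>t. \<phi> t x)"
proof -
  assume "x \<in> topspace X"
  then have "continuous_map euclideanreal (prod_topology euclideanreal X) (\<lambda>t. (t, x))"
    by (intro continuous_map_pairedI) auto
  from continuous_map_compose[OF this flow_continuous] show ?thesis by (simp add: comp_def)
qed

lemma flow_in: "x \<in> topspace X \<Longrightarrow> \<phi> t x \<in> topspace X"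
  using flow_map_continuous[of t] unfolding continuous_map_def by blast

lemma flow_inverse: "x \<in> topspace X \<Longrightarrow> \<phi> t (\<phi> (- t) x) = x"
  using flow_add[of x t "- t"] flow_0 by simp

lemma flow_inj:
  assumes "x \<in> topspace X" "y \<in> topspace X" "\<phi> t x = \<phi> t y"
  shows "x = y"
  using flow_inverse[of x "- t"] flow_inverse[of y "- t"] assms by simp

lemma open_preimage: "openin X U \<Longrightarrow> openin X {x \<in> topspace X. \<phi> t x \<in> U}"
  by (rule openin_continuous_map_preimage[OF flow_map_continuous])

lemma ll_open:
  assumes "ll x y"
  obtains U V where "openin X U" "openin X V" "x \<in> U" "y \<in> V" "\<And>u v. u \<in> U \<Longrightarrow> v \<in> V \<Longrightarrow> ll u v"
proof -
  obtain z where z: "ll x z" "ll z y" using ll_dense[OF assms] by blast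
  show ?thesis
  proof (rule that[OF open_past[of z] open_future[of z]])
    fix u v assume "u \<in> {q. ll q z}" "v \<in> {q. ll z q}"
    then show "ll u v" using ll_trans by blast
  qed (use z in auto)
qed

lemma open_sets: "openin X U \<Longrightarrow> U \<in> sets \<mu>"
  using borel unfolding borel_probability_def by auto

lemma space_measure: "space \<mu> = topspace X"
  using borel unfolding borel_probability_def by blast

lemma support_pos: "x \<in> measure_support X \<mu> \<Longrightarrow> openin X U \<Longrightarrow> x \<in> U \<Longrightarrow> emeasure \<mu> U \<noteq> 0"
  unfolding measure_support_def by blast

lemma support_topspace: "x \<in> measure_support X \<mu> \<Longrightarrow> x \<in> topspace X"
  unfolding measure_support_def by blast

lemma preimage_measure: "openin X U \<Longrightarrow> emeasure \<mu> {x \<in> topspace X. \<phi> t x \<in> U} = emeasure \<mu> U"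
proof -
  assume U: "openin X U"
  have "{x \<in> topspace X. \<phi> t x \<in> U} = \<phi> t -` U \<inter> space \<mu>" unfolding space_measure by blast
  then show ?thesis using invariant open_sets[OF U] unfolding invariant_measure_def by simp
qed

lemma support_invariant:
  assumes x: "x \<in> measure_support X \<mu>"
  shows "\<phi> t x \<in> measure_support X \<mu>"
proof -
  have "emeasure \<mu> U \<noteq> 0" if U: "openin X U" "\<phi> t x \<in> U" for U
    using support_pos[OF x open_preimage[OF U(1), of t]] support_topspace[OF x] U(2)
      preimage_measure[OF U(1), of t] by simp
  then show ?thesis using flow_in[OF support_topspace[OF x]] unfolding measure_support_def by blast
qed

text \<open>Poincare recurrence for the product flow and the product measure. The preimages of \<open>U \<times> V\<close> under the
  times \<open>0, 1, 2, \<dots>\<close> have the same positive measure, so two of them meet. Only rectangles occur, hence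
  no comparison of the product \<open>\<sigma>\<close>-algebra with the Borel sets of the product is needed.\<close>

lemma recurrent_pair:
  assumes U: "openin X U" "emeasure \<mu> U \<noteq> 0" and V: "openin X V" "emeasure \<mu> V \<noteq> 0"
  obtains n :: nat and u v where "n \<ge> 1" "u \<in> U" "v \<in> V" "\<phi> (real n) u \<in> U" "\<phi> (real n) v \<in> V"
proof -
  interpret prob_space \<mu> using borel unfolding borel_probability_def by blast
  interpret P: pair_prob_space \<mu> \<mu> ..
  define A where "A i = {x \<in> topspace X. \<phi> (real i) x \<in> U}" for i :: nat
  define B where "B i = {x \<in> topspace X. \<phi> (real i) x \<in> V}" for i :: nat
  have AB: "A i \<in> sets \<mu>" "B i \<in> sets \<mu>" for i
    unfolding A_def B_def using open_sets open_preimage U(1) V(1) by blast+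
  define m where "m = measure \<mu> U * measure \<mu> V"
  have m: "m > 0"
    using U(2) V(2) unfolding m_def by (simp add: emeasure_eq_measure zero_less_measure_iff)
  have meas: "measure (\<mu> \<Otimes>\<^sub>M \<mu>) (A i \<times> B i) = m" for i
  proof -
    have "emeasure (\<mu> \<Otimes>\<^sub>M \<mu>) (A i \<times> B i) = emeasure \<mu> (A i) * emeasure \<mu> (B i)"
      by (rule emeasure_pair_measure_Times[OF AB])
    also have "\<dots> = emeasure \<mu> U * emeasure \<mu> V"
      unfolding A_def B_def by (simp add: preimage_measure U(1) V(1))
    also have "\<dots> = ennreal m" by (simp add: emeasure_eq_measure ennreal_mult'' m_def)
    finally show ?thesis using m by (simp add: measure_def)
  qed
  have "\<exists>i j. i < j \<and> (A i \<times> B i) \<inter> (A j \<times> B j) \<noteq> {}"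
  proof (rule ccontr)
    assume contr: "\<not> ?thesis"
    have dis: "disjoint_family_on (\<lambda>i. A i \<times> B i) {..<k}" for k
      unfolding disjoint_family_on_def
    proof (intro ballI impI)
      fix i j :: nat assume "i \<noteq> j"
      then consider "i < j" | "j < i" by linarith
      then show "(A i \<times> B i) \<inter> (A j \<times> B j) = {}" using contr by cases blast+
    qed
    obtain k :: nat where k: "1 < real k * m" using ex_less_of_nat_mult[OF m] by blast
    have "(\<Sum>i<k. measure (\<mu> \<Otimes>\<^sub>M \<mu>) (A i \<times> B i)) = measure (\<mu> \<Otimes>\<^sub>M \<mu>) (\<Union>i<k. A i \<times> B i)"
      by (rule P.P.finite_measure_finite_Union[symmetric]) (use AB dis in auto)
    also have "\<dots> \<le> 1" by (rule P.P.prob_le_1)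
    finally show False using k by (simp add: meas)
  qed
  then obtain i j a b where ij: "i < j" and a: "a \<in> A i" "a \<in> A j" and b: "b \<in> B i" "b \<in> B j"
    by blast
  have split: "\<phi> (real (j - i)) (\<phi> (real i) z) = \<phi> (real j) z" if "z \<in> topspace X" for z
    using flow_add[OF that, of "real (j - i)" "real i"] ij by (simp add: of_nat_diff)
  show ?thesis
    by (rule that[of "j - i" "\<phi> (real i) a" "\<phi> (real i) b"])
      (use ij a b split in \<open>auto simp: A_def B_def\<close>)
qed

text \<open>The bare relation \<open>x \<le> y\<close> is first spread, by recurrence and quasi-closedness, to a neighbourhood of
  \<open>(x, y)\<close> in the square of the support. The neighbourhood contains a pair from the past of \<open>(x, y)\<close>.\<close>

lemma support_le_imp_ll:
  assumes x: "x \<in> measure_support X \<mu>" and y: "y \<in> measure_support X \<mu>" and le: "le x y" and ne: "x \<noteq> y"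
  shows "ll x y"
proof -
  have xT: "x \<in> topspace X" and yT: "y \<in> topspace X" using support_topspace x y by blast+
  have "ll (\<phi> 1 x) (\<phi> 1 y)" by (rule push[OF le ne]) simp
  then obtain U1 V1 where UV1: "openin X U1" "openin X V1" "\<phi> 1 x \<in> U1" "\<phi> 1 y \<in> V1"
    "\<And>u v. u \<in> U1 \<Longrightarrow> v \<in> V1 \<Longrightarrow> ll u v" using ll_open by blast
  obtain U0 V0 where UV0: "openin X U0" "openin X V0" "x \<in> U0" "y \<in> V0" "disjnt U0 V0"
    using Hausdorff[unfolded Hausdorff_space_def, rule_format, of x y] xT yT ne by blast
  define U where "U = U0 \<inter> {p \<in> topspace X. \<phi> 1 p \<in> U1}"
  define V where "V = V0 \<inter> {p \<in> topspace X. \<phi> 1 p \<in> V1}"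
  have UV: "openin X U" "openin X V" "x \<in> U" "y \<in> V"
    unfolding U_def V_def using UV0 UV1 xT yT by (auto intro: openin_Int open_preimage)
  \<comment> \<open>recurrent pairs accumulate at every pair of support points in \<open>U \<times> V\<close>, not just at \<open>(x, y)\<close>\<close>
  have le': "le x' y'" if x': "x' \<in> measure_support X \<mu>" "x' \<in> U" and y': "y' \<in> measure_support X \<mu>" "y' \<in> V" for x' y'
  proof (rule quasi_closed)
    show "x' \<in> topspace X" "y' \<in> topspace X" using support_topspace x'(1) y'(1) by blast+
    fix U2 V2 assume UV2: "openin X U2" "openin X V2" "x' \<in> U2" "y' \<in> V2"
    have A: "openin X (U2 \<inter> U)" "openin X (V2 \<inter> V)" using UV UV2 by blast+
    have "emeasure \<mu> (U2 \<inter> U) \<noteq> 0" by (rule support_pos[OF x'(1) A(1)]) (use x'(2) UV2 in blast)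
    moreover have "emeasure \<mu> (V2 \<inter> V) \<noteq> 0" by (rule support_pos[OF y'(1) A(2)]) (use y'(2) UV2 in blast)
    ultimately obtain n :: nat and u v where n: "n \<ge> 1" "u \<in> U2 \<inter> U" "v \<in> V2 \<inter> V" "\<phi> (real n) u \<in> U2 \<inter> U" "\<phi> (real n) v \<in> V2 \<inter> V"
      using recurrent_pair[OF A(1) _ A(2)] by blast
    have T: "u \<in> topspace X" "v \<in> topspace X" and ll1: "ll (\<phi> 1 u) (\<phi> 1 v)" and "u \<noteq> v"
      using n(2,3) UV0(5) UV1(5) unfolding U_def V_def disjnt_def by blast+
    have "ll (\<phi> (real n) u) (\<phi> (real n) v)"
    proof (cases "n = 1")
      case False
      then have pos: "real n - 1 > 0" using n(1) by simp
      have "\<phi> 1 u \<noteq> \<phi> 1 v" using flow_inj[OF T] \<open>u \<noteq> v\<close> by blast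
      from push[OF ll_le[OF ll1] this pos] show ?thesis
        using flow_add[OF T(1), of "real n - 1" 1] flow_add[OF T(2), of "real n - 1" 1] by simp
    qed (use ll1 in simp)
    then show "\<exists>u\<in>U2. \<exists>v\<in>V2. ll u v" using n(4,5) by blast
  qed
  \<comment> \<open>go back by a small time within \<open>U \<times> V\<close>, and forward again by strong monotonicity\<close>
  have "openin euclideanreal {t \<in> topspace euclideanreal. \<phi> t x \<in> U}" "openin euclideanreal {t \<in> topspace euclideanreal. \<phi> t y \<in> V}"
    using openin_continuous_map_preimage[OF orbit_continuous[OF xT] UV(1)] openin_continuous_map_preimage[OF orbit_continuous[OF yT] UV(2)] .
  then have "open ({t. \<phi> t x \<in> U} \<inter> {t. \<phi> t y \<in> V})" by (intro open_Int) simp_all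
  moreover have "0 \<in> {t. \<phi> t x \<in> U} \<inter> {t. \<phi> t y \<in> V}" using UV(3,4) flow_0 xT yT by simp
  ultimately obtain e where e: "e > 0" "cball 0 e \<subseteq> {t. \<phi> t x \<in> U} \<inter> {t. \<phi> t y \<in> V}"
    by (meson open_contains_cball)
  have "- e \<in> cball 0 e" using e(1) by (simp add: dist_real_def)
  then have "\<phi> (- e) x \<in> U" "\<phi> (- e) y \<in> V" using e(2) by blast+
  then have "le (\<phi> (- e) x) (\<phi> (- e) y)"
    using le' support_invariant x y by blast
  moreover have "\<phi> (- e) x \<noteq> \<phi> (- e) y" using flow_inj[OF xT yT] ne by blast
  ultimately have "ll (\<phi> e (\<phi> (- e) x)) (\<phi> e (\<phi> (- e) y))" using e(1) by (rule push)
  then show ?thesis using flow_inverse xT yT by simp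
qed

theorem support_component_dichotomy:
  assumes B: "B \<in> connected_components_of (subtopology X (measure_support X \<mu>))"
  shows "(\<forall>x\<in>B. \<forall>y\<in>B. x \<noteq> y \<longrightarrow> ll x y \<or> ll y x) \<or>
         (\<forall>x\<in>B. \<forall>y\<in>B. x \<noteq> y \<longrightarrow> \<not> le x y \<and> \<not> le y x)"
proof -
  let ?S = "measure_support X \<mu>"
  have "connectedin (subtopology X ?S) B" by (rule connectedin_connected_components_of[OF B])
  then have conn: "connectedin X B" and BS: "B \<subseteq> ?S" by (auto simp: connectedin_subtopology)
  have BX: "x \<in> topspace X" if "x \<in> B" for x using support_topspace that BS by blast
  have key: "le x y \<longleftrightarrow> ll x y" if "x \<in> B" "y \<in> B" "x \<noteq> y" for x y
    using support_le_imp_ll[of x y] ll_le[of x y] that BS by blast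
  define F where "F x = {q. ll x q} \<union> {q. ll q x}" for x
  have "(\<forall>x\<in>B. \<forall>y\<in>B. x \<noteq> y \<longrightarrow> ll x y \<or> ll y x) \<or> (\<forall>x\<in>B. \<forall>y\<in>B. x \<noteq> y \<longrightarrow> \<not> (ll x y \<or> ll y x))"
  proof (rule connected_symmetric_dichotomy[OF conn, where W = F and K = "\<lambda>x. X closure_of F x"])
    show "closedin X {x}" if "x \<in> B" for x
      using Hausdorff BX[OF that] by (simp add: closedin_Hausdorff_singleton)
    show oF: "openin X (F x)" for x unfolding F_def by (intro openin_Un open_future open_past)
    show "closedin X (X closure_of F x)" for x by (rule closedin_closure_of)
    show "ll x y \<or> ll y x \<Longrightarrow> ll y x \<or> ll x y" for x y by blast
    show "(ll x y \<or> ll y x) \<longleftrightarrow> y \<in> F x" for x y unfolding F_def by blast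
    show "(ll x y \<or> ll y x) \<longleftrightarrow> y \<in> X closure_of F x" if xy: "x \<in> B" "y \<in> B" "x \<noteq> y" for x y
    proof
      assume "ll x y \<or> ll y x"
      then have "y \<in> F x" unfolding F_def by blast
      then show "y \<in> X closure_of F x" using closure_of_subset[OF openin_subset[OF oF]] by blast
    next
      assume "y \<in> X closure_of F x"
      then consider "y \<in> X closure_of {q. ll x q}" | "y \<in> X closure_of {q. ll q x}"
        unfolding F_def closure_of_Un by blast
      then show "ll x y \<or> ll y x"
      proof cases
        case 1
        have "le x y"
        proof (rule quasi_closed[OF BX[OF xy(1)] BX[OF xy(2)]])
          fix U V assume "openin X U" "openin X V" "x \<in> U" "y \<in> V"
          then show "\<exists>u\<in>U. \<exists>v\<in>V. ll u v" using 1 unfolding in_closure_of by blast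
        qed
        then show ?thesis using key xy by blast
      next
        case 2
        have "le y x"
        proof (rule quasi_closed[OF BX[OF xy(2)] BX[OF xy(1)]])
          fix U V assume "openin X U" "openin X V" "y \<in> U" "x \<in> V"
          then show "\<exists>u\<in>U. \<exists>v\<in>V. ll u v" using 2 unfolding in_closure_of by blast
        qed
        then show ?thesis using key[of y x] xy by blast
      qed
    qed
  qed
  then show ?thesis
  proof
    assume un: "\<forall>x\<in>B. \<forall>y\<in>B. x \<noteq> y \<longrightarrow> \<not> (ll x y \<or> ll y x)"
    have "\<not> le x y" if "x \<in> B" "y \<in> B" "x \<noteq> y" for x y using un key[OF that] that by blast
    then show ?thesis by (metis (full_types))
  qed blast
qed

end


section \<open>Conal orders and flows on homogeneous spaces\<close>

text \<open>Inner continuity for one-point compact sets is openness of the inverse relation. This is how each of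
  the two chronological fields makes the other one open.\<close>

lemma inner_continuous_openin:
  assumes I: "continuous_chron X I" and top: "\<And>q. p \<in> I q \<Longrightarrow> p \<in> topspace X \<and> q \<in> topspace X"
  shows "openin X {q. p \<in> I q}"
proof (subst openin_subopen, intro ballI)
  fix q assume "q \<in> {q. p \<in> I q}"
  then have q: "p \<in> I q" "p \<in> topspace X" "q \<in> topspace X" using top by blast+
  have inner: "inner_continuous_at X I q" using I q(3) unfolding continuous_chron_def by blast
  have "compactin X {p} \<and> {p} \<subseteq> I q" using q(1,2) by simp
  from inner[unfolded inner_continuous_at_def, rule_format, OF this]
  show "\<exists>T. openin X T \<and> q \<in> T \<and> T \<subseteq> {q. p \<in> I q}" by blast
qed

context manifold begin

text \<open>Quasi-closedness is a statement about sequences; chart balls of radius \<open>1 / n\<close> provide them.\<close>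

lemma quasi_closed_order_closure:
  assumes C: "quasi_closed_order N C" and x: "x \<in> topspace (mtop N)" and y: "y \<in> topspace (mtop N)"
    and near: "\<And>U V. openin (mtop N) U \<Longrightarrow> openin (mtop N) V \<Longrightarrow> x \<in> U \<Longrightarrow> y \<in> V \<Longrightarrow> \<exists>u\<in>U. \<exists>v\<in>V. conal_ll N C u v"
  shows "conal_le N C x y"
proof -
  obtain c d where c: "c \<in> charts_at N x" and d: "d \<in> charts_at N y" using chart_exists x y by blast
  define nb where "nb c p n = {q \<in> fst c. snd c q \<in> ball (snd c p) (inverse (real (Suc n)))}" for c :: "('a, 'e) chart" and p n
  have nb: "openin (mtop N) (nb c p n)" "p \<in> nb c p n" if "c \<in> charts_at N p" for c p n
    using openin_chart_preimage[OF charts_atD(1)[OF that] open_ball] charts_atD(2)[OF that] unfolding nb_def by auto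
  have lim: "limitin (mtop N) f p sequentially" if c: "c \<in> charts_at N p" and f: "\<And>n. f n \<in> nb c p n" for c p f
    unfolding limitin_chart[OF c]
  proof
    show "\<forall>\<^sub>F n in sequentially. f n \<in> fst c" using f unfolding nb_def by simp
    have "((\<lambda>n. dist (snd c (f n)) (snd c p)) \<longlongrightarrow> 0) sequentially"
    proof (rule real_tendsto_sandwich[OF _ _ tendsto_const LIMSEQ_inverse_real_of_nat])
      show "\<forall>\<^sub>F n in sequentially. dist (snd c (f n)) (snd c p) \<le> inverse (real (Suc n))"
        using f unfolding nb_def by (auto simp: dist_commute less_imp_le)
    qed simp
    then show "((\<lambda>n. snd c (f n)) \<longlongrightarrow> snd c p) sequentially" by (simp only: tendsto_dist_iff[of _ "snd c p"])
  qed
  have "\<exists>u v. u \<in> nb c x n \<and> v \<in> nb d y n \<and> conal_ll N C u v" for n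
    using near[OF nb(1)[OF c] nb(1)[OF d] nb(2)[OF c] nb(2)[OF d]] by blast
  then obtain u v where uv: "\<And>n. u n \<in> nb c x n" "\<And>n. v n \<in> nb d y n" "\<And>n. conal_ll N C (u n) (v n)" by metis
  from lim[OF c uv(1)] lim[OF d uv(2)] uv(3) show ?thesis
    using C unfolding quasi_closed_order_def by blast
qed

lemma conal_ll_topspace: "conal_ll N C x y \<Longrightarrow> x \<in> topspace (mtop N) \<and> y \<in> topspace (mtop N)"
  using conal_le_topspace conal_ll_le by blast

lemma openin_chron_future:
  assumes "continuous_chron (mtop N) (chron_past N C)"
  shows "openin (mtop N) (chron_future N C p)"
  using inner_continuous_openin[OF assms, of p] conal_ll_topspace[of C p]
  by (simp add: chron_past_def chron_future_def)

lemma openin_chron_past: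
  assumes "continuous_chron (mtop N) (chron_future N C)"
  shows "openin (mtop N) (chron_past N C p)"
  using inner_continuous_openin[OF assms, of p] conal_ll_topspace[of C _ p]
  by (simp add: chron_past_def chron_future_def)

lemma flow_map_C1:
  assumes \<phi>: "Ck_map 1 (prod_manifold real_line N) N (\<lambda>(t, x). \<phi> t x)"
  shows "Ck_map 1 N N (\<phi> t)"
  unfolding Ck_map_def
proof (intro conjI ballI)
  have "continuous_map (prod_topology euclideanreal (mtop N)) (mtop N) (\<lambda>(t, x). \<phi> t x)"
    using \<phi> unfolding Ck_map_def prod_manifold_def real_line_def by simp
  moreover have "continuous_map (mtop N) (prod_topology euclideanreal (mtop N)) (\<lambda>x. (t, x))"
    by (intro continuous_map_pairedI) auto
  ultimately have "continuous_map (mtop N) (mtop N) ((\<lambda>(t, x). \<phi> t x) \<circ> (\<lambda>x. (t, x)))"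
    using continuous_map_compose by blast
  then show "continuous_map (mtop N) (mtop N) (\<phi> t)" by (simp add: comp_def)
  fix c d assume cd: "c \<in> atlas N" "d \<in> atlas N"
  let ?R = "(UNIV, id) :: (real, real) chart"
  have R: "?R \<in> atlas real_line" by (simp add: real_line_def)
  have Rc: "is_chart (mtop real_line) ?R"
    unfolding is_chart_def real_line_def by (simp add: homeomorphic_map_id)
  let ?D = "{(s, y). s \<in> snd ?R ` fst ?R \<and> y \<in> snd c ` fst c \<and> \<phi> (chart_inv ?R s) (chart_inv c y) \<in> fst d}"
  have Ck: "Ck_on 1 (\<lambda>(s, y). snd d (\<phi> (chart_inv ?R s) (chart_inv c y))) ?D" and oD: "open ?D"
    by (rule Ck_map_prod_chart[OF \<phi> R Rc cd(1) is_chart[OF cd(1)] cd(2) openin_chart[OF cd(2)]])+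
  have inv: "chart_inv ?R s = s" for s by (simp add: inv_into_f_f[of id UNIV s, unfolded id_apply])
  let ?E = "snd c ` {p \<in> fst c. \<phi> t p \<in> fst d}"
  have E: "{y. (t, y) \<in> ?D} = ?E"
  proof (intro equalityI subsetI)
    fix y assume "y \<in> {y. (t, y) \<in> ?D}"
    then obtain p where p: "p \<in> fst c" "y = snd c p" "\<phi> (chart_inv ?R t) (chart_inv c y) \<in> fst d" by blast
    then have "\<phi> t p \<in> fst d" using cd(1) unfolding inv by simp
    then show "y \<in> ?E" using p by blast
  next
    fix y assume "y \<in> ?E"
    then obtain p where "p \<in> fst c" "\<phi> t p \<in> fst d" "y = snd c p" by blast
    then show "y \<in> {y. (t, y) \<in> ?D}" using cd(1) inv[of t] by simp
  qed
  have "open {y. (t, y) \<in> ?D}"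
  proof -
    have "continuous_on UNIV (Pair t :: 'e \<Rightarrow> real \<times> 'e)" by (intro continuous_intros)
    from open_vimage[OF oD this] show ?thesis by (simp add: vimage_def)
  qed
  then have oE: "open ?E" unfolding E .
  have "Ck_on 1 (\<lambda>y. (\<lambda>(s, y). snd d (\<phi> (chart_inv ?R s) (chart_inv c y))) (t, y)) {y. (t, y) \<in> ?D}"
    by (rule Ck_on_1_slice(1)[OF Ck])
  then have 1: "Ck_on 1 (\<lambda>y. snd d (\<phi> t (chart_inv c y))) ?E" unfolding E by (simp only: prod.case inv)
  show "Ck_on 1 (snd d \<circ> \<phi> t \<circ> chart_inv c) ?E"
    by (rule Ck_on_1_cong[OF oE _ 1]) simp
qed

end

theorem corollaryB:
  fixes G :: "'g monoid" and NG :: "('g, 'e::euclidean_space) manifold"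
    and H :: "'g set" and M :: "('g set, 'f::euclidean_space) manifold"
    and \<rho>G :: "'g \<Rightarrow> ('g, 'e) tangent \<Rightarrow> ('g, 'e) tangent \<Rightarrow> real"
    and \<rho>M :: "'g set \<Rightarrow> ('g set, 'f) tangent \<Rightarrow> ('g set, 'f) tangent \<Rightarrow> real"
    and C :: "'g set \<Rightarrow> ('g set, 'f) tangent set"
    and X :: "'g set \<Rightarrow> ('g set, 'f) tangent"
    and \<phi> :: "real \<Rightarrow> 'g set \<Rightarrow> 'g set"
    and \<mu> :: "'g set measure"
    and B :: "'g set set"
  assumes "lie_group G NG" and "connected_space (mtop NG)"
    and "riemannian_metric NG \<rho>G" and "invariant_metric NG (carrier G) (\<lambda>g x. g \<otimes>\<^bsub>G\<^esub> x) \<rho>G"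
    and "subgroup H G" and "closedin (mtop NG) H"
    and "homogeneous_space G NG H M"
    and "riemannian_metric M \<rho>M" and "invariant_metric M (carrier G) (lact G) \<rho>M"
    and "solid_cone_field M C" and "homogeneous_cone_field M (carrier G) (lact G) C"
    and "quasi_closed_order M C"
    and "continuous_chron (mtop M) (chron_future M C)"
    and "continuous_chron (mtop M) (chron_past M C)"
    and "Ck_vector_field 1 M X" and "is_flow_of M X \<phi>"
    and "strongly_differentially_positive M C \<phi>"
    and "\<And>x. x \<in> topspace (mtop M) \<Longrightarrow> compactin (mtop M) (mtop M closure_of orbit \<phi> x)"
    and "borel_probability (mtop M) \<mu>" and "invariant_measure \<phi> \<mu>"
    and "B \<in> connected_components_of (subtopology (mtop M) (measure_support (mtop M) \<mu>))"
  shows "(\<forall>x\<in>B. \<forall>y\<in>B. x \<noteq> y \<longrightarrow> strongly_ordered M C x y) \<or>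
         (\<forall>x\<in>B. \<forall>y\<in>B. x \<noteq> y \<longrightarrow> unordered M C x y)"
proof -
  have smooth: "smooth_manifold M" using assms(7) unfolding homogeneous_space_def by blast
  interpret M: manifold M by unfold_locales (rule smooth)
  have cone: "cone_field M C" using assms(10) unfolding solid_cone_field_def by blast
  have cc: "M.continuous_cone_field C"
    by (rule homogeneous_cone_field_continuous[OF assms(1,5,7) cone assms(11)])
  have flow: "Ck_map 1 (prod_manifold real_line M) M (\<lambda>(t, x). \<phi> t x)"
    and flow0: "\<And>x. x \<in> topspace (mtop M) \<Longrightarrow> \<phi> 0 x = x"
    and flow_add: "\<And>x s t. x \<in> topspace (mtop M) \<Longrightarrow> \<phi> (s + t) x = \<phi> s (\<phi> t x)"
    using assms(16) unfolding is_flow_of_def by blast+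
  have future: "openin (mtop M) (chron_future M C p)" and past: "openin (mtop M) (chron_past M C p)" for p
    by (rule M.openin_chron_future[OF assms(14)], rule M.openin_chron_past[OF assms(13)])
  interpret strongly_monotone_flow "mtop M" "conal_le M C" "conal_ll M C" \<phi> \<mu>
  proof
    show "Hausdorff_space (mtop M)" using smooth unfolding smooth_manifold_def by blast
    show "continuous_map (prod_topology euclideanreal (mtop M)) (mtop M) (\<lambda>(t, x). \<phi> t x)"
      using flow unfolding Ck_map_def prod_manifold_def real_line_def by simp
    show "openin (mtop M) {q. conal_ll M C p q}" "openin (mtop M) {q. conal_ll M C q p}" for p
      using future[of p] past[of p] unfolding chron_future_def chron_past_def by simp_all
    show "conal_ll M C x z" if "conal_ll M C x y" "conal_ll M C y z" for x y z
      using that by (rule M.conal_ll_trans)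
    show "\<exists>z. conal_ll M C x z \<and> conal_ll M C z y" if "conal_ll M C x y" for x y
      using that by (rule M.conal_ll_dense)
    show "conal_le M C x y" if "conal_ll M C x y" for x y using that by (rule M.conal_ll_le)
    show "conal_le M C x y" if "x \<in> topspace (mtop M)" "y \<in> topspace (mtop M)"
      "\<And>U V. openin (mtop M) U \<Longrightarrow> openin (mtop M) V \<Longrightarrow> x \<in> U \<Longrightarrow> y \<in> V \<Longrightarrow> \<exists>u\<in>U. \<exists>v\<in>V. conal_ll M C u v" for x y
      by (rule M.quasi_closed_order_closure[OF assms(12) that])
    show "conal_ll M C (\<phi> t x) (\<phi> t y)" if xy: "conal_le M C x y" "x \<noteq> y" and t: "t > 0" for x y t
    proof (rule M.strongly_positive_map_conal_ll[OF assms(10) cc M.flow_map_C1[OF flow] _ future past xy])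
      fix x assume "x \<in> topspace (mtop M)"
      then show "mdiff M M (\<phi> t) x ` (C x - {\<lambda>c. 0}) \<subseteq> cone_interior M C (\<phi> t x)"
        using assms(17) t unfolding strongly_differentially_positive_def by blast
    qed
  qed (use flow0 flow_add assms(19,20) in blast)+
  show ?thesis
    using support_component_dichotomy[OF assms(21)] unfolding strongly_ordered_def unordered_def .
qed

end
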